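(* For all integers $k\ge 1$, the averages of the first $k+1$ eigenvalues of $\mathbb{S}^2$ and $\mathbb{S}^4$ satisfy $$\frac12\,C_{W,2}(\mathbb{S}^2)\,k+\frac{k}{2(k+1)}\left|\sin\left(\pi\sqrt{k+1}\right)\right|\ \le\ \frac{1}{k+1}\sum_{j=0}^{k}\lambda_j(\mathbb{S}^2)\ \le\ \frac12\,C_{W,2}(\mathbb{S}^2)\,k+\frac12$$ and $$\frac{1}{k+1}\sum_{j=0}^{k}\lambda_j(\mathbb{S}^4)\ \le\ \frac23\,C_{W,4}(\mathbb{S}^4)\,k^{1/2}-\frac{2}{\sqrt{3k}\,(k+1)^2},$$ respectively.
   Context: $\mathbb{S}^n=\{x\in\mathbb{R}^{n+1}:\|x\|=1\}$ carries the round metric; its (closed) Laplace-Beltrami eigenvalues ($\Delta u+\lambda u=0$), repeated according to multiplicity, are $0=\lambda_0\le\lambda_1\le\lambda_2\le\dots$ (indexing starts at $0$). The Weyl constant is $C_{W,n}(M)=4\pi^2/(\omega_n|M|)^{2/n}$, with $\omega_n$ the volume of the unit ball in $\mathbb{R}^n$; for spheres $C_{W,n}(\mathbb{S}^n)=(n!/2)^{2/n}$, so $C_{W,2}(\mathbb{S}^2)=1$ and $C_{W,4}(\mathbb{S}^4)=\sqrt{12}$. Known facts: the distinct eigenvalues of $\mathbb{S}^n$ are $K(K+n-1)$, $K=0,1,2,\dots$, with multiplicity $\binom{n+K}{n}-\binom{n+K-2}{n}$ (a binomial $\binom{a}{b}$ with $a<b$ being $0$). *)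

theory Defs
  imports "HOL-Analysis.Analysis" "HOL-Library.Function_Algebras"
begin

text \<open>
  The unit sphere \<open>S\<^sup>n\<close> is \<open>sphere 0 1\<close> in a Euclidean space \<open>'a\<close> with \<open>DIM('a) = n + 1\<close>.
  A function \<open>f\<close> on the sphere is extended to the complement of the origin by
  \<open>f \<circ> sgn\<close>, where \<open>sgn y = y /\<^sub>R norm y\<close>. The extension is constant along rays, so at a
  point \<open>x\<close> of the sphere its differential annihilates the normal direction \<open>x\<close> and
  agrees on the tangent space with the differential of \<open>f\<close>.
\<close>

primrec C_k_on :: "nat \<Rightarrow> 'a::euclidean_space set \<Rightarrow> ('a \<Rightarrow> real) \<Rightarrow> bool" where
  "C_k_on 0 U f \<longleftrightarrow> continuous_on U f"
| "C_k_on (Suc k) U f \<longleftrightarrow> (\<forall>x\<in>U. f differentiable (at x)) \<and>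
     (\<forall>v\<in>Basis. C_k_on k U (\<lambda>x. frechet_derivative f (at x) v))"

definition smooth_on_sphere :: "('a::euclidean_space \<Rightarrow> real) \<Rightarrow> bool" where
  "smooth_on_sphere u \<longleftrightarrow> (\<forall>k. C_k_on k (- {0}) (u \<circ> sgn))"

text \<open>
  Gradient and divergence for the round metric. As the metric is induced from the ambient
  space, the gradient of \<open>u\<close> is the tangential gradient, and the divergence of a
  tangent field \<open>X\<close> is the trace over the tangent space of the tangential part of its
  differential. The full gradient and the full trace of the ray-constant extensions give these,
  because the normal direction contributes nothing.
\<close>

definition sphere_grad :: "('a::euclidean_space \<Rightarrow> real) \<Rightarrow> 'a \<Rightarrow> 'a" where
  "sphere_grad u x = (\<Sum>b\<in>Basis. frechet_derivative (u \<circ> sgn) (at x) b *\<^sub>R b)"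

definition sphere_div :: "('a::euclidean_space \<Rightarrow> 'a) \<Rightarrow> 'a \<Rightarrow> real" where
  "sphere_div X x = (\<Sum>b\<in>Basis. frechet_derivative (X \<circ> sgn) (at x) b \<bullet> b)"

definition laplace_beltrami :: "('a::euclidean_space \<Rightarrow> real) \<Rightarrow> 'a \<Rightarrow> real" where
  "laplace_beltrami u = sphere_div (sphere_grad u)"

text \<open>
  A function on the sphere is represented by the function on the whole space that vanishes off
  the sphere, so that the eigenspaces below are isomorphic to the usual ones.
\<close>

definition eigenspace :: "real \<Rightarrow> ('a::euclidean_space \<Rightarrow> real) set" where
  "eigenspace \<mu> = {u. (\<forall>x. x \<notin> sphere 0 1 \<longrightarrow> u x = 0) \<and> smooth_on_sphere u \<and>
     (\<forall>x\<in>sphere 0 1. laplace_beltrami u x + \<mu> * u x = 0)}"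

definition eigen_mult :: "'a::euclidean_space itself \<Rightarrow> real \<Rightarrow> nat" where
  "eigen_mult _ \<mu> =
     vector_space.dim (\<lambda>(c::real) (f::'a \<Rightarrow> real) x. c * f x) (eigenspace \<mu>)"

text \<open>
  The nondecreasing enumeration, from index \<open>0\<close>, of the eigenvalues repeated according to
  multiplicity. A real number that is not an eigenvalue has multiplicity \<open>0\<close> and is not listed.
\<close>

definition sphere_eigenvalue :: "'a::euclidean_space itself \<Rightarrow> nat \<Rightarrow> real" where
  "sphere_eigenvalue T = (THE l. mono l \<and>
     (\<forall>\<mu>. finite {j. l j = \<mu>} \<and> card {j. l j = \<mu>} = eigen_mult T \<mu>))"

text \<open>
  The volume of a compact smooth hypersurface of Euclidean space, as its
  codimension-one Minkowski content.
\<close>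

definition hypersurface_volume :: "'a::euclidean_space set \<Rightarrow> real" where
  "hypersurface_volume M =
     Lim (at_right 0) (\<lambda>\<epsilon>. measure lebesgue {y. infdist y M < \<epsilon>} / (2 * \<epsilon>))"

definition weyl_constant :: "nat \<Rightarrow> 'a::euclidean_space set \<Rightarrow> real" where
  "weyl_constant n M =
     4 * pi\<^sup>2 / (unit_ball_vol (real n) * hypersurface_volume M) powr (2 / real n)"

end

theory Submission
  imports Defs
begin

text \<open>
  Extending a function on the sphere to be constant along rays turns the ambient partial
  derivatives into derivations \<open>tder c\<close> with \<open>tder c (x \<bullet> b) = (b \<bullet> c) - (x \<bullet> b) * (x \<bullet> c)\<close>, and the
  Laplace-Beltrami operator into \<open>\<Sum>c. tder c (tder c u)\<close>. On polynomials it is triangular with respect to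
  the degree, with diagonal entries \<open>- m * (m + n - 1)\<close>; so each monomial of degree \<open>m\<close> is the leading
  term of an eigenfunction, and these eigenfunctions span the polynomials. The operator is
  symmetric for the integral over a spherical shell, by translation invariance of Lebesgue
  measure, so eigenfunctions for different eigenvalues are orthogonal; by the Stone-Weierstrass
  theorem a smooth function orthogonal to all polynomials vanishes. Hence there are no further
  eigenfunctions, and the multiplicity of the eigenvalue is the number of monomials of degree \<open>m\<close> in
  which a fixed coordinate has exponent at most one.

  Summing the eigenvalues up to an index inside the \<open>K\<close>-th level leaves two elementary inequalities.
  For \<open>S\<^sup>2\<close>, with \<open>k + 1 = K\<^sup>2 + r\<close>, twice the sum exceeds \<open>k * (k + 1)\<close> by
  \<open>r * (2 * K + 1 - r)\<close>. For \<open>S\<^sup>4\<close>, with \<open>l = K * (K + 3)\<close>, the sum is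
  \<open>l * (k + 1 - (l + 2)\<^sup>2 / 36)\<close>, a line close to a tangent of the convex upper bound.
\<close>

section \<open>Smooth functions on the sphere\<close>

text \<open>Functions vanish off the sphere, so equations on the sphere are equalities of functions
  and linear algebra applies directly. A coordinate \<open>x \<bullet> b\<close> is not such a
  function and occurs only as a multiplier.

  Monomials reduced modulo \<open>x \<bullet> x = 1\<close> take the place of harmonic polynomials
  on the ambient space: the eigenfunctions come from eliminating in a triangular system, solvable
  because its diagonal entries are distinct, and the dimension is a count of exponents. The shell
  integral serves because the gradient of a radial weight is normal, hence invisible to tangent
  fields.

  The delicate point on the two-sphere is the sine term. With \<open>w = sqrt (k + 1)\<close>,
  \<open>s\<close> its offset from \<open>K + 1/2\<close> and \<open>q = 1/4 - s^2\<close>, the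
  estimate \<open>1 - cos (pi * s) \<ge> 4 * s^2\<close> alone leaves the slack
  \<open>q * (4 - 4 * w * s - q)\<close>, which is negative when \<open>w * s > 1\<close> and
  \<open>q > 0\<close>. An extra \<open>c * s^2 * q\<close> with \<open>c\<close> slightly above 1
  repairs this for all \<open>w\<close> at once; hence the constant 11/10. On the four-sphere the
  squared inequality is an equality at \<open>k = 1\<close>, so the level \<open>K = 1\<close> is
  computed exactly.\<close>

lemma C_k_on_SucD: "C_k_on (Suc k) U f \<Longrightarrow> C_k_on k U f"
proof (induction k arbitrary: f)
  case 0
  then show ?case
    by (auto intro!: differentiable_imp_continuous_on differentiable_at_imp_differentiable_on)
next
  case (Suc k)
  then show ?case by (metis C_k_on.simps(2))
qed

lemma frechet_derivative_cong_open:
  assumes "open U" "x \<in> U" "\<And>y. y \<in> U \<Longrightarrow> f y = g y"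
  shows "frechet_derivative f (at x) = frechet_derivative g (at x)"
    and "f differentiable (at x) \<longleftrightarrow> g differentiable (at x)"
proof -
  have "(f has_derivative D) (at x) \<longleftrightarrow> (g has_derivative D) (at x)" for D
    using has_derivative_transform_within_open[OF _ assms(1,2), of f D UNIV g]
      has_derivative_transform_within_open[OF _ assms(1,2), of g D UNIV f] assms(3) by metis
  then show "frechet_derivative f (at x) = frechet_derivative g (at x)"
    and "f differentiable (at x) \<longleftrightarrow> g differentiable (at x)"
    unfolding frechet_derivative_def differentiable_def by auto
qed

lemma C_k_on_cong:
  assumes "open U" "\<And>y. y \<in> U \<Longrightarrow> f y = g y"
  shows "C_k_on k U f \<longleftrightarrow> C_k_on k U g"
  using assms(2)
proof (induction k arbitrary: f g)
  case 0
  then show ?case by (simp cong: continuous_on_cong)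
next
  case (Suc k)
  note fd = frechet_derivative_cong_open[OF assms(1) _ Suc.prems]
  have "C_k_on k U (\<lambda>x. frechet_derivative f (at x) v) = C_k_on k U (\<lambda>x. frechet_derivative g (at x) v)" for v
    by (rule Suc.IH) (simp add: fd(1) Suc.prems)
  then show ?case using fd(2) Suc.prems by auto
qed

text \<open>On an open set the Frechet derivative is unique, so any explicit formula for it may be
  used at the next level; the closure rules below differentiate by formula and never meet
  \<open>frechet_derivative\<close> of a compound term.\<close>

lemma C_k_on_SucI:
  assumes "open U"
    and "\<And>x. x \<in> U \<Longrightarrow> (f has_derivative D x) (at x)"
    and "\<And>v. v \<in> Basis \<Longrightarrow> C_k_on k U (\<lambda>x. D x v)"
  shows "C_k_on (Suc k) U f"
proof -
  have "frechet_derivative f (at x) = D x" if "x \<in> U" for x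
    using frechet_derivative_at[OF assms(2)[OF that]] by simp
  then have "C_k_on k U (\<lambda>x. frechet_derivative f (at x) v)" if "v \<in> Basis" for v
    using C_k_on_cong[OF assms(1), of "\<lambda>x. frechet_derivative f (at x) v" "\<lambda>x. D x v"] assms(3)[OF that]
    by auto
  then show ?thesis using assms(2) by (auto simp: differentiable_def)
qed

lemma C_k_on_const: "open U \<Longrightarrow> C_k_on k U (\<lambda>x. c)"
proof (induction k arbitrary: c)
  case (Suc k)
  show ?case by (rule C_k_on_SucI[where D="\<lambda>x v. 0"]) (use Suc in auto)
qed auto

lemma C_k_on_add:
  assumes "open U"
  shows "C_k_on k U f \<Longrightarrow> C_k_on k U g \<Longrightarrow> C_k_on k U (\<lambda>x. f x + g x)"
proof (induction k arbitrary: f g)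
  case (Suc k)
  show ?case
  proof (rule C_k_on_SucI[OF assms])
    fix x assume "x \<in> U"
    then show "((\<lambda>x. f x + g x) has_derivative
      (\<lambda>v. frechet_derivative f (at x) v + frechet_derivative g (at x) v)) (at x)"
      using Suc.prems by (auto intro!: has_derivative_add simp: frechet_derivative_works[symmetric])
  qed (use Suc in auto)
qed (auto intro: continuous_intros)

lemma C_k_on_mult:
  assumes "open U"
  shows "C_k_on k U f \<Longrightarrow> C_k_on k U g \<Longrightarrow> C_k_on k U (\<lambda>x. f x * g x)"
proof (induction k arbitrary: f g)
  case (Suc k)
  show ?case
  proof (rule C_k_on_SucI[OF assms])
    fix x assume "x \<in> U"
    then show "((\<lambda>x. f x * g x) has_derivative
      (\<lambda>v. f x * frechet_derivative g (at x) v + frechet_derivative f (at x) v * g x)) (at x)"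
      using Suc.prems by (auto intro!: has_derivative_mult simp: frechet_derivative_works[symmetric])
  next
    fix v :: 'a assume "v \<in> Basis"
    then show "C_k_on k U (\<lambda>x. f x * frechet_derivative g (at x) v + frechet_derivative f (at x) v * g x)"
      using Suc.prems by (intro C_k_on_add[OF assms] Suc.IH) (auto dest: C_k_on_SucD simp del: C_k_on.simps(2), auto)
  qed
qed (auto intro: continuous_intros)

lemma C_k_on_inner: "open U \<Longrightarrow> C_k_on k U (\<lambda>x. x \<bullet> c)"
proof (cases k)
  case (Suc j)
  assume "open U"
  then show ?thesis unfolding Suc
    by (intro C_k_on_SucI[where D="\<lambda>x v. v \<bullet> c"]) (auto intro!: derivative_eq_intros C_k_on_const)
qed (auto intro: continuous_intros)

lemma has_derivative_inverse_norm:
  fixes x :: "'a::real_inner"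
  assumes "x \<noteq> 0"
  shows "((\<lambda>x. inverse (norm x)) has_derivative
    (\<lambda>h. - (inverse (norm x) * (h \<bullet> sgn x) * inverse (norm x)))) (at x)"
  using assms by (intro Deriv.has_derivative_inverse has_derivative_norm) auto

text \<open>The derivative in direction \<open>v\<close> is
  \<open>- (x \<bullet> v) / norm x ^ 3\<close>, a product of a coordinate form and copies of the
  function itself, so the induction closes. This makes the inverse norm, rather than
  \<open>norm\<close> or \<open>sgn\<close>, the convenient primitive.\<close>

lemma C_k_on_inverse_norm: "C_k_on k (- {0}) (\<lambda>x. inverse (norm x))"
proof (induction k)
  case (Suc k)
  have o: "open (- {0::'a})" by auto
  show ?case
  proof (rule C_k_on_SucI[OF o])
    fix x :: 'a assume "x \<in> - {0}"
    then show "((\<lambda>x. inverse (norm x)) has_derivative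
      (\<lambda>v. (-1) * (inverse (norm x) * (inverse (norm x) * ((x \<bullet> v) * inverse (norm x)))))) (at x)"
      using has_derivative_inverse_norm[of x] by (simp add: sgn_div_norm inner_commute mult_ac)
  qed (intro C_k_on_mult[OF o] C_k_on_const[OF o] Suc C_k_on_inner[OF o])
qed (auto intro!: continuous_intros)

definition smooth_off_origin :: "('a::euclidean_space \<Rightarrow> real) \<Rightarrow> bool" where
  "smooth_off_origin f \<longleftrightarrow> (\<forall>k. C_k_on k (- {0}) f)"

lemma open_off_origin: "open (- {0::'a::euclidean_space})" by auto

lemma smooth_off_origin_cong:
  assumes "\<And>x. x \<noteq> 0 \<Longrightarrow> f x = g x"
  shows "smooth_off_origin f \<longleftrightarrow> smooth_off_origin g"
  unfolding smooth_off_origin_def using C_k_on_cong[OF open_off_origin, of f g] assms by auto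

lemma smooth_off_origin_const: "smooth_off_origin (\<lambda>x. c)"
  and smooth_off_origin_inner: "smooth_off_origin (\<lambda>x. x \<bullet> d)"
  and smooth_off_origin_inverse_norm: "smooth_off_origin (\<lambda>x. inverse (norm x))"
  by (simp_all add: smooth_off_origin_def C_k_on_const C_k_on_inner C_k_on_inverse_norm open_off_origin)

lemma smooth_off_origin_add:
    "smooth_off_origin f \<Longrightarrow> smooth_off_origin g \<Longrightarrow> smooth_off_origin (\<lambda>x. f x + g x)"
  and smooth_off_origin_mult:
    "smooth_off_origin f \<Longrightarrow> smooth_off_origin g \<Longrightarrow> smooth_off_origin (\<lambda>x. f x * g x)"
  by (simp_all add: smooth_off_origin_def C_k_on_add C_k_on_mult open_off_origin)

lemma smooth_off_origin_sum:
  "(\<And>i. i \<in> A \<Longrightarrow> smooth_off_origin (f i)) \<Longrightarrow> smooth_off_origin (\<lambda>x. \<Sum>i\<in>A. f i x)"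
  by (induction A rule: infinite_finite_induct) (auto intro: smooth_off_origin_const smooth_off_origin_add)

text \<open>No new induction is required: off the origin \<open>norm x\<close> is
  \<open>norm x ^ 2\<close> times the inverse norm, and \<open>norm x ^ 2\<close> is a polynomial in
  the coordinates.\<close>

lemma smooth_off_origin_norm: "smooth_off_origin norm"
proof -
  have "smooth_off_origin (\<lambda>x::'a. (\<Sum>b\<in>Basis. (x \<bullet> b) * (x \<bullet> b)) * inverse (norm x))"
    by (intro smooth_off_origin_mult smooth_off_origin_sum smooth_off_origin_inner smooth_off_origin_inverse_norm)
  moreover have "(\<Sum>b\<in>Basis. (x \<bullet> b) * (x \<bullet> b)) * inverse (norm x) = norm x" if "x \<noteq> 0" for x :: 'a
    using that by (simp add: dot_square_norm power2_eq_square flip: euclidean_inner)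
  ultimately show ?thesis
    using smooth_off_origin_cong[of "\<lambda>x::'a. (\<Sum>b\<in>Basis. (x \<bullet> b) * (x \<bullet> b)) * inverse (norm x)" norm] by blast
qed

lemma smooth_off_origin_differentiable:
  "smooth_off_origin f \<Longrightarrow> x \<noteq> 0 \<Longrightarrow> f differentiable (at x)"
  unfolding smooth_off_origin_def by (metis C_k_on.simps(2) ComplI singletonD)

lemma smooth_off_origin_frechet_derivative:
  "smooth_off_origin f \<Longrightarrow> v \<in> Basis \<Longrightarrow> smooth_off_origin (\<lambda>x. frechet_derivative f (at x) v)"
  unfolding smooth_off_origin_def by (metis C_k_on.simps(2))

lemma smooth_off_origin_continuous: "smooth_off_origin f \<Longrightarrow> continuous_on (- {0}) f"
  unfolding smooth_off_origin_def by (metis C_k_on.simps(1))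

section \<open>Tangential derivatives of functions on the sphere\<close>

definition sphere_smooth :: "('a::euclidean_space \<Rightarrow> real) set" where
  "sphere_smooth = {u. (\<forall>x. norm x \<noteq> 1 \<longrightarrow> u x = 0) \<and> smooth_on_sphere u}"

text \<open>On the sphere this is the \<open>c\<close>-component of the gradient, that is, the
  derivative along the tangential projection of \<open>c\<close>. The value 0 off the sphere lets it
  map \<open>sphere_smooth\<close> into itself, so that it can be iterated.\<close>

definition tder :: "'a::euclidean_space \<Rightarrow> ('a \<Rightarrow> real) \<Rightarrow> 'a \<Rightarrow> real" where
  "tder c f x = (if norm x = 1 then frechet_derivative (f \<circ> sgn) (at x) c else 0)"

definition sphere_lap :: "('a::euclidean_space \<Rightarrow> real) \<Rightarrow> 'a \<Rightarrow> real" where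
  "sphere_lap f x = (\<Sum>c\<in>Basis. tder c (tder c f) x)"

lemma sphere_smooth_iff:
  "u \<in> sphere_smooth \<longleftrightarrow> (\<forall>x. norm x \<noteq> 1 \<longrightarrow> u x = 0) \<and> smooth_off_origin (u \<circ> sgn)"
  by (simp add: sphere_smooth_def smooth_on_sphere_def smooth_off_origin_def)

lemma sphere_smooth_off: "u \<in> sphere_smooth \<Longrightarrow> norm x \<noteq> 1 \<Longrightarrow> u x = 0"
  by (simp add: sphere_smooth_def)

lemma sgn_eq_self: "norm (x::'a::real_normed_vector) = 1 \<Longrightarrow> sgn x = x"
  by (simp add: sgn_div_norm)

text \<open>A function constant along rays has a differential homogeneous of degree -1. The scaling
  factor is frozen at the point \<open>x\<close>, so the chain rule passes through a linear map
  taking \<open>x\<close> to \<open>sgn x\<close>.\<close>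

lemma frechet_derivative_ray_constant:
  fixes f :: "'a::euclidean_space \<Rightarrow> real"
  assumes "(f \<circ> sgn) differentiable (at (sgn x))" "x \<noteq> 0"
  shows "((f \<circ> sgn) has_derivative (\<lambda>v. frechet_derivative (f \<circ> sgn) (at (sgn x)) v / norm x)) (at x)"
proof -
  let ?F = "f \<circ> sgn"
  let ?s = "\<lambda>y. y /\<^sub>R norm x"
  have eq: "?F = ?F \<circ> ?s"
    using assms(2) by (simp add: fun_eq_iff sgn_scaleR)
  have lin: "linear (frechet_derivative ?F (at (sgn x)))"
    using assms(1) linear_frechet_derivative by blast
  have "(?s has_derivative (\<lambda>v. v /\<^sub>R norm x)) (at x)"
    by (auto intro!: derivative_eq_intros)
  moreover have "(?F has_derivative frechet_derivative ?F (at (sgn x))) (at (?s x))"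
    using assms(1) by (simp add: sgn_div_norm frechet_derivative_works[symmetric])
  ultimately have "((?F \<circ> ?s) has_derivative (frechet_derivative ?F (at (sgn x)) \<circ> (\<lambda>v. v /\<^sub>R norm x))) (at x)"
    by (rule diff_chain_at)
  moreover have "frechet_derivative ?F (at (sgn x)) \<circ> (\<lambda>v. v /\<^sub>R norm x)
      = (\<lambda>v. frechet_derivative ?F (at (sgn x)) v / norm x)"
    using lin by (simp add: fun_eq_iff linear_scale divide_inverse mult.commute)
  ultimately show ?thesis using eq by metis
qed

lemma norm_sgn_nz: "x \<noteq> 0 \<Longrightarrow> norm (sgn (x::'a::real_normed_vector)) = 1"
  by (simp add: norm_sgn)

lemma sphere_smooth_has_derivative:
  assumes "f \<in> sphere_smooth" "x \<noteq> 0"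
  shows "((f \<circ> sgn) has_derivative (\<lambda>v. \<Sum>b\<in>Basis. (v \<bullet> b) * (tder b f (sgn x) / norm x))) (at x)"
proof -
  let ?D = "frechet_derivative (f \<circ> sgn) (at (sgn x))"
  have sx: "sgn x \<noteq> 0" using assms(2) by (simp add: sgn_zero_iff)
  have d: "(f \<circ> sgn) differentiable (at (sgn x))"
    using assms(1) sx smooth_off_origin_differentiable unfolding sphere_smooth_iff by blast
  have eq: "?D v = (\<Sum>b\<in>Basis. (v \<bullet> b) * ?D b)" for v
  proof -
    have "?D v = ?D (\<Sum>b\<in>Basis. (v \<bullet> b) *\<^sub>R b)" by (simp add: euclidean_representation)
    also have "\<dots> = (\<Sum>b\<in>Basis. (v \<bullet> b) * ?D b)"
      using linear_frechet_derivative[OF d] by (simp add: linear_sum linear_scale)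
    finally show ?thesis .
  qed
  have "?D v / norm x = (\<Sum>b\<in>Basis. (v \<bullet> b) * (tder b f (sgn x) / norm x))" for v
    by (subst eq) (simp add: tder_def norm_sgn_nz[OF assms(2)] sum_divide_distrib)
  then show ?thesis using frechet_derivative_ray_constant[OF d assms(2)] by simp
qed

lemma tder_unique:
  assumes "((f \<circ> sgn) has_derivative D) (at x)" "norm x = 1"
  shows "tder c f x = D c"
  using assms frechet_derivative_at[OF assms(1)] by (simp add: tder_def)

text \<open>Multiplying the ambient partial derivative by \<open>norm x\<close> undoes its
  homogeneity of degree -1 and yields exactly the ray-constant extension of \<open>tder c f\<close>;
  smoothness is read off from this product.\<close>

lemma tder_in_sphere_smooth:
  assumes "f \<in> sphere_smooth" "c \<in> Basis"
  shows "tder c f \<in> sphere_smooth"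
proof -
  have f: "smooth_off_origin (f \<circ> sgn)" using assms by (simp add: sphere_smooth_iff)
  have "(tder c f \<circ> sgn) x = norm x * frechet_derivative (f \<circ> sgn) (at x) c" if "x \<noteq> 0" for x
  proof -
    have sx: "sgn x \<noteq> 0" using that by (simp add: sgn_zero_iff)
    have d: "(f \<circ> sgn) differentiable (at (sgn x))"
      using f sx smooth_off_origin_differentiable by blast
    have "frechet_derivative (f \<circ> sgn) (at x) c = frechet_derivative (f \<circ> sgn) (at (sgn x)) c / norm x"
      using fun_cong[OF frechet_derivative_at[OF frechet_derivative_ray_constant[OF d that]], of c] by simp
    then show ?thesis
      using that by (simp add: tder_def norm_sgn_nz)
  qed
  moreover have "smooth_off_origin (\<lambda>x. norm x * frechet_derivative (f \<circ> sgn) (at x) c)"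
    by (intro smooth_off_origin_mult smooth_off_origin_norm smooth_off_origin_frechet_derivative f assms)
  ultimately show ?thesis
    using smooth_off_origin_cong[of "tder c f \<circ> sgn"] by (auto simp: sphere_smooth_iff tder_def)
qed

text \<open>Tangency of the gradient: along the ray through \<open>x\<close> the extension is
  constant, and its derivative there is this sum.\<close>

lemma tder_radial:
  assumes "f \<in> sphere_smooth" "norm x = 1"
  shows "(\<Sum>c\<in>Basis. (x \<bullet> c) * tder c f x) = 0"
proof -
  have x: "x \<noteq> 0" using assms(2) by auto
  let ?F = "f \<circ> sgn"
  have 1: "((\<lambda>t::real. (1 + t) *\<^sub>R x) has_derivative (\<lambda>t. t *\<^sub>R x)) (at 0)"
    by (auto intro!: derivative_eq_intros)
  have "(?F has_derivative (\<lambda>v. \<Sum>b\<in>Basis. (v \<bullet> b) * tder b f x)) (at x)"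
    using sphere_smooth_has_derivative[OF assms(1) x] assms(2) by (simp add: sgn_eq_self)
  then have "(?F \<circ> (\<lambda>t::real. (1 + t) *\<^sub>R x) has_derivative
     (\<lambda>v. \<Sum>b\<in>Basis. (v \<bullet> b) * tder b f x) \<circ> (\<lambda>t. t *\<^sub>R x)) (at 0)"
    using 1 by (intro diff_chain_at) auto
  then have "((\<lambda>t. ?F x) has_derivative
     (\<lambda>v. \<Sum>b\<in>Basis. (v \<bullet> b) * tder b f x) \<circ> (\<lambda>t. t *\<^sub>R x)) (at (0::real))"
    by (rule has_derivative_transform_within_open[where s="{-1<..}"]) (auto simp: sgn_scaleR)
  moreover have "((\<lambda>t. ?F x) has_derivative (\<lambda>_. 0)) (at (0::real))" by simp
  ultimately have "(\<lambda>v. \<Sum>b\<in>Basis. (v \<bullet> b) * tder b f x) \<circ> (\<lambda>t::real. t *\<^sub>R x) = (\<lambda>_. 0)"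
    by (rule has_derivative_unique)
  from fun_cong[OF this, of 1] show ?thesis by simp
qed

lemma inner_sum_left_Basis: "b \<in> Basis \<Longrightarrow> (\<Sum>c\<in>Basis. g c *\<^sub>R c) \<bullet> b = g b"
  by simp

lemma basis_contract: "c \<in> Basis \<Longrightarrow> (\<Sum>b\<in>Basis. (c \<bullet> b) * g b) = (g c :: real)"
  by (simp add: inner_Basis if_distrib if_distribR sum.delta cong: if_cong)

text \<open>The gradient field extended along rays has the components
  \<open>tder c f \<circ> sgn\<close>; the trace of its differential picks from each component the
  derivative in its own direction. The result is the sum of squares of the projected coordinate
  fields.\<close>

lemma laplace_beltrami_eq_sphere_lap:
  assumes "f \<in> sphere_smooth" "norm x = 1"
  shows "laplace_beltrami f x = sphere_lap f x"
proof -
  have x: "x \<noteq> 0" using assms(2) by auto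
  have "((\<lambda>y. \<Sum>c\<in>Basis. (tder c f \<circ> sgn) y *\<^sub>R c) has_derivative
     (\<lambda>v. \<Sum>c\<in>Basis. (\<Sum>b\<in>Basis. (v \<bullet> b) * (tder b (tder c f) (sgn x) / norm x)) *\<^sub>R c)) (at x)"
    by (intro has_derivative_sum has_derivative_scaleR_left sphere_smooth_has_derivative tder_in_sphere_smooth
         assms x)
  then have "((sphere_grad f \<circ> sgn) has_derivative
     (\<lambda>v. \<Sum>c\<in>Basis. (\<Sum>b\<in>Basis. (v \<bullet> b) * (tder b (tder c f) (sgn x) / norm x)) *\<^sub>R c)) (at x)"
    by (rule has_derivative_transform_within_open[where s="- {0}"])
       (use x in \<open>auto simp: sphere_grad_def tder_def norm_sgn_nz\<close>)
  from frechet_derivative_at[OF this]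
  have "frechet_derivative (sphere_grad f \<circ> sgn) (at x) b
      = (\<Sum>c\<in>Basis. (\<Sum>a\<in>Basis. (b \<bullet> a) * tder a (tder c f) x) *\<^sub>R c)" for b
    using assms(2) by (simp add: sgn_eq_self fun_eq_iff)
  then have "frechet_derivative (sphere_grad f \<circ> sgn) (at x) b \<bullet> b = tder b (tder b f) x"
    if "b \<in> Basis" for b
    using inner_sum_left_Basis[OF that] basis_contract[OF that] by simp
  then show ?thesis
    unfolding laplace_beltrami_def sphere_div_def sphere_lap_def by (rule sum.cong[OF refl])
qed

lemma sphere_smooth_zero: "(\<lambda>x. 0) \<in> sphere_smooth"
  by (simp add: sphere_smooth_iff comp_def smooth_off_origin_const)

lemma sphere_smooth_add:
  "f \<in> sphere_smooth \<Longrightarrow> g \<in> sphere_smooth \<Longrightarrow> (\<lambda>x. f x + g x) \<in> sphere_smooth"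
  and sphere_smooth_mult:
  "f \<in> sphere_smooth \<Longrightarrow> g \<in> sphere_smooth \<Longrightarrow> (\<lambda>x. f x * g x) \<in> sphere_smooth"
  and sphere_smooth_scale:
  "f \<in> sphere_smooth \<Longrightarrow> (\<lambda>x. a * f x) \<in> sphere_smooth"
  by (auto simp: sphere_smooth_iff comp_def intro: smooth_off_origin_add smooth_off_origin_mult smooth_off_origin_const)

lemma sphere_smooth_uminus: "f \<in> sphere_smooth \<Longrightarrow> (\<lambda>x. - f x) \<in> sphere_smooth"
  using sphere_smooth_scale[of f "-1"] by simp

lemma sphere_smooth_diff:
  "f \<in> sphere_smooth \<Longrightarrow> g \<in> sphere_smooth \<Longrightarrow> (\<lambda>x. f x - g x) \<in> sphere_smooth"
  using sphere_smooth_add[OF _ sphere_smooth_uminus, of f g] by simp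

lemma sphere_smooth_coord: "f \<in> sphere_smooth \<Longrightarrow> (\<lambda>x. (x \<bullet> c) * f x) \<in> sphere_smooth"
proof -
  assume f: "f \<in> sphere_smooth"
  have "smooth_off_origin (\<lambda>x. ((x \<bullet> c) * inverse (norm x)) * (f \<circ> sgn) x)"
    using f by (intro smooth_off_origin_mult smooth_off_origin_inner smooth_off_origin_inverse_norm)
       (simp add: sphere_smooth_iff comp_def)
  also have "(\<lambda>x. ((x \<bullet> c) * inverse (norm x)) * (f \<circ> sgn) x) = (\<lambda>x. (x \<bullet> c) * f x) \<circ> sgn"
    by (simp add: fun_eq_iff sgn_div_norm)
  finally show ?thesis using f unfolding sphere_smooth_iff by (simp add: comp_def)
qed

definition sphere_one :: "'a::euclidean_space \<Rightarrow> real" where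
  "sphere_one x = (if norm x = 1 then 1 else 0)"

lemma sphere_smooth_one: "sphere_one \<in> sphere_smooth"
proof -
  have "smooth_off_origin (sphere_one \<circ> (sgn :: 'a \<Rightarrow> 'a)) \<longleftrightarrow> smooth_off_origin (\<lambda>x::'a. 1)"
    by (rule smooth_off_origin_cong) (auto simp: sphere_one_def norm_sgn_nz)
  then show ?thesis by (simp add: sphere_smooth_iff smooth_off_origin_const) (simp add: sphere_one_def)
qed

lemma sphere_smooth_has_derivative_sphere:
  assumes "f \<in> sphere_smooth" "norm x = 1"
  shows "((f \<circ> sgn) has_derivative (\<lambda>v. \<Sum>b\<in>Basis. (v \<bullet> b) * tder b f x)) (at x)"
proof -
  have "x \<noteq> 0" using assms(2) by auto
  from sphere_smooth_has_derivative[OF assms(1) this] assms(2) show ?thesis by (simp add: sgn_eq_self)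
qed

lemma tder_off: "norm x \<noteq> 1 \<Longrightarrow> tder c f x = 0" by (simp add: tder_def)

lemma tder_add:
  assumes "f \<in> sphere_smooth" "g \<in> sphere_smooth" "c \<in> Basis"
  shows "tder c (\<lambda>x. f x + g x) = (\<lambda>x. tder c f x + tder c g x)"
proof
  fix x show "tder c (\<lambda>x. f x + g x) x = tder c f x + tder c g x"
  proof (cases "norm x = 1")
    case True
    from has_derivative_add[OF sphere_smooth_has_derivative_sphere[OF assms(1) True]
        sphere_smooth_has_derivative_sphere[OF assms(2) True]]
    have "((\<lambda>x. f x + g x) \<circ> sgn has_derivative (\<lambda>v. (\<Sum>b\<in>Basis. (v \<bullet> b) * tder b f x) + (\<Sum>b\<in>Basis. (v \<bullet> b) * tder b g x))) (at x)"
      by (simp add: comp_def sgn_eq_self[OF True])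
    from tder_unique[OF this True, of c] show ?thesis
      using assms(3) by (simp add: basis_contract)
  qed (simp add: tder_off)
qed

lemma tder_mult:
  assumes "f \<in> sphere_smooth" "g \<in> sphere_smooth" "c \<in> Basis"
  shows "tder c (\<lambda>x. f x * g x) = (\<lambda>x. f x * tder c g x + tder c f x * g x)"
proof
  fix x show "tder c (\<lambda>x. f x * g x) x = f x * tder c g x + tder c f x * g x"
  proof (cases "norm x = 1")
    case True
    from has_derivative_mult[OF sphere_smooth_has_derivative_sphere[OF assms(1) True]
        sphere_smooth_has_derivative_sphere[OF assms(2) True]]
    have "((\<lambda>x. f x * g x) \<circ> sgn has_derivative (\<lambda>v. f x * (\<Sum>b\<in>Basis. (v \<bullet> b) * tder b g x) + (\<Sum>b\<in>Basis. (v \<bullet> b) * tder b f x) * g x)) (at x)"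
      by (simp add: comp_def sgn_eq_self[OF True])
    from tder_unique[OF this True, of c] show ?thesis
      using assms(3) by (simp add: basis_contract)
  qed (simp add: tder_off)
qed

lemma tder_scale:
  assumes "f \<in> sphere_smooth" "c \<in> Basis"
  shows "tder c (\<lambda>x. a * f x) = (\<lambda>x. a * tder c f x)"
proof
  fix x show "tder c (\<lambda>x. a * f x) x = a * tder c f x"
  proof (cases "norm x = 1")
    case True
    from has_derivative_mult_right[OF sphere_smooth_has_derivative_sphere[OF assms(1) True], of a]
    have "((\<lambda>x. a * f x) \<circ> sgn has_derivative (\<lambda>v. a * (\<Sum>b\<in>Basis. (v \<bullet> b) * tder b f x))) (at x)"
      by (simp add: comp_def sgn_eq_self[OF True])
    from tder_unique[OF this True, of c] show ?thesis
      using assms(2) by (simp add: basis_contract)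
  qed (simp add: tder_off)
qed

lemma tder_diff:
  assumes "f \<in> sphere_smooth" "g \<in> sphere_smooth" "c \<in> Basis"
  shows "tder c (\<lambda>x. f x - g x) = (\<lambda>x. tder c f x - tder c g x)"
  using tder_add[OF assms(1) sphere_smooth_scale[OF assms(2), of "-1"] assms(3)] 
    tder_scale[OF assms(2,3), of "-1"] by simp

lemma tder_one: "tder c sphere_one = (\<lambda>x. 0)"
proof
  fix x show "tder c sphere_one x = 0"
  proof (cases "norm x = 1")
    case True
    have "((\<lambda>x. 1) has_derivative (\<lambda>_. 0)) (at x)" by simp
    then have "((sphere_one \<circ> sgn) has_derivative (\<lambda>_. 0)) (at x)"
      by (rule has_derivative_transform_within_open[where s="- {0}"])
         (use True in \<open>auto simp: sphere_one_def norm_sgn_nz\<close>)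
    from tder_unique[OF this True] show ?thesis .
  qed (simp add: tder_off)
qed

text \<open>A product rule of its own, because \<open>x \<bullet> b\<close> does not vanish off the
  sphere and \<open>tder_mult\<close> does not cover it. On the sphere the extension
  \<open>(y \<bullet> b) / norm y\<close> has the derivative
  \<open>b \<bullet> c - (x \<bullet> b) * (x \<bullet> c)\<close> in direction
  \<open>c\<close>.\<close>

lemma tder_coord:
  assumes "f \<in> sphere_smooth" "b \<in> Basis" "c \<in> Basis"
  shows "tder c (\<lambda>x. (x \<bullet> b) * f x) =
    (\<lambda>x. (x \<bullet> b) * tder c f x + ((if b = c then 1 else 0) - (x \<bullet> b) * (x \<bullet> c)) * f x)"
proof
  fix x show "tder c (\<lambda>x. (x \<bullet> b) * f x) x =
    (x \<bullet> b) * tder c f x + ((if b = c then 1 else 0) - (x \<bullet> b) * (x \<bullet> c)) * f x"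
  proof (cases "norm x = 1")
    case True
    then have x: "x \<noteq> 0" by auto
    have "((\<lambda>y. (y \<bullet> b) * inverse (norm y)) has_derivative (\<lambda>v. v \<bullet> b - (x \<bullet> b) * (x \<bullet> v))) (at x)"
      by (rule has_derivative_eq_rhs[OF has_derivative_mult[OF has_derivative_inner_left[OF has_derivative_ident]
            has_derivative_inverse_norm[OF x]]])
         (use True in \<open>simp add: sgn_eq_self fun_eq_iff inner_commute\<close>)
    from has_derivative_mult[OF this sphere_smooth_has_derivative_sphere[OF assms(1) True]]
    have "(((\<lambda>x. (x \<bullet> b) * f x) \<circ> sgn) has_derivative (\<lambda>v. (x \<bullet> b) * (\<Sum>b\<in>Basis. (v \<bullet> b) * tder b f x)
         + (v \<bullet> b - (x \<bullet> b) * (x \<bullet> v)) * f x)) (at x)"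
      using True by (simp add: comp_def sgn_div_norm mult.commute)
    from tder_unique[OF this True, of c] show ?thesis
      using assms inner_Basis[OF assms(3,2)] by (auto simp only: basis_contract split: if_splits)
  qed (use sphere_smooth_off[OF assms(1)] in \<open>simp add: tder_off\<close>)
qed

section \<open>Symmetry of the Laplace-Beltrami operator\<close>

lemma integrable_compact_support:
  fixes f :: "'a::euclidean_space \<Rightarrow> real"
  assumes "continuous_on UNIV f" "\<And>x. norm x > R \<Longrightarrow> f x = 0"
  shows "integrable lborel f"
proof -
  have "integrable lborel (\<lambda>x. indicator (cball 0 R) x *\<^sub>R f x)"
    by (intro borel_integrable_compact continuous_on_subset[OF assms(1)]) auto
  also have "(\<lambda>x. indicator (cball 0 R) x *\<^sub>R f x) = f"
    using assms(2) by (auto simp: indicator_def fun_eq_iff not_le)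
  finally show ?thesis .
qed

lemma integral_lborel_translate:
  fixes F :: "'a::euclidean_space \<Rightarrow> real"
  assumes "F \<in> borel_measurable borel"
  shows "(\<integral>x. F (c + x) \<partial>lborel) = (\<integral>x. F x \<partial>lborel)"
proof -
  have "(\<integral>x. F x \<partial>lborel) = (\<integral>x. F x \<partial>(distr lborel borel ((+) c)))"
    by (simp add: lborel_distr_plus)
  also have "\<dots> = (\<integral>x. F (c + x) \<partial>lborel)"
    using assms by (intro integral_distr) auto
  finally show ?thesis by simp
qed

text \<open>The difference quotients have integral zero by translation invariance and converge boundedly.\<close>
lemma integral_directional_derivative_eq_0:
  fixes F :: "'a::euclidean_space \<Rightarrow> real"
  assumes der: "\<And>x. (F has_derivative D x) (at x)"
    and cont: "continuous_on UNIV (\<lambda>x. D x c)"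
    and supp: "\<And>x. norm x > R \<Longrightarrow> F x = 0"
  shows "(\<integral>x. D x c \<partial>lborel) = 0"
proof -
  have contF: "continuous_on UNIV F"
    using der by (meson continuous_at_imp_continuous_on has_derivative_continuous)
  have line: "((\<lambda>t::real. F (x + t *\<^sub>R c)) has_real_derivative D (x + t *\<^sub>R c) c) (at t)" for x t
  proof -
    have "((\<lambda>t::real. x + t *\<^sub>R c) has_derivative (\<lambda>s. s *\<^sub>R c)) (at t)"
      by (auto intro!: derivative_eq_intros)
    from diff_chain_at[OF this der]
    have "((\<lambda>t::real. F (x + t *\<^sub>R c)) has_derivative (\<lambda>s. D (x + t *\<^sub>R c) (s *\<^sub>R c))) (at t)"
      by (simp add: comp_def)
    moreover have "D (x + t *\<^sub>R c) (s *\<^sub>R c) = D (x + t *\<^sub>R c) c * s" for s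
      using linear_scale[OF has_derivative_linear[OF der]] by (simp add: mult.commute)
    ultimately show ?thesis by (simp add: has_field_derivative_def)
  qed
  define u where "u n x = (F (x + (1 / real (Suc n)) *\<^sub>R c) - F x) * real (Suc n)" for n x
  \<comment> \<open>The steps are at most \<open>norm c\<close> long. Beyond radius
    \<open>\<bar>R\<bar> + norm c\<close> both values in the quotient vanish; within it, the
    intermediate point of the mean value theorem stays in this ball, so one bound \<open>M\<close>
    serves everywhere.\<close>
  let ?K = "cball (0::'a) (\<bar>R\<bar> + 2 * norm c)"
  have "bounded ((\<lambda>x. D x c) ` ?K)"
    by (intro compact_imp_bounded compact_continuous_image continuous_on_subset[OF cont]) auto
  then obtain M where M: "\<And>x. x \<in> ?K \<Longrightarrow> \<bar>D x c\<bar> \<le> M"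
    unfolding bounded_iff by (metis image_eqI real_norm_def)
  have int_F: "integrable lborel F" using integrable_compact_support[OF contF supp] .
  have bm: "F \<in> borel_measurable borel" using contF by (rule borel_measurable_continuous_onI)
  have tr: "(\<integral>x. F (x + a) \<partial>lborel) = (\<integral>x. F x \<partial>lborel)" for a
    using integral_lborel_translate[OF bm, of a] by (simp add: add.commute)
  have int_Ft: "integrable lborel (\<lambda>x. F (x + a))" for a
  proof (rule integrable_compact_support[where R="R + norm a"])
    show "continuous_on UNIV (\<lambda>x. F (x + a))"
      by (rule continuous_on_compose2[OF contF]) (auto intro!: continuous_intros)
    fix x :: 'a assume "norm x > R + norm a"
    then show "F (x + a) = 0" using norm_diff_ineq[of x a] by (intro supp) linarith
  qed
  have int_u: "(\<integral>x. u n x \<partial>lborel) = 0" for n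
    unfolding u_def using int_F int_Ft by (simp add: tr)
  have "(\<lambda>n. \<integral>x. u n x \<partial>lborel) \<longlonglongrightarrow> (\<integral>x. D x c \<partial>lborel)"
  proof (rule integral_dominated_convergence[where w="\<lambda>x. indicator ?K x * M"])
    show "(\<lambda>x. D x c) \<in> borel_measurable lborel"
      using borel_measurable_continuous_onI[OF cont] by simp
    show "u n \<in> borel_measurable lborel" for n
    proof -
      have "integrable lborel (u n)" unfolding u_def using int_F int_Ft by auto
      then show ?thesis by auto
    qed
    show "integrable lborel (\<lambda>x. indicator ?K x * M)"
      by (intro integrable_mult_left integrable_real_indicator emeasure_compact_finite) auto
    show "AE x in lborel. (\<lambda>n. u n x) \<longlonglongrightarrow> D x c"
    proof (rule AE_I2)
      fix x
      have "((\<lambda>h. (F (x + h *\<^sub>R c) - F x) / h) \<longlongrightarrow> D x c) (at 0)"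
        using line[of x 0] by (simp add: DERIV_def)
      moreover have "filterlim (\<lambda>n. 1 / real (Suc n)) (at 0) sequentially"
        using LIMSEQ_inverse_real_of_nat by (simp add: filterlim_at inverse_eq_divide)
      ultimately have "((\<lambda>n. (F (x + (1 / real (Suc n)) *\<^sub>R c) - F x) / (1 / real (Suc n))) \<longlonglongrightarrow> D x c)"
        by (rule filterlim_compose)
      then show "(\<lambda>n. u n x) \<longlonglongrightarrow> D x c" by (simp add: u_def)
    qed
    show "AE x in lborel. norm (u n x) \<le> indicator ?K x * M" for n
    proof (rule AE_I2)
      fix x
      let ?h = "1 / real (Suc n)"
      have h: "0 < ?h" "?h \<le> 1" by auto
      have hc: "norm (?h *\<^sub>R c) \<le> norm c" using mult_left_le_one_le[OF norm_ge_zero _ h(2), of c] by simp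
      show "norm (u n x) \<le> indicator ?K x * M"
      proof (cases "norm x \<le> \<bar>R\<bar> + norm c")
        case True
        have "\<exists>z>0. z < ?h \<and> F (x + ?h *\<^sub>R c) - F (x + 0 *\<^sub>R c) = (?h - 0) * D (x + z *\<^sub>R c) c"
          using MVT2[OF h(1), of "\<lambda>t. F (x + t *\<^sub>R c)" "\<lambda>t. D (x + t *\<^sub>R c) c"] line by blast
        then obtain z where z: "0 < z" "z < ?h" "F (x + ?h *\<^sub>R c) - F x = ?h * D (x + z *\<^sub>R c) c"
          by auto
        have "z \<le> 1" using z(2) h(2) by linarith
        then have "norm (z *\<^sub>R c) \<le> norm c" using z mult_left_le_one_le[OF norm_ge_zero, of z c] by simp
        then have "norm (x + z *\<^sub>R c) \<le> \<bar>R\<bar> + 2 * norm c"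
          using True norm_triangle_ineq[of x "z *\<^sub>R c"] by linarith
        then have "\<bar>D (x + z *\<^sub>R c) c\<bar> \<le> M" by (intro M) simp
        moreover have "u n x = D (x + z *\<^sub>R c) c" unfolding u_def z(3) by simp
        moreover have "x \<in> ?K" using True norm_ge_zero[of c] by (simp del: norm_ge_zero)
        ultimately show ?thesis by simp
      next
        case False
        then have "R < norm x" "R < norm (x + ?h *\<^sub>R c)"
          using norm_diff_ineq[of x "?h *\<^sub>R c"] hc norm_ge_zero[of c] by linarith+
        then have "F x = 0" "F (x + ?h *\<^sub>R c) = 0" by (auto intro: supp)
        moreover have "0 \<le> M" using M[of 0] by force
        ultimately show ?thesis by (simp add: u_def)
      qed
    qed
  qed
  then show ?thesis by (simp add: int_u LIMSEQ_const_iff)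
qed

section \<open>A radial weight and the integral over the shell\<close>

lemma DERIV_positive_part_square:
  "((\<lambda>y::real. (max 0 y)\<^sup>2) has_real_derivative 2 * max 0 y) (at y)"
proof -
  consider "y < 0" | "y = 0" | "y > 0" by linarith
  then show ?thesis
  proof cases
    case 1
    have "((\<lambda>y::real. 0) has_real_derivative 0) (at y)" by simp
    then show ?thesis
      using 1 has_field_derivative_transform_within_open[of "\<lambda>y. 0" 0 y "{..<0}" "\<lambda>y. (max 0 y)\<^sup>2"]
      by (simp add: max_def)
  next
    case 2
    have "((\<lambda>h::real. max 0 h) \<longlongrightarrow> max 0 0) (at 0)" by (intro tendsto_intros)
    moreover have "\<forall>\<^sub>F h::real in at 0. max 0 h = (max 0 h)\<^sup>2 / h"
      by (auto simp: eventually_at_filter max_def power2_eq_square)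
    ultimately have "((\<lambda>h::real. (max 0 h)\<^sup>2 / h) \<longlongrightarrow> max 0 0) (at 0)"
      by (rule Lim_transform_eventually)
    then show ?thesis using 2 by (simp add: DERIV_def)
  next
    case 3
    have "((\<lambda>y::real. y\<^sup>2) has_real_derivative 2 * y) (at y)" by (auto intro!: derivative_eq_intros)
    then show ?thesis
      using 3 has_field_derivative_transform_within_open[of "\<lambda>y. y\<^sup>2" "2 * y" y "{0<..}" "\<lambda>y. (max 0 y)\<^sup>2"]
      by (simp add: max_def)
  qed
qed

text \<open>A radial cutoff positive exactly on the shell between radii 1 and 2, away from the
  origin, where \<open>sgn\<close> is discontinuous. Squaring the positive part makes it
  continuously differentiable, all that a single integration by parts requires.\<close>

definition bump :: "'a::euclidean_space \<Rightarrow> real" where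
  "bump x = (max 0 ((x \<bullet> x - 1) * (4 - x \<bullet> x)))\<^sup>2"

definition bump_slope :: "'a::euclidean_space \<Rightarrow> real" where
  "bump_slope x = 4 * max 0 ((x \<bullet> x - 1) * (4 - x \<bullet> x)) * (5 - 2 * (x \<bullet> x))"

lemma bump_has_derivative: "(bump has_derivative (\<lambda>v. bump_slope x * (x \<bullet> v))) (at x)"
proof -
  have "((\<lambda>x. (x \<bullet> x - 1) * (4 - x \<bullet> x)) has_derivative (\<lambda>v. (5 - 2 * (x \<bullet> x)) * (2 * (x \<bullet> v)))) (at x)"
    by (auto intro!: derivative_eq_intros simp: inner_commute algebra_simps)
  from has_derivative_compose[OF this DERIV_positive_part_square[unfolded has_field_derivative_def]]
  show ?thesis unfolding bump_def[abs_def] bump_slope_def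
    by (rule has_derivative_eq_rhs) (simp add: fun_eq_iff)
qed

lemma bump_nonneg: "bump x \<ge> 0" by (simp add: bump_def)

lemma bump_pos: "1 < norm x \<Longrightarrow> norm x < 2 \<Longrightarrow> bump x > 0"
proof -
  assume "1 < norm x" "norm x < 2"
  then have "1 < x \<bullet> x" "x \<bullet> x < 4"
    using power_strict_mono[of "norm x" 2 2] one_less_power[of "norm x" 2] unfolding dot_square_norm by auto
  then have "0 < (x \<bullet> x - 1) * (4 - x \<bullet> x)" by simp
  then show ?thesis unfolding bump_def by (metis max.absorb4 zero_less_power)
qed

lemma annulus_cutoff_eq_0:
  assumes "norm x \<le> 1 \<or> norm x \<ge> 2"
  shows "max 0 ((x \<bullet> x - 1) * (4 - x \<bullet> x)) = 0"
proof -
  have "x \<bullet> x \<le> 1 \<or> x \<bullet> x \<ge> 4"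
    using assms power_mono[of "norm x" 1 2] power_mono[of 2 "norm x" 2] by (auto simp: dot_square_norm)
  then have "(x \<bullet> x - 1) * (4 - x \<bullet> x) \<le> 0" by (auto simp: mult_le_0_iff)
  then show ?thesis by simp
qed

lemma bump_eq_0: "norm x \<le> 1 \<or> norm x \<ge> 2 \<Longrightarrow> bump x = 0"
  and bump_slope_eq_0: "norm x \<le> 1 \<or> norm x \<ge> 2 \<Longrightarrow> bump_slope x = 0"
  using annulus_cutoff_eq_0[of x] by (simp_all add: bump_def bump_slope_def)

lemma continuous_on_bump: "continuous_on S bump" and continuous_on_bump_slope: "continuous_on S bump_slope"
  unfolding bump_def[abs_def] bump_slope_def[abs_def] by (intro continuous_intros)+

lemma continuous_on_cutoff:
  fixes w :: "'a::euclidean_space \<Rightarrow> real"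
  assumes "continuous_on (- {0}) w" "\<And>x. norm x \<le> 1 \<Longrightarrow> w x = 0"
  shows "continuous_on UNIV w"
proof -
  have "continuous_on (ball 0 1) w"
    using continuous_on_cong[of "ball 0 1" "ball 0 1" w "\<lambda>x. 0"] assms(2) by auto
  then have "continuous_on (- {0} \<union> ball 0 1) w"
    using assms(1) by (intro continuous_on_open_Un) auto
  moreover have "- {0} \<union> ball (0::'a) 1 = UNIV" by auto
  ultimately show ?thesis by simp
qed

text \<open>In polar coordinates this is a positive constant times the surface integral over the
  sphere. The factor \<open>1 / norm x\<close> is the one that arises when a ray-constant function
  is differentiated away from the sphere, so the derivatives of \<open>h \<circ> sgn\<close>
  weighted by \<open>bump\<close> again have this form.\<close>

definition sphint :: "('a::euclidean_space \<Rightarrow> real) \<Rightarrow> real" where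
  "sphint f = (\<integral>x. bump x / norm x * f (sgn x) \<partial>lborel)"

lemma sphere_smooth_continuous: "f \<in> sphere_smooth \<Longrightarrow> continuous_on (- {0}) (\<lambda>x. f (sgn x))"
  using smooth_off_origin_continuous[of "f \<circ> sgn"] by (simp add: sphere_smooth_iff comp_def)

lemma continuous_sphint_integrand:
  assumes "f \<in> sphere_smooth"
  shows "continuous_on UNIV (\<lambda>x. bump x / norm x * f (sgn x))"
  by (rule continuous_on_cutoff)
     (auto intro!: continuous_intros sphere_smooth_continuous assms continuous_on_bump simp: bump_eq_0)

lemma integrable_sphint:
  assumes "f \<in> sphere_smooth"
  shows "integrable lborel (\<lambda>x. bump x / norm x * f (sgn x))"
  by (rule integrable_compact_support[OF continuous_sphint_integrand[OF assms], of 2]) (simp add: bump_eq_0)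

lemma sphint_add:
  assumes "f \<in> sphere_smooth" "g \<in> sphere_smooth"
  shows "sphint (\<lambda>x. f x + g x) = sphint f + sphint g"
  unfolding sphint_def
  using Bochner_Integration.integral_add[OF integrable_sphint[OF assms(1)] integrable_sphint[OF assms(2)]]
  by (simp add: distrib_left)

lemma sphint_scale: "sphint (\<lambda>x. a * f x) = a * sphint f"
  unfolding sphint_def by (simp add: mult.left_commute flip: integral_mult_right_zero)

lemma sphint_diff:
  assumes "f \<in> sphere_smooth" "g \<in> sphere_smooth"
  shows "sphint (\<lambda>x. f x - g x) = sphint f - sphint g"
  using sphint_add[OF assms(1) sphere_smooth_scale[OF assms(2), of "-1"]] sphint_scale[of "-1" g] by simp

lemma sphint_mult_bound:
  assumes "u \<in> sphere_smooth" "w \<in> sphere_smooth" "\<And>x. norm x = 1 \<Longrightarrow> \<bar>w x\<bar> \<le> e"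
  shows "\<bar>sphint (\<lambda>x. u x * w x)\<bar> \<le> e * (\<integral>x. \<bar>bump x / norm x * u (sgn x)\<bar> \<partial>lborel)"
proof -
  have "\<bar>sphint (\<lambda>x. u x * w x)\<bar> \<le> (\<integral>x. \<bar>bump x / norm x * (u (sgn x) * w (sgn x))\<bar> \<partial>lborel)"
    unfolding sphint_def by (rule integral_abs_bound)
  also have "\<dots> \<le> (\<integral>x. e * \<bar>bump x / norm x * u (sgn x)\<bar> \<partial>lborel)"
  proof (rule integral_mono)
    show "integrable lborel (\<lambda>x. \<bar>bump x / norm x * (u (sgn x) * w (sgn x))\<bar>)"
      by (rule integrable_abs[OF integrable_sphint[OF sphere_smooth_mult[OF assms(1,2)]]])
    show "integrable lborel (\<lambda>x. e * \<bar>bump x / norm x * u (sgn x)\<bar>)"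
      by (intro integrable_mult_right integrable_abs integrable_sphint assms)
    fix x :: 'a
    show "\<bar>bump x / norm x * (u (sgn x) * w (sgn x))\<bar> \<le> e * \<bar>bump x / norm x * u (sgn x)\<bar>"
    proof (cases "x = 0")
      case False
      then have "\<bar>w (sgn x)\<bar> \<le> e" by (intro assms) (simp add: norm_sgn)
      then have "\<bar>bump x / norm x * u (sgn x)\<bar> * \<bar>w (sgn x)\<bar> \<le> \<bar>bump x / norm x * u (sgn x)\<bar> * e"
        by (intro mult_left_mono) auto
      then show ?thesis by (simp add: abs_mult mult_ac)
    qed simp
  qed
  finally show ?thesis by (simp only: integral_mult_right_zero)
qed

lemma sphint_square_nonneg: "sphint (\<lambda>x. f x * f x) \<ge> 0"
  unfolding sphint_def by (rule integral_nonneg_AE) (simp add: bump_nonneg)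

lemma sphint_square_eq_0:
  assumes f: "f \<in> sphere_smooth" and 0: "sphint (\<lambda>x. f x * f x) = 0"
  shows "f = (\<lambda>x. 0)"
proof -
  let ?g = "\<lambda>x. bump x / norm x * (f (sgn x) * f (sgn x))"
  have ff: "(\<lambda>x. f x * f x) \<in> sphere_smooth" using f by (intro sphere_smooth_mult)
  have cont: "continuous_on UNIV ?g" using continuous_sphint_integrand[OF ff] .
  have "AE x in lborel. ?g x = 0"
    using 0 integral_nonneg_eq_0_iff_AE[OF integrable_sphint[OF ff]]
    by (auto simp: sphint_def bump_nonneg)
  then have "{x. ?g x \<noteq> 0} \<in> null_sets lborel"
    using borel_measurable_continuous_onI[OF cont] AE_iff_null[of lborel "\<lambda>x. ?g x = 0"]
    by (simp del: mult_eq_0_iff divide_eq_0_iff)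
  then have "negligible {x. ?g x \<noteq> 0}"
    by (meson negligible_iff_null_sets null_sets_completionI)
  moreover have "open {x. ?g x \<noteq> 0}"
    using open_vimage[OF open_delete[OF open_UNIV, of 0] cont]
    by (simp add: vimage_def del: mult_eq_0_iff divide_eq_0_iff)
  ultimately have g0: "?g x = 0" for x using open_not_negligible by blast
  have "f x = 0" for x
  proof (cases "norm x = 1")
    case True
    \<comment> \<open>The point at radius 3/2 lies inside the shell on the ray of \<open>x\<close>,
      where the weight is positive and \<open>sgn\<close> returns \<open>x\<close>.\<close>
    then have "bump ((3/2) *\<^sub>R x) > 0" by (intro bump_pos) auto
    then show ?thesis using g0[of "(3/2) *\<^sub>R x"] True by (auto simp: sgn_scaleR sgn_eq_self)
  qed (simp add: sphere_smooth_off f)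
  then show ?thesis by auto
qed

text \<open>The divergence theorem on a closed manifold. Each \<open>bump x * h b (sgn x)\<close>
  has compact support, so its derivative in direction \<open>b\<close> integrates to zero. Summed
  over \<open>b\<close>, the terms in which the weight is differentiated are multiples of the normal
  component of the field, which is zero.\<close>

lemma tangent_field_divergence_integral:
  fixes h :: "'a::euclidean_space \<Rightarrow> 'a \<Rightarrow> real"
  assumes h: "\<And>b. b \<in> Basis \<Longrightarrow> h b \<in> sphere_smooth"
    and tangent: "\<And>x. norm x = 1 \<Longrightarrow> (\<Sum>b\<in>Basis. (x \<bullet> b) * h b x) = 0"
  shows "sphint (\<lambda>x. \<Sum>b\<in>Basis. tder b (h b) x) = 0"
proof -
  define D where "D b x v = bump x * (\<Sum>a\<in>Basis. (v \<bullet> a) * (tder a (h b) (sgn x) / norm x))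
     + (bump_slope x * (x \<bullet> v)) * (h b \<circ> sgn) x" for b x v
  have der: "((\<lambda>x. bump x * (h b \<circ> sgn) x) has_derivative D b x) (at x)" if b: "b \<in> Basis" for b x
  proof (cases "x = 0")
    case False
    show ?thesis unfolding D_def[abs_def]
      by (rule has_derivative_mult[OF bump_has_derivative sphere_smooth_has_derivative[OF h[OF b] False]])
  next
    case True
    have "((\<lambda>x. 0) has_derivative (\<lambda>v. 0)) (at x)" by simp
    then have "((\<lambda>x. bump x * (h b \<circ> sgn) x) has_derivative (\<lambda>v. 0)) (at x)"
      by (rule has_derivative_transform_within_open[where s="ball 0 1"])
         (auto simp: True bump_eq_0)
    moreover have "D b x = (\<lambda>v. 0)" by (simp add: D_def fun_eq_iff True bump_eq_0)
    ultimately show ?thesis by simp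
  qed
  have D_diag: "D b x b = bump x / norm x * tder b (h b) (sgn x) + bump_slope x * ((x \<bullet> b) * h b (sgn x))"
    if "b \<in> Basis" for b x
    unfolding D_def basis_contract[OF that] by simp
  have cont1: "continuous_on UNIV (\<lambda>x. bump_slope x * ((x \<bullet> b) * h b (sgn x)))" if "b \<in> Basis" for b
    by (rule continuous_on_cutoff)
       (auto intro!: continuous_intros sphere_smooth_continuous h that continuous_on_bump_slope simp: bump_slope_eq_0)
  have cont2: "continuous_on UNIV (\<lambda>x. bump x / norm x * tder b (h b) (sgn x))" if "b \<in> Basis" for b
    by (intro continuous_sphint_integrand tder_in_sphere_smooth h that)
  have contD: "continuous_on UNIV (\<lambda>x. D b x b)" if "b \<in> Basis" for b
    using continuous_on_add[OF cont2[OF that] cont1[OF that]] by (simp add: D_diag[OF that])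
  have D0: "(\<integral>x. D b x b \<partial>lborel) = 0" if "b \<in> Basis" for b
    by (rule integral_directional_derivative_eq_0[OF der[OF that] contD[OF that], of 2]) (simp add: bump_eq_0)
  have intD: "integrable lborel (\<lambda>x. D b x b)" if "b \<in> Basis" for b
    by (rule integrable_compact_support[OF contD[OF that], of 2])
       (simp add: D_def bump_eq_0 bump_slope_eq_0)
  have "(\<Sum>b\<in>Basis. D b x b) = bump x / norm x * (\<Sum>b\<in>Basis. tder b (h b) (sgn x))" for x
  proof -
    have "(\<Sum>b\<in>Basis. (x \<bullet> b) * h b (sgn x)) = 0"
    proof (cases "x = 0")
      case False
      have "(\<Sum>b\<in>Basis. (x \<bullet> b) * h b (sgn x)) = norm x * (\<Sum>b\<in>Basis. (sgn x \<bullet> b) * h b (sgn x))"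
        using False by (simp add: sgn_div_norm sum_distrib_left mult.assoc[symmetric])
      then show ?thesis using tangent[of "sgn x"] False by (simp add: norm_sgn)
    qed simp
    then show ?thesis
      by (simp add: D_diag sum.distrib sum_distrib_left[symmetric] del: times_divide_eq_left)
  qed
  then have "sphint (\<lambda>x. \<Sum>b\<in>Basis. tder b (h b) x) = (\<integral>x. (\<Sum>b\<in>Basis. D b x b) \<partial>lborel)"
    by (simp add: sphint_def)
  also have "\<dots> = (\<Sum>b\<in>Basis. \<integral>x. D b x b \<partial>lborel)"
    by (rule Bochner_Integration.integral_sum) (rule intD)
  finally show ?thesis using D0 by simp
qed

lemma sphere_smooth_sum:
  "(\<And>i. i \<in> A \<Longrightarrow> f i \<in> sphere_smooth) \<Longrightarrow> (\<lambda>x. \<Sum>i\<in>A. f i x) \<in> sphere_smooth"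
  by (induction A rule: infinite_finite_induct) (auto intro: sphere_smooth_zero sphere_smooth_add)

lemma sphere_lap_in_sphere_smooth: "f \<in> sphere_smooth \<Longrightarrow> sphere_lap f \<in> sphere_smooth"
  unfolding sphere_lap_def[abs_def] by (intro sphere_smooth_sum tder_in_sphere_smooth)

text \<open>Green's identity: the field \<open>u * grad v - v * grad u\<close> is tangent, and in
  its divergence the mixed first-order terms cancel.\<close>

lemma sphere_lap_symmetric:
  assumes u: "u \<in> sphere_smooth" and v: "v \<in> sphere_smooth"
  shows "sphint (\<lambda>x. u x * sphere_lap v x) = sphint (\<lambda>x. v x * sphere_lap u x)"
proof -
  define h where "h b x = u x * tder b v x - v x * tder b u x" for b x
  have h: "h b \<in> sphere_smooth" if "b \<in> Basis" for b
    unfolding h_def[abs_def] using that u v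
    by (intro sphere_smooth_diff sphere_smooth_mult tder_in_sphere_smooth)
  have dh: "tder b (h b) x = u x * tder b (tder b v) x - v x * tder b (tder b u) x" if b: "b \<in> Basis" for b x
    unfolding h_def[abs_def] using u v b
    by (simp add: tder_diff tder_mult sphere_smooth_mult tder_in_sphere_smooth)
  have "sphint (\<lambda>x. \<Sum>b\<in>Basis. tder b (h b) x) = 0"
  proof (rule tangent_field_divergence_integral[OF h])
    fix x :: 'a assume x: "norm x = 1"
    have "(\<Sum>b\<in>Basis. (x \<bullet> b) * h b x)
        = u x * (\<Sum>b\<in>Basis. (x \<bullet> b) * tder b v x) - v x * (\<Sum>b\<in>Basis. (x \<bullet> b) * tder b u x)"
      by (simp add: h_def sum_subtractf sum_distrib_left right_diff_distrib mult_ac)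
    then show "(\<Sum>b\<in>Basis. (x \<bullet> b) * h b x) = 0"
      using tder_radial[OF u x] tder_radial[OF v x] by simp
  qed
  also have "(\<lambda>x. \<Sum>b\<in>Basis. tder b (h b) x) = (\<lambda>x. u x * sphere_lap v x - v x * sphere_lap u x)"
    by (simp add: dh sphere_lap_def sum_subtractf sum_distrib_left)
  finally show ?thesis
    by (subst (asm) sphint_diff) (auto intro!: sphere_smooth_mult sphere_lap_in_sphere_smooth u v)
qed

section \<open>Polynomials on the sphere\<close>

text \<open>The scalar action is literally the one in \<open>eigen_mult\<close>, so that
  \<open>fs.dim\<close> is the dimension used there.\<close>

interpretation fs: vector_space "\<lambda>(c::real) (f::'a::euclidean_space \<Rightarrow> real) x. c * f x"
  by unfold_locales (auto simp: fun_eq_iff algebra_simps)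

lemma sum_fun_apply: "(\<Sum>i\<in>A. f i) x = (\<Sum>i\<in>A. (f i x :: real))"
  by (induction A rule: infinite_finite_induct) auto

lemma subspace_funI:
  fixes S :: "('a::euclidean_space \<Rightarrow> real) set"
  assumes "(\<lambda>x. 0) \<in> S" "\<And>f g. f \<in> S \<Longrightarrow> g \<in> S \<Longrightarrow> (\<lambda>x. f x + g x) \<in> S"
    "\<And>c f. f \<in> S \<Longrightarrow> (\<lambda>x. c * f x) \<in> S"
  shows "fs.subspace S"
  using assms by (simp add: fs.subspace_def plus_fun_def zero_fun_def)

lemma subspace_fun_add: "fs.subspace S \<Longrightarrow> f \<in> S \<Longrightarrow> g \<in> S \<Longrightarrow> (\<lambda>x. f x + g x) \<in> S"
  and subspace_fun_scale: "fs.subspace S \<Longrightarrow> f \<in> S \<Longrightarrow> (\<lambda>x. c * f x) \<in> S"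
  and subspace_fun_zero: "fs.subspace S \<Longrightarrow> (\<lambda>x. 0) \<in> S"
  by (auto simp: fs.subspace_def plus_fun_def zero_fun_def)

lemma subspace_fun_diff: "fs.subspace S \<Longrightarrow> f \<in> S \<Longrightarrow> g \<in> S \<Longrightarrow> (\<lambda>x. f x - g x) \<in> S"
  using subspace_fun_add[of S f "\<lambda>x. -1 * g x"] subspace_fun_scale[of S g "-1"] by simp

lemma subspace_fun_sum:
  "fs.subspace S \<Longrightarrow> (\<And>i. i \<in> A \<Longrightarrow> f i \<in> S) \<Longrightarrow> (\<lambda>x. \<Sum>i\<in>A. f i x) \<in> S"
  by (induction A rule: infinite_finite_induct) (auto intro: subspace_fun_zero subspace_fun_add)

lemma subspace_sphere_smooth: "fs.subspace sphere_smooth"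
  by (intro subspace_funI sphere_smooth_zero sphere_smooth_add sphere_smooth_scale)

lemma sphere_lap_add:
  assumes "f \<in> sphere_smooth" "g \<in> sphere_smooth"
  shows "sphere_lap (\<lambda>x. f x + g x) = (\<lambda>x. sphere_lap f x + sphere_lap g x)"
  unfolding sphere_lap_def[abs_def]
  using assms by (simp add: tder_add tder_in_sphere_smooth sum.distrib)

lemma sphere_lap_scale:
  assumes "f \<in> sphere_smooth"
  shows "sphere_lap (\<lambda>x. a * f x) = (\<lambda>x. a * sphere_lap f x)"
  unfolding sphere_lap_def[abs_def]
  using assms by (simp add: tder_scale tder_in_sphere_smooth sum_distrib_left)

lemma tder_zero: "c \<in> Basis \<Longrightarrow> tder c (\<lambda>x. 0) = (\<lambda>x. 0)"
  using tder_scale[OF sphere_smooth_zero, of c 0] by simp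

lemma sphere_lap_zero: "sphere_lap (\<lambda>x. 0) = (\<lambda>x. 0)"
  using sphere_lap_scale[OF sphere_smooth_zero, of 0] by simp

lemma sphere_lap_diff:
  assumes "f \<in> sphere_smooth" "g \<in> sphere_smooth"
  shows "sphere_lap (\<lambda>x. f x - g x) = (\<lambda>x. sphere_lap f x - sphere_lap g x)"
  using sphere_lap_add[OF assms(1) sphere_smooth_scale[OF assms(2), of "-1"]]
    sphere_lap_scale[OF assms(2), of "-1"] by simp

text \<open>The Leibniz rule for the Laplacian of a product: the coordinate is itself an
  eigenfunction for \<open>DIM('a) - 1\<close>, and the inner product of its gradient with that of
  \<open>g\<close> reduces to \<open>tder b g\<close> because the gradient of \<open>g\<close> is
  tangent.\<close>

lemma sphere_lap_coord:
  fixes g :: "'a::euclidean_space \<Rightarrow> real"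
  assumes g: "g \<in> sphere_smooth" and b: "b \<in> Basis"
  shows "sphere_lap (\<lambda>x. (x \<bullet> b) * g x) x =
    (x \<bullet> b) * sphere_lap g x - (real DIM('a) - 1) * ((x \<bullet> b) * g x) + 2 * tder b g x"
proof (cases "norm x = 1")
  case False
  then show ?thesis
    using sphere_lap_in_sphere_smooth[OF sphere_smooth_coord[OF g, of b]] sphere_lap_in_sphere_smooth[OF g]
    by (simp add: sphere_smooth_off g tder_off)
next
  case True
  have summand: "tder c (tder c (\<lambda>x. (x \<bullet> b) * g x)) x =
    (x \<bullet> b) * tder c (tder c g) x + (if b = c then 2 * tder b g x else 0)
      - 2 * (x \<bullet> b) * ((x \<bullet> c) * tder c g x)
      + ((if b = c then - ((x \<bullet> b) * g x) else 0) + 2 * ((x \<bullet> b) * g x) * (x \<bullet> c)\<^sup>2 - (x \<bullet> b) * g x)"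
    if c: "c \<in> Basis" for c
  proof -
    define k where "k = (if b = c then 1 else (0::real))"
    have tg: "tder c g \<in> sphere_smooth" by (rule tder_in_sphere_smooth[OF g c])
    have "tder c (\<lambda>x. (x \<bullet> b) * g x) =
        (\<lambda>x. ((x \<bullet> b) * tder c g x + k * g x) - (x \<bullet> b) * ((x \<bullet> c) * g x))"
      unfolding tder_coord[OF g b c] k_def by (rule ext) (simp add: algebra_simps)
    then have "tder c (tder c (\<lambda>x. (x \<bullet> b) * g x)) x =
      (tder c (\<lambda>x. (x \<bullet> b) * tder c g x) x + k * tder c g x) - tder c (\<lambda>x. (x \<bullet> b) * ((x \<bullet> c) * g x)) x"
      using g tg c by (simp add: tder_diff tder_add tder_scale sphere_smooth_coord sphere_smooth_add sphere_smooth_scale)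
    also have "\<dots> = ((x \<bullet> b) * tder c (tder c g) x + (k - (x \<bullet> b) * (x \<bullet> c)) * tder c g x + k * tder c g x)
      - ((x \<bullet> b) * ((x \<bullet> c) * tder c g x + (1 - (x \<bullet> c) * (x \<bullet> c)) * g x)
         + (k - (x \<bullet> b) * (x \<bullet> c)) * ((x \<bullet> c) * g x))"
      using g tg b c by (simp add: tder_coord sphere_smooth_coord k_def)
    finally show ?thesis
      by (cases "b = c") (simp_all add: k_def algebra_simps power2_eq_square)
  qed
  have sq: "(\<Sum>c\<in>Basis. (x \<bullet> c)\<^sup>2) = 1"
    using True by (simp add: euclidean_inner[symmetric] power2_eq_square dot_square_norm)
  have "sphere_lap (\<lambda>x. (x \<bullet> b) * g x) x =
    (x \<bullet> b) * sphere_lap g x + 2 * tder b g x - 2 * (x \<bullet> b) * (\<Sum>c\<in>Basis. (x \<bullet> c) * tder c g x)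
      + (- ((x \<bullet> b) * g x) + 2 * ((x \<bullet> b) * g x) * (\<Sum>c\<in>Basis. (x \<bullet> c)\<^sup>2) - real DIM('a) * ((x \<bullet> b) * g x))"
    using b by (simp add: sphere_lap_def summand sum.distrib sum_subtractf sum_distrib_left)
  then show ?thesis
    using tder_radial[OF g True] sq by (simp add: algebra_simps)
qed

section \<open>Reduced monomials and the action of the operators on them\<close>

text \<open>These index a basis of the degree \<open>m\<close> polynomials modulo lower degree and
  \<open>x \<bullet> x = 1\<close>. Requiring 0 outside \<open>Basis\<close> lets each monomial have
  only one exponent function.\<close>

definition exps :: "'a::euclidean_space \<Rightarrow> nat \<Rightarrow> ('a \<Rightarrow> nat) set" where
  "exps e m = {\<alpha>. (\<forall>b. b \<notin> Basis \<longrightarrow> \<alpha> b = 0) \<and> \<alpha> e \<le> 1 \<and> sum \<alpha> Basis = m}"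

definition smono :: "('a::euclidean_space \<Rightarrow> nat) \<Rightarrow> 'a \<Rightarrow> real" where
  "smono \<alpha> x = (if norm x = 1 then \<Prod>b\<in>Basis. (x \<bullet> b) ^ \<alpha> b else 0)"

text \<open>Degree strictly less than \<open>m\<close>; exponents of \<open>x \<bullet> e\<close> above one are redundant on the sphere.\<close>
definition sphere_poly :: "'a::euclidean_space \<Rightarrow> nat \<Rightarrow> ('a \<Rightarrow> real) set" where
  "sphere_poly e m = fs.span (smono ` (\<Union>j<m. exps e j))"

lemma subspace_sphere_poly: "fs.subspace (sphere_poly e m)"
  by (simp add: sphere_poly_def)

lemma smono_in_sphere_poly: "\<alpha> \<in> exps e j \<Longrightarrow> j < m \<Longrightarrow> smono \<alpha> \<in> sphere_poly e m"
  unfolding sphere_poly_def by (intro fs.span_base) auto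

lemma sphere_poly_mono: "m \<le> m' \<Longrightarrow> sphere_poly e m \<subseteq> sphere_poly e m'"
  unfolding sphere_poly_def by (intro fs.span_mono image_mono UN_mono) auto

lemma sphere_poly_minimal:
  assumes "fs.subspace T" "\<And>\<alpha> j. j < m \<Longrightarrow> \<alpha> \<in> exps e j \<Longrightarrow> smono \<alpha> \<in> T"
  shows "sphere_poly e m \<subseteq> T"
  unfolding sphere_poly_def using assms by (intro fs.span_minimal) auto

lemma sphere_poly_0: "sphere_poly e 0 = {\<lambda>x. 0}"
  by (simp add: sphere_poly_def zero_fun_def)

lemma exps_0: "exps e 0 = {\<lambda>b. 0}"
  by (auto simp: exps_def fun_eq_iff)

lemma smono_0: "smono (\<lambda>b. 0) = sphere_one"
  by (simp add: smono_def sphere_one_def fun_eq_iff)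

lemma smono_Suc:
  assumes "b \<in> Basis"
  shows "smono (\<alpha>(b := Suc (\<alpha> b))) = (\<lambda>x. (x \<bullet> b) * smono \<alpha> x)"
proof
  fix x
  have "(\<Prod>c\<in>Basis. (x \<bullet> c) ^ (\<alpha>(b := Suc (\<alpha> b))) c)
      = (x \<bullet> b) ^ Suc (\<alpha> b) * (\<Prod>c\<in>Basis - {b}. (x \<bullet> c) ^ \<alpha> c)"
    by (subst prod.remove[OF _ assms]) (auto intro!: prod.cong)
  also have "\<dots> = (x \<bullet> b) * (\<Prod>c\<in>Basis. (x \<bullet> c) ^ \<alpha> c)"
    using prod.remove[OF finite_Basis assms, of "\<lambda>c. (x \<bullet> c) ^ \<alpha> c"] by simp
  finally show "smono (\<alpha>(b := Suc (\<alpha> b))) x = (x \<bullet> b) * smono \<alpha> x" by (simp add: smono_def)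
qed

lemma sum_Suc_upd: "finite A \<Longrightarrow> b \<in> A \<Longrightarrow> sum (\<alpha>(b := Suc (\<alpha> b))) A = Suc (sum \<alpha> A)"
  by (simp add: sum.remove[of A b])

lemma exps_SucI:
  assumes "\<alpha> \<in> exps e m" "b \<in> Basis" "b = e \<Longrightarrow> \<alpha> e = 0"
  shows "\<alpha>(b := Suc (\<alpha> b)) \<in> exps e (Suc m)"
proof -
  have "sum (\<alpha>(b := Suc (\<alpha> b))) Basis = Suc (sum \<alpha> Basis)" by (rule sum_Suc_upd) (use assms in auto)
  then show ?thesis using assms by (auto simp: exps_def)
qed

text \<open>The step for inductions on the degree: every monomial of positive degree is a coordinate
  times a reduced monomial of one degree less.\<close>

lemma exps_SucE:
  assumes "\<alpha> \<in> exps e (Suc m)"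
  obtains b \<beta> where "b \<in> Basis" "\<beta> \<in> exps e m" "\<alpha> = \<beta>(b := Suc (\<beta> b))" "b = e \<Longrightarrow> \<beta> e = 0"
proof -
  have "\<exists>b\<in>Basis. \<alpha> b \<noteq> 0"
    using assms sum.neutral[of Basis \<alpha>] by (fastforce simp: exps_def)
  then obtain b where b: "b \<in> Basis" "\<alpha> b \<noteq> 0" by auto
  let ?\<beta> = "\<alpha>(b := \<alpha> b - 1)"
  have \<alpha>: "\<alpha> = ?\<beta>(b := Suc (?\<beta> b))" using b by auto
  have "sum \<alpha> Basis = Suc (sum ?\<beta> Basis)"
    by (subst \<alpha>) (rule sum_Suc_upd, use b in auto)
  then have "?\<beta> \<in> exps e m" using assms b by (auto simp: exps_def)
  moreover have "b = e \<Longrightarrow> ?\<beta> e = 0" using assms by (auto simp: exps_def)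
  ultimately show ?thesis using that[OF b(1) _ \<alpha>] by blast
qed

lemma smono_smooth: "\<alpha> \<in> exps e m \<Longrightarrow> smono \<alpha> \<in> sphere_smooth"
proof (induction m arbitrary: \<alpha>)
  case 0
  then show ?case by (simp add: exps_0 smono_0 sphere_smooth_one)
next
  case (Suc m)
  from Suc.prems obtain b \<beta> where "b \<in> Basis" "\<beta> \<in> exps e m" "\<alpha> = \<beta>(b := Suc (\<beta> b))"
    by (rule exps_SucE)
  then show ?case using Suc.IH by (simp only: smono_Suc) (rule sphere_smooth_coord, blast)
qed

lemma sphere_poly_smooth: "sphere_poly e m \<subseteq> sphere_smooth"
  by (intro sphere_poly_minimal subspace_sphere_smooth) (auto intro: smono_smooth)

text \<open>A second factor \<open>x \<bullet> e\<close> is eliminated by means of \<open>(x \<bullet> e)\<^sup>2 = 1 - (\<Sum>c\<noteq>e. (x \<bullet> c)\<^sup>2)\<close>.\<close>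
lemma sphere_poly_coord:
  fixes e :: "'a::euclidean_space"
  assumes e: "e \<in> Basis" and b: "b \<in> Basis" and "f \<in> sphere_poly e m"
  shows "(\<lambda>x. (x \<bullet> b) * f x) \<in> sphere_poly e (Suc m)"
proof -
  let ?T = "{f. (\<lambda>x. (x \<bullet> b) * f x) \<in> sphere_poly e (Suc m)}"
  have "fs.subspace ?T"
    using subspace_sphere_poly[of e "Suc m"]
    by (intro subspace_funI) (auto simp: distrib_left mult.left_commute
        intro: subspace_fun_zero subspace_fun_add subspace_fun_scale)
  moreover have "smono \<alpha> \<in> ?T" if j: "j < m" and \<alpha>: "\<alpha> \<in> exps e j" for \<alpha> j
  proof (cases "b = e \<and> \<alpha> e \<noteq> 0")
    case False
    then have "\<alpha>(b := Suc (\<alpha> b)) \<in> exps e (Suc j)" using \<alpha> b by (intro exps_SucI) auto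
    from smono_in_sphere_poly[OF this, of "Suc m"] show ?thesis using j smono_Suc[OF b, of \<alpha>] by simp
  next
    case True
    \<comment> \<open>\<open>\<beta>\<close> drops the factor \<open>x \<bullet> e\<close>, so
      multiplying by \<open>x \<bullet> e\<close> twice more precisely produces
      \<open>(x \<bullet> b) * smono \<alpha> x\<close>, while
      \<open>(x \<bullet> c)\<^sup>2\<close> times its monomial has degree \<open>j + 1\<close> and
      is already reduced.\<close>
    define \<beta> where "\<beta> = \<alpha>(e := 0)"
    have \<alpha>e: "\<alpha> e = 1" using True \<alpha> by (auto simp: exps_def)
    then have \<alpha>\<beta>: "\<alpha> = \<beta>(e := Suc (\<beta> e))" by (auto simp: \<beta>_def)
    have "j = Suc (sum \<beta> Basis)"
      using \<alpha> sum_Suc_upd[OF finite_Basis e, of \<beta>] unfolding exps_def \<alpha>\<beta>[symmetric] by blast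
    moreover have "\<beta> \<in> exps e (sum \<beta> Basis)" using \<alpha> by (auto simp: exps_def \<beta>_def)
    ultimately obtain i where i: "j = Suc i" "\<beta> \<in> exps e i" by blast
    have sm: "(\<lambda>x. (x \<bullet> c) * ((x \<bullet> c) * smono \<beta> x)) \<in> sphere_poly e (Suc m)" if "c \<in> Basis - {e}" for c
    proof -
      have c: "c \<in> Basis" "c \<noteq> e" using that by auto
      let ?\<gamma> = "\<beta>(c := Suc (\<beta> c))"
      have "?\<gamma>(c := Suc (?\<gamma> c)) \<in> exps e (Suc (Suc i))"
        using i c by (intro exps_SucI) auto
      from smono_in_sphere_poly[OF this, of "Suc m"] show ?thesis
        using i j unfolding smono_Suc[OF c(1)] by simp
    qed
    have "(x \<bullet> b) * smono \<alpha> x = smono \<beta> x - (\<Sum>c\<in>Basis - {e}. (x \<bullet> c) * ((x \<bullet> c) * smono \<beta> x))" for x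
    proof (cases "norm x = 1")
      case nx: True
      have "1 = (\<Sum>c\<in>Basis. (x \<bullet> c) * (x \<bullet> c))"
        using nx by (simp add: euclidean_inner[symmetric] dot_square_norm)
      also have "\<dots> = (x \<bullet> e) * (x \<bullet> e) + (\<Sum>c\<in>Basis - {e}. (x \<bullet> c) * (x \<bullet> c))"
        by (rule sum.remove) (use e in auto)
      finally have "(x \<bullet> e) * (x \<bullet> e) = 1 - (\<Sum>c\<in>Basis - {e}. (x \<bullet> c) * (x \<bullet> c))" by simp
      then have "(x \<bullet> e) * ((x \<bullet> e) * smono \<beta> x) = (1 - (\<Sum>c\<in>Basis - {e}. (x \<bullet> c) * (x \<bullet> c))) * smono \<beta> x"
        by (simp add: mult.assoc[symmetric])
      also have "(x \<bullet> e) * ((x \<bullet> e) * smono \<beta> x) = (x \<bullet> b) * smono \<alpha> x"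
        using True by (subst \<alpha>\<beta>) (simp only: smono_Suc[OF e])
      finally show ?thesis by (simp add: left_diff_distrib sum_distrib_right mult.assoc)
    qed (simp add: smono_def)
    moreover have "(\<lambda>x. smono \<beta> x - (\<Sum>c\<in>Basis - {e}. (x \<bullet> c) * ((x \<bullet> c) * smono \<beta> x))) \<in> sphere_poly e (Suc m)"
      using subspace_sphere_poly sm i j
      by (intro subspace_fun_diff subspace_fun_sum) (auto intro!: smono_in_sphere_poly)
    ultimately show ?thesis by simp
  qed
  ultimately have "sphere_poly e m \<subseteq> ?T" by (rule sphere_poly_minimal)
  with assms show ?thesis by auto
qed

definition lam :: "'a::euclidean_space itself \<Rightarrow> nat \<Rightarrow> real" where
  "lam _ m = real m * (real m + real DIM('a) - 2)"

text \<open>Up to terms of lower degree, on polynomials of degree \<open>m\<close> the operator \<open>tder c\<close> acts as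
  multiplication by \<open>- m * (x \<bullet> c)\<close> and \<open>sphere_lap\<close> as the scalar \<open>- lam m\<close>.\<close>
lemma sphere_poly_leading_terms:
  fixes e :: "'a::euclidean_space"
  assumes e: "e \<in> Basis"
  shows "f \<in> sphere_poly e (Suc m) \<Longrightarrow>
    (\<forall>c\<in>Basis. (\<lambda>x. tder c f x + real m * ((x \<bullet> c) * f x)) \<in> sphere_poly e (Suc m)) \<and>
    (\<lambda>x. sphere_lap f x + lam TYPE('a) m * f x) \<in> sphere_poly e m"
proof (induction m arbitrary: f)
  \<comment> \<open>The claim is packed into a subspace, so that only monomials remain to be
    checked. Smoothness belongs to it because the operators are additive only on smooth
    functions.\<close>
  define T where "T m = {f \<in> sphere_smooth.
    (\<forall>c\<in>Basis. (\<lambda>x. tder c f x + real m * ((x \<bullet> c) * f x)) \<in> sphere_poly e (Suc m)) \<and>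
    (\<lambda>x. sphere_lap f x + lam TYPE('a) m * f x) \<in> sphere_poly e m}" for m
  have sub: "fs.subspace (T m)" for m
  proof (rule subspace_funI)
    show "(\<lambda>x. 0) \<in> T m"
      by (simp add: T_def sphere_smooth_zero sphere_lap_zero tder_zero subspace_fun_zero[OF subspace_sphere_poly])
    fix f g assume fg: "f \<in> T m" "g \<in> T m"
    have eq: "tder c f x + tder c g x + real m * ((x \<bullet> c) * (f x + g x))
        = (tder c f x + real m * ((x \<bullet> c) * f x)) + (tder c g x + real m * ((x \<bullet> c) * g x))"
      "sphere_lap f x + sphere_lap g x + lam TYPE('a) m * (f x + g x)
        = (sphere_lap f x + lam TYPE('a) m * f x) + (sphere_lap g x + lam TYPE('a) m * g x)"
      for c x by (simp_all add: algebra_simps)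
    have "(\<lambda>x. tder c f x + tder c g x + real m * ((x \<bullet> c) * (f x + g x))) \<in> sphere_poly e (Suc m)"
      if "c \<in> Basis" for c
      unfolding eq by (rule subspace_fun_add[OF subspace_sphere_poly]) (use fg that in \<open>auto simp: T_def\<close>)
    moreover have "(\<lambda>x. sphere_lap f x + sphere_lap g x + lam TYPE('a) m * (f x + g x)) \<in> sphere_poly e m"
      unfolding eq by (rule subspace_fun_add[OF subspace_sphere_poly]) (use fg in \<open>auto simp: T_def\<close>)
    ultimately show "(\<lambda>x. f x + g x) \<in> T m"
      using fg by (simp add: T_def sphere_smooth_add tder_add sphere_lap_add)
  next
    fix a f assume f: "f \<in> T m"
    have eq: "a * tder c f x + real m * ((x \<bullet> c) * (a * f x)) = a * (tder c f x + real m * ((x \<bullet> c) * f x))"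
      "a * sphere_lap f x + lam TYPE('a) m * (a * f x) = a * (sphere_lap f x + lam TYPE('a) m * f x)"
      for c x by (simp_all add: algebra_simps)
    have "(\<lambda>x. a * tder c f x + real m * ((x \<bullet> c) * (a * f x))) \<in> sphere_poly e (Suc m)"
      if "c \<in> Basis" for c
      unfolding eq by (rule subspace_fun_scale[OF subspace_sphere_poly]) (use f that in \<open>auto simp: T_def\<close>)
    moreover have "(\<lambda>x. a * sphere_lap f x + lam TYPE('a) m * (a * f x)) \<in> sphere_poly e m"
      unfolding eq by (rule subspace_fun_scale[OF subspace_sphere_poly]) (use f in \<open>auto simp: T_def\<close>)
    ultimately show "(\<lambda>x. a * f x) \<in> T m"
      using f by (simp add: T_def sphere_smooth_scale tder_scale sphere_lap_scale)
  qed
  {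
    case 0
    have "sphere_one \<in> T 0"
      by (simp add: subspace_fun_zero[OF subspace_sphere_poly] T_def sphere_smooth_one tder_one sphere_lap_def lam_def tder_zero)
    then have "sphere_poly e (Suc 0) \<subseteq> T 0"
      by (intro sphere_poly_minimal sub) (simp add: exps_0 smono_0)
    then show ?case using 0 by (auto simp: T_def)
  next
    case (Suc m)
    have "smono \<alpha> \<in> T (Suc m)" if j: "j < Suc (Suc m)" and \<alpha>: "\<alpha> \<in> exps e j" for \<alpha> j
    proof (cases "j \<le> m")
      case True
      let ?f = "smono \<alpha>"
      \<comment> \<open>For a monomial of degree at most \<open>m\<close>, passing from
        \<open>m\<close> to \<open>m + 1\<close> adds only \<open>(x \<bullet> c) * ?f x\<close>,
        respectively a multiple of \<open>?f\<close>, and both fit into the enlarged spaces.\<close>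
      have f: "?f \<in> sphere_poly e (Suc m)" using True \<alpha> by (intro smono_in_sphere_poly) auto
      note IH = Suc.IH[OF f]
      have mono: "g \<in> sphere_poly e (Suc m) \<Longrightarrow> g \<in> sphere_poly e (Suc (Suc m))"
        "g \<in> sphere_poly e m \<Longrightarrow> g \<in> sphere_poly e (Suc m)" for g
        using sphere_poly_mono[of "Suc m" "Suc (Suc m)" e] sphere_poly_mono[of "m" "Suc m" e] by auto
      have "(\<lambda>x. tder c ?f x + real (Suc m) * ((x \<bullet> c) * ?f x)) \<in> sphere_poly e (Suc (Suc m))"
        if c: "c \<in> Basis" for c
        using subspace_fun_add[OF subspace_sphere_poly mono(1)[OF bspec[OF conjunct1[OF IH] c]] sphere_poly_coord[OF e c f]]
        by (simp add: algebra_simps)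
      moreover have "(\<lambda>x. sphere_lap ?f x + lam TYPE('a) (Suc m) * ?f x) \<in> sphere_poly e (Suc m)"
        using subspace_fun_add[OF subspace_sphere_poly mono(2)[OF conjunct2[OF IH]]
            subspace_fun_scale[OF subspace_sphere_poly f, of "lam TYPE('a) (Suc m) - lam TYPE('a) m"]]
        by (simp add: algebra_simps)
      ultimately show ?thesis using smono_smooth[OF \<alpha>] by (simp add: T_def)
    next
      case False
      then have "\<alpha> \<in> exps e (Suc m)" using j \<alpha> le_less_Suc_eq by fastforce
      then obtain b \<beta> where b: "b \<in> Basis" and \<beta>: "\<beta> \<in> exps e m" "\<alpha> = \<beta>(b := Suc (\<beta> b))"
        by (rule exps_SucE)
      let ?g = "smono \<beta>"
      have g: "?g \<in> sphere_poly e (Suc m)" "?g \<in> sphere_smooth"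
        using \<beta> by (auto intro: smono_in_sphere_poly smono_smooth)
      have f: "smono \<alpha> = (\<lambda>x. (x \<bullet> b) * ?g x)" using smono_Suc[OF b] \<beta> by simp
      note IH = Suc.IH[OF g(1)]
      have "(\<lambda>x. tder c (smono \<alpha>) x + real (Suc m) * ((x \<bullet> c) * smono \<alpha> x)) \<in> sphere_poly e (Suc (Suc m))"
        if c: "c \<in> Basis" for c
      proof -
        have "?g \<in> sphere_poly e (Suc (Suc m))" using g sphere_poly_mono[of "Suc m" "Suc (Suc m)" e] by auto
        from subspace_fun_add[OF subspace_sphere_poly
            sphere_poly_coord[OF e b bspec[OF conjunct1[OF IH] c]]
            subspace_fun_scale[OF subspace_sphere_poly this, of "if b = c then 1 else 0"]]
        show ?thesis unfolding f tder_coord[OF g(2) b c] by (simp add: algebra_simps)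
      qed
      \<comment> \<open>The eigenvalue recursion
        \<open>lam (m + 1) = lam m + (DIM('a) - 1) + 2 * m\<close>: the middle term comes from the
        coordinate, the last from \<open>2 * tder b ?g\<close>, whose leading part is
        \<open>- 2 * m * (x \<bullet> b) * ?g x\<close>.\<close>
      moreover have "(\<lambda>x. sphere_lap (smono \<alpha>) x + lam TYPE('a) (Suc m) * smono \<alpha> x) \<in> sphere_poly e (Suc m)"
        using subspace_fun_add[OF subspace_sphere_poly
            sphere_poly_coord[OF e b conjunct2[OF IH]]
            subspace_fun_scale[OF subspace_sphere_poly bspec[OF conjunct1[OF IH] b], of 2]]
        unfolding f sphere_lap_coord[OF g(2) b] by (simp add: lam_def algebra_simps)
      ultimately show ?thesis using smono_smooth[OF \<alpha>] by (simp add: T_def)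
    qed
    then have "sphere_poly e (Suc (Suc m)) \<subseteq> T (Suc m)"
      by (intro sphere_poly_minimal sub) auto
    then show ?case using Suc.prems by (auto simp: T_def)
  }
qed

text \<open>Back substitution in a triangular system. The image of \<open>f\<close> under
  \<open>sphere_lap + lam m\<close> has lower degree, so it equals \<open>(sphere_lap + c) h\<close>
  for some \<open>h\<close> of lower degree; then \<open>sphere_lap + c\<close> maps
  \<open>f - h\<close> to \<open>(c - lam m) * f\<close>, and one divides.\<close>

lemma sphere_poly_resolvent:
  fixes e :: "'a::euclidean_space"
  assumes e: "e \<in> Basis"
  shows "(\<And>j. j < m \<Longrightarrow> c \<noteq> lam TYPE('a) j) \<Longrightarrow> f \<in> sphere_poly e m \<Longrightarrow>
    \<exists>g\<in>sphere_poly e m. \<forall>x. sphere_lap g x + c * g x = f x"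
proof (induction m arbitrary: f)
  case 0
  then show ?case by (auto simp: sphere_poly_0 sphere_lap_zero)
next
  case (Suc m)
  let ?l = "lam TYPE('a) m"
  let ?q = "\<lambda>x. sphere_lap f x + ?l * f x"
  have "?q \<in> sphere_poly e m" using sphere_poly_leading_terms[OF e Suc.prems(2)] by auto
  from Suc.IH[OF _ this] Suc.prems(1)
  obtain h where h: "h \<in> sphere_poly e m" "\<And>x. sphere_lap h x + c * h x = ?q x"
    by (metis less_SucI)
  define k where "k = 1 / (c - ?l)"
  have k: "k * (c - ?l) = 1" using Suc.prems(1)[of m] by (simp add: k_def)
  have h': "h \<in> sphere_poly e (Suc m)" using h sphere_poly_mono[of m "Suc m" e] by auto
  let ?g = "\<lambda>x. k * (f x - h x)"
  have "?g \<in> sphere_poly e (Suc m)"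
    by (intro subspace_fun_scale[OF subspace_sphere_poly] subspace_fun_diff[OF subspace_sphere_poly] h' Suc.prems)
  moreover have "sphere_lap ?g x + c * ?g x = f x" for x
  proof -
    have s: "f \<in> sphere_smooth" "h \<in> sphere_smooth" using h' Suc.prems(2) sphere_poly_smooth by auto
    have "sphere_lap ?g x + c * ?g x
        = k * ((sphere_lap f x + c * f x) - (sphere_lap h x + c * h x))"
      unfolding sphere_lap_scale[OF sphere_smooth_diff[OF s]] sphere_lap_diff[OF s]
      by (simp add: algebra_simps)
    also have "\<dots> = (k * (c - ?l)) * f x"
      unfolding h(2) by (simp add: algebra_simps)
    finally show ?thesis using k by simp
  qed
  ultimately show ?case by blast
qed

section \<open>Spherical harmonics and eigenspaces\<close>

lemma univariate_poly_zero_coeffs: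
  fixes C :: "nat \<Rightarrow> real"
  assumes "0 < \<delta>" "\<And>s. 0 < s \<Longrightarrow> s < \<delta> \<Longrightarrow> (\<Sum>i\<le>n. C i * s ^ i) = 0" "k \<le> n"
  shows "C k = 0"
proof (rule ccontr)
  assume "C k \<noteq> 0"
  then have "finite {z. (\<Sum>i\<le>n. C i * z ^ i) = 0}"
    using assms(3) polyfun_finite_roots[of C n] by blast
  moreover have "{0<..<\<delta>} \<subseteq> {z. (\<Sum>i\<le>n. C i * z ^ i) = 0}" using assms(2) by auto
  ultimately show False using infinite_Ioo[OF assms(1)] finite_subset by blast
qed

text \<open>One variable is split off at a time: for fixed values of the others the polynomial in it
  has infinitely many roots, so each coefficient, a polynomial in the remaining variables, vanishes.
  A small positive box is enough and is what the sphere offers.\<close>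

lemma multivariate_poly_zero_coeffs:
  fixes c :: "('b \<Rightarrow> nat) \<Rightarrow> real"
  assumes "finite B" "0 < \<delta>"
  shows "finite A \<Longrightarrow> (\<And>\<alpha> \<beta>. \<alpha> \<in> A \<Longrightarrow> \<beta> \<in> A \<Longrightarrow> (\<forall>b\<in>B. \<alpha> b = \<beta> b) \<Longrightarrow> \<alpha> = \<beta>) \<Longrightarrow>
    (\<And>t. (\<forall>b\<in>B. 0 < t b \<and> t b < \<delta>) \<Longrightarrow> (\<Sum>\<alpha>\<in>A. c \<alpha> * (\<Prod>b\<in>B. t b ^ \<alpha> b)) = 0) \<Longrightarrow>
    \<alpha>\<^sub>0 \<in> A \<Longrightarrow> c \<alpha>\<^sub>0 = 0"
  using assms(1)
proof (induction B arbitrary: A \<alpha>\<^sub>0)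
  case empty
  then have "A = {\<alpha>\<^sub>0}" by auto
  then show ?case using empty.prems(3)[of "\<lambda>_. 0"] by simp
next
  case (insert b B)
  let ?A = "\<lambda>k. {\<alpha> \<in> A. \<alpha> b = k}"
  define n where "n = Max ((\<lambda>\<alpha>. \<alpha> b) ` A)"
  have n: "\<alpha> b \<le> n" if "\<alpha> \<in> A" for \<alpha> using that insert.prems(1) by (simp add: n_def)
  show ?case
  proof (rule insert.IH[of "?A (\<alpha>\<^sub>0 b)"])
    fix t assume t: "\<forall>b\<in>B. 0 < t b \<and> t b < \<delta>"
    define C where "C i = (\<Sum>\<alpha>\<in>?A i. c \<alpha> * (\<Prod>b\<in>B. t b ^ \<alpha> b))" for i
    have "C (\<alpha>\<^sub>0 b) = 0"
    proof (rule univariate_poly_zero_coeffs[OF assms(2) _ n[OF insert.prems(4)]])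
      fix s assume s: "0 < s" "s < \<delta>"
      have "0 = (\<Sum>\<alpha>\<in>A. c \<alpha> * (\<Prod>a\<in>insert b B. (t(b := s)) a ^ \<alpha> a))"
        using insert.prems(3)[of "t(b := s)"] s t by auto
      also have "\<dots> = (\<Sum>\<alpha>\<in>A. c \<alpha> * (\<Prod>a\<in>B. t a ^ \<alpha> a) * s ^ \<alpha> b)"
      proof (rule sum.cong[OF refl])
        fix \<alpha>
        have "(\<Prod>a\<in>B. (t(b := s)) a ^ \<alpha> a) = (\<Prod>a\<in>B. t a ^ \<alpha> a)"
          using insert.hyps by (intro prod.cong) auto
        then show "c \<alpha> * (\<Prod>a\<in>insert b B. (t(b := s)) a ^ \<alpha> a) = c \<alpha> * (\<Prod>a\<in>B. t a ^ \<alpha> a) * s ^ \<alpha> b"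
          using insert.hyps by simp
      qed
      also have "\<dots> = (\<Sum>i\<le>n. \<Sum>\<alpha>\<in>?A i. c \<alpha> * (\<Prod>a\<in>B. t a ^ \<alpha> a) * s ^ \<alpha> b)"
        by (rule sum.group[symmetric]) (use insert.prems(1) n in auto)
      also have "\<dots> = (\<Sum>i\<le>n. C i * s ^ i)"
        unfolding C_def sum_distrib_right by (intro sum.cong[OF refl]) auto
      finally show "(\<Sum>i\<le>n. C i * s ^ i) = 0" by simp
    qed
    then show "(\<Sum>\<alpha>\<in>?A (\<alpha>\<^sub>0 b). c \<alpha> * (\<Prod>b\<in>B. t b ^ \<alpha> b)) = 0" by (simp add: C_def)
  qed (use insert.prems in auto)
qed

lemma finite_exps: "finite (exps e m)"
proof (rule finite_subset)
  show "exps e m \<subseteq> {\<alpha>. \<forall>x. (x \<in> Basis \<longrightarrow> \<alpha> x \<in> {..m}) \<and> (x \<notin> Basis \<longrightarrow> \<alpha> x = 0)}"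
    by (auto simp: exps_def intro: member_le_sum)
qed (intro finite_set_of_finite_funs; simp)

lemma exps_disjoint: "\<alpha> \<in> exps e i \<Longrightarrow> \<alpha> \<in> exps e j \<Longrightarrow> i = j"
  by (simp add: exps_def)

text \<open>Comparing the points of the sphere with coordinates \<open>t b\<close> for \<open>b \<noteq> e\<close> and last coordinate
  \<open>\<plusminus> s\<close> separates the exponents \<open>0\<close> and \<open>1\<close> of \<open>x \<bullet> e\<close>.\<close>
lemma smono_independent:
  fixes e :: "'a::euclidean_space"
  assumes e: "e \<in> Basis" and fin: "finite A" and A: "\<And>\<alpha>. \<alpha> \<in> A \<Longrightarrow> \<exists>j. \<alpha> \<in> exps e j"
    and zero: "\<And>x. (\<Sum>\<alpha>\<in>A. c \<alpha> * smono \<alpha> x) = 0" and \<alpha>\<^sub>0: "\<alpha>\<^sub>0 \<in> A"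
  shows "c \<alpha>\<^sub>0 = 0"
proof -
  let ?B = "Basis - {e}"
  let ?A = "\<lambda>i. {\<alpha> \<in> A. \<alpha> e = i}"
  \<comment> \<open>With all coordinates but one below \<open>1 / DIM('a)\<close>, their squares sum
    to less than 1, which leaves a nonzero last coordinate \<open>\<plusminus> s\<close> on the
    sphere.\<close>
  have \<delta>: "0 < 1 / real DIM('a)" by simp
  have main: "(\<Sum>\<alpha>\<in>?A 0. c \<alpha> * (\<Prod>b\<in>?B. t b ^ \<alpha> b)) = 0 \<and> (\<Sum>\<alpha>\<in>?A 1. c \<alpha> * (\<Prod>b\<in>?B. t b ^ \<alpha> b)) = 0"
    if t: "\<forall>b\<in>?B. 0 < t b \<and> t b < 1 / real DIM('a)" for t
  proof -
    have "(\<Sum>b\<in>?B. (t b)\<^sup>2) \<le> (\<Sum>b\<in>?B. 1 / real DIM('a))"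
    proof (rule sum_mono)
      fix b assume "b \<in> ?B"
      then have b: "0 < t b" "t b < 1 / real DIM('a)" using t by auto
      moreover have "1 / real DIM('a) \<le> 1" by (simp add: Suc_leI)
      ultimately have "t b * t b \<le> t b * 1" by (intro mult_left_mono) linarith+
      then show "(t b)\<^sup>2 \<le> 1 / real DIM('a)" using b unfolding power2_eq_square by linarith
    qed
    also have "\<dots> = real (card ?B) / real DIM('a)" by simp
    also have "\<dots> < 1" using e by (simp add: card_Diff_singleton)
    finally have lt1: "(\<Sum>b\<in>?B. (t b)\<^sup>2) < 1" .
    define s where "s = sqrt (1 - (\<Sum>b\<in>?B. (t b)\<^sup>2))"
    have s: "s > 0" "s\<^sup>2 = 1 - (\<Sum>b\<in>?B. (t b)\<^sup>2)" using lt1 by (simp_all add: s_def)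
    let ?p = "\<Sum>\<alpha>\<in>?A 0. c \<alpha> * (\<Prod>b\<in>?B. t b ^ \<alpha> b)"
    let ?q = "\<Sum>\<alpha>\<in>?A 1. c \<alpha> * (\<Prod>b\<in>?B. t b ^ \<alpha> b)"
    have pq: "?p + r * ?q = 0" if r: "r\<^sup>2 = 1 - (\<Sum>b\<in>?B. (t b)\<^sup>2)" for r
    proof -
      define x where "x = (\<Sum>b\<in>Basis. (if b = e then r else t b) *\<^sub>R b)"
      have xb: "x \<bullet> b = (if b = e then r else t b)" if "b \<in> Basis" for b
        unfolding x_def by (rule inner_sum_left_Basis[OF that])
      have "x \<bullet> x = (\<Sum>b\<in>Basis. (x \<bullet> b)\<^sup>2)" by (simp add: euclidean_inner[of x x] power2_eq_square)
      also have "\<dots> = (x \<bullet> e)\<^sup>2 + (\<Sum>b\<in>?B. (x \<bullet> b)\<^sup>2)" by (rule sum.remove) (use e in auto)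
      also have "\<dots> = 1" using r e by (simp add: xb)
      finally have nx: "norm x = 1" by (simp add: norm_eq_sqrt_inner)
      have sm: "smono \<alpha> x = r ^ \<alpha> e * (\<Prod>b\<in>?B. t b ^ \<alpha> b)" for \<alpha>
      proof -
        have "smono \<alpha> x = (x \<bullet> e) ^ \<alpha> e * (\<Prod>b\<in>?B. (x \<bullet> b) ^ \<alpha> b)"
          using nx prod.remove[OF finite_Basis e, of "\<lambda>b. (x \<bullet> b) ^ \<alpha> b"] by (simp add: smono_def)
        also have "\<dots> = r ^ \<alpha> e * (\<Prod>b\<in>?B. t b ^ \<alpha> b)" using e by (simp add: xb)
        finally show ?thesis .
      qed
      have un: "A = ?A 0 \<union> ?A 1" using A by (fastforce simp: exps_def)
      have "0 = (\<Sum>\<alpha>\<in>?A 0 \<union> ?A 1. c \<alpha> * smono \<alpha> x)" using zero[of x] un by simp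
      also have "\<dots> = (\<Sum>\<alpha>\<in>?A 0. c \<alpha> * smono \<alpha> x) + (\<Sum>\<alpha>\<in>?A 1. c \<alpha> * smono \<alpha> x)"
        by (rule sum.union_disjoint) (use fin in auto)
      also have "\<dots> = ?p + r * ?q"
        by (simp add: sm sum_distrib_left mult_ac)
      finally show ?thesis by simp
    qed
    have "?p + s * ?q = 0" "?p + (- s) * ?q = 0" using pq[of s] pq[of "- s"] s(2) by auto
    moreover have "2 * s * ?q = (?p + s * ?q) - (?p + (- s) * ?q)" by simp
    ultimately show ?thesis using s(1) by auto
  qed
  have inj: "\<alpha> = \<beta>" if "\<alpha> \<in> ?A i" "\<beta> \<in> ?A i" "\<forall>b\<in>?B. \<alpha> b = \<beta> b" for i \<alpha> \<beta>
  proof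
    fix b show "\<alpha> b = \<beta> b" using that A[of \<alpha>] A[of \<beta>] by (cases "b \<in> ?B") (auto simp: exps_def)
  qed
  have "\<alpha>\<^sub>0 \<in> ?A 0 \<or> \<alpha>\<^sub>0 \<in> ?A 1" using A[OF \<alpha>\<^sub>0] \<alpha>\<^sub>0 by (auto simp: exps_def)
  then show ?thesis
  proof
    assume "\<alpha>\<^sub>0 \<in> ?A 0"
    then show ?thesis
      using main fin inj by (intro multivariate_poly_zero_coeffs[OF _ \<delta>, of ?B "?A 0" c]) auto
  next
    assume "\<alpha>\<^sub>0 \<in> ?A 1"
    then show ?thesis
      using main fin inj by (intro multivariate_poly_zero_coeffs[OF _ \<delta>, of ?B "?A 1" c]) auto
  qed
qed

lemma fs_span_image:
  assumes "finite A" "f \<in> fs.span (g ` A)"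
  obtains c where "\<And>x. f x = (\<Sum>\<alpha>\<in>A. c \<alpha> * g \<alpha> x)"
proof -
  let ?T = "{f. \<exists>c. \<forall>x. f x = (\<Sum>\<alpha>\<in>A. c \<alpha> * g \<alpha> x)}"
  have "fs.subspace ?T"
  proof (rule subspace_funI)
    show "(\<lambda>x. 0) \<in> ?T" by (auto intro!: exI[of _ "\<lambda>_. 0"])
    fix f h assume "f \<in> ?T" "h \<in> ?T"
    then obtain c d where "\<forall>x. f x = (\<Sum>\<alpha>\<in>A. c \<alpha> * g \<alpha> x)" "\<forall>x. h x = (\<Sum>\<alpha>\<in>A. d \<alpha> * g \<alpha> x)" by auto
    then show "(\<lambda>x. f x + h x) \<in> ?T"
      by (auto intro!: exI[of _ "\<lambda>\<alpha>. c \<alpha> + d \<alpha>"] simp: distrib_right sum.distrib)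
  next
    fix a f assume "f \<in> ?T"
    then obtain c where "\<forall>x. f x = (\<Sum>\<alpha>\<in>A. c \<alpha> * g \<alpha> x)" by auto
    then show "(\<lambda>x. a * f x) \<in> ?T"
      by (auto intro!: exI[of _ "\<lambda>\<alpha>. a * c \<alpha>"] simp: sum_distrib_left mult.assoc)
  qed
  moreover have "g ` A \<subseteq> ?T"
  proof clarify
    fix \<alpha> assume "\<alpha> \<in> A"
    then show "\<exists>c. \<forall>x. g \<alpha> x = (\<Sum>\<beta>\<in>A. c \<beta> * g \<beta> x)"
      using assms(1) by (intro exI[of _ "\<lambda>\<beta>. if \<beta> = \<alpha> then 1 else 0"])
        (simp add: if_distrib if_distribR sum.delta cong: if_cong)
  qed
  ultimately have "fs.span (g ` A) \<subseteq> ?T" by (rule fs.span_minimal[rotated])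
  then show ?thesis using assms(2) that by auto
qed

section \<open>Eigenfunctions with a prescribed leading monomial\<close>

text \<open>The dimension bound excludes the zero-dimensional sphere, for which \<open>lam 0\<close>
  and \<open>lam 1\<close> coincide.\<close>

lemma lam_strict_mono:
  assumes "DIM('a::euclidean_space) \<ge> 2" "j < m"
  shows "lam TYPE('a) j < lam TYPE('a) m"
proof -
  have "lam TYPE('a) m - lam TYPE('a) j = (real m - real j) * (real m + real j + (real DIM('a) - 2))"
    by (simp add: lam_def algebra_simps)
  also have "\<dots> > 0" using assms by (intro mult_pos_pos) auto
  finally show ?thesis by simp
qed

lemma lam_inj: "DIM('a::euclidean_space) \<ge> 2 \<Longrightarrow> lam TYPE('a) j = lam TYPE('a) m \<longleftrightarrow> j = m"
  using lam_strict_mono[where 'a='a, of j m] lam_strict_mono[where 'a='a, of m j] by (cases j m rule: linorder_cases) auto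

text \<open>A spherical harmonic with leading monomial \<open>smono \<alpha>\<close>. The subtracted
  correction has lower degree and cancels the error of \<open>smono \<alpha>\<close> in the
  eigenvalue equation; it exists because \<open>lam m\<close> differs from \<open>lam j\<close> for
  all \<open>j < m\<close>.\<close>

definition harm_poly :: "'a::euclidean_space \<Rightarrow> ('a \<Rightarrow> nat) \<Rightarrow> 'a \<Rightarrow> real" where
  "harm_poly e \<alpha> x = smono \<alpha> x - (SOME g. g \<in> sphere_poly e (sum \<alpha> Basis) \<and>
     (\<forall>x. sphere_lap g x + lam TYPE('a) (sum \<alpha> Basis) * g x
        = sphere_lap (smono \<alpha>) x + lam TYPE('a) (sum \<alpha> Basis) * smono \<alpha> x)) x"

context
  fixes e :: "'a::euclidean_space"
  assumes e: "e \<in> Basis" and dim2: "DIM('a) \<ge> 2"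
begin

lemma harm_props:
  assumes "\<alpha> \<in> exps e m"
  shows "(\<lambda>x. smono \<alpha> x - harm_poly e \<alpha> x) \<in> sphere_poly e m"
    and "harm_poly e \<alpha> \<in> sphere_smooth"
    and "sphere_lap (harm_poly e \<alpha>) x = - lam TYPE('a) m * harm_poly e \<alpha> x"
proof -
  have m: "sum \<alpha> Basis = m" using assms by (simp add: exps_def)
  let ?P = "\<lambda>g. g \<in> sphere_poly e m \<and>
     (\<forall>x. sphere_lap g x + lam TYPE('a) m * g x = sphere_lap (smono \<alpha>) x + lam TYPE('a) m * smono \<alpha> x)"
  let ?q = "\<lambda>x. sphere_lap (smono \<alpha>) x + lam TYPE('a) m * smono \<alpha> x"
  have "smono \<alpha> \<in> sphere_poly e (Suc m)" by (rule smono_in_sphere_poly[OF assms]) simp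
  then have "?q \<in> sphere_poly e m" using sphere_poly_leading_terms[OF e] by blast
  then have "\<exists>g. ?P g"
    using sphere_poly_resolvent[OF e, of m "lam TYPE('a) m" ?q] lam_strict_mono[OF dim2] by (metis less_irrefl)
  then have P: "?P (SOME g. ?P g)" by (rule someI_ex)
  define g where "g = (SOME g. ?P g)"
  have harm: "harm_poly e \<alpha> = (\<lambda>x. smono \<alpha> x - g x)"
    by (rule ext) (simp only: harm_poly_def g_def m)
  from P have g: "g \<in> sphere_poly e m" and gq: "sphere_lap g x + lam TYPE('a) m * g x = ?q x" for x
    by (simp_all add: g_def)
  have gs: "g \<in> sphere_smooth" using g sphere_poly_smooth by auto
  show "(\<lambda>x. smono \<alpha> x - harm_poly e \<alpha> x) \<in> sphere_poly e m" using g by (simp add: harm)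
  show "harm_poly e \<alpha> \<in> sphere_smooth" unfolding harm by (rule sphere_smooth_diff[OF smono_smooth[OF assms] gs])
  show "sphere_lap (harm_poly e \<alpha>) x = - lam TYPE('a) m * harm_poly e \<alpha> x"
    unfolding harm sphere_lap_diff[OF smono_smooth[OF assms] gs] using gq[of x] by (simp add: algebra_simps)
qed

lemma sphere_poly_subset_harm: "sphere_poly e m \<subseteq> fs.span (\<Union>j<m. harm_poly e ` exps e j)"
proof (induction m)
  case 0
  then show ?case by (simp add: sphere_poly_0 zero_fun_def)
next
  case (Suc m)
  let ?S = "fs.span (\<Union>j<Suc m. harm_poly e ` exps e j)"
  have low: "sphere_poly e m \<subseteq> ?S"
    using Suc.IH fs.span_mono[of "\<Union>j<m. harm_poly e ` exps e j" "\<Union>j<Suc m. harm_poly e ` exps e j"] by fastforce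
  show ?case
  proof (rule sphere_poly_minimal)
    show sub: "fs.subspace ?S" by simp
    fix \<alpha> j assume j: "j < Suc m" "\<alpha> \<in> exps e j"
    show "smono \<alpha> \<in> ?S"
    proof (cases "j < m")
      case True
      then show ?thesis using smono_in_sphere_poly[OF j(2)] low by blast
    next
      case False
      then have \<alpha>: "\<alpha> \<in> exps e m" using j less_Suc_eq by auto
      then have "harm_poly e \<alpha> \<in> ?S" by (intro fs.span_base) auto
      then have "(\<lambda>x. harm_poly e \<alpha> x + (smono \<alpha> x - harm_poly e \<alpha> x)) \<in> ?S"
        using low harm_props(1)[OF \<alpha>] by (intro subspace_fun_add[OF sub]) auto
      then show ?thesis by simp
    qed
  qed
qed

text \<open>A vanishing combination of the eigenfunctions would express the same combination of
  their leading monomials through monomials of lower degree, against the independence of all reduced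
  monomials together.\<close>

lemma harm_independent:
  assumes zero: "\<And>x. (\<Sum>\<alpha>\<in>exps e m. c \<alpha> * harm_poly e \<alpha> x) = 0" and \<alpha>\<^sub>0: "\<alpha>\<^sub>0 \<in> exps e m"
  shows "c \<alpha>\<^sub>0 = 0"
proof -
  let ?L = "\<Union>j<m. exps e j"
  have "(\<lambda>x. \<Sum>\<alpha>\<in>exps e m. c \<alpha> * (smono \<alpha> x - harm_poly e \<alpha> x)) \<in> sphere_poly e m"
    by (intro subspace_fun_sum subspace_fun_scale subspace_sphere_poly harm_props)
  moreover have "(\<Sum>\<alpha>\<in>exps e m. c \<alpha> * (smono \<alpha> x - harm_poly e \<alpha> x)) = (\<Sum>\<alpha>\<in>exps e m. c \<alpha> * smono \<alpha> x)" for x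
    using zero[of x] by (simp add: right_diff_distrib sum_subtractf)
  ultimately have "(\<lambda>x. \<Sum>\<alpha>\<in>exps e m. c \<alpha> * smono \<alpha> x) \<in> fs.span (smono ` ?L)"
    by (simp add: sphere_poly_def)
  moreover have fin: "finite ?L" by (simp add: finite_exps)
  ultimately obtain d where d: "\<And>x. (\<Sum>\<alpha>\<in>exps e m. c \<alpha> * smono \<alpha> x) = (\<Sum>\<alpha>\<in>?L. d \<alpha> * smono \<alpha> x)"
    using fs_span_image[OF fin] by blast
  let ?f = "\<lambda>\<alpha>. if \<alpha> \<in> exps e m then c \<alpha> else - d \<alpha>"
  have disj: "\<alpha> \<notin> exps e m" if "\<alpha> \<in> ?L" for \<alpha> using that exps_disjoint[of \<alpha> e] by blast
  have "(\<Sum>\<alpha>\<in>exps e m \<union> ?L. ?f \<alpha> * smono \<alpha> x) = 0" for x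
  proof -
    have "(\<Sum>\<alpha>\<in>exps e m \<union> ?L. ?f \<alpha> * smono \<alpha> x) = (\<Sum>\<alpha>\<in>exps e m. ?f \<alpha> * smono \<alpha> x) + (\<Sum>\<alpha>\<in>?L. ?f \<alpha> * smono \<alpha> x)"
      by (rule sum.union_disjoint) (use finite_exps disj in auto)
    also have "(\<Sum>\<alpha>\<in>?L. ?f \<alpha> * smono \<alpha> x) = - (\<Sum>\<alpha>\<in>?L. d \<alpha> * smono \<alpha> x)"
      unfolding sum_negf[symmetric] by (rule sum.cong[OF refl]) (use disj in auto)
    finally show ?thesis using d[of x] by simp
  qed
  then have "?f \<alpha>\<^sub>0 = 0"
    using fin \<alpha>\<^sub>0 by (intro smono_independent[OF e, of "exps e m \<union> ?L" ?f]) (auto simp: finite_exps)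
  then show ?thesis using \<alpha>\<^sub>0 by simp
qed

lemma dim_span_harm: "fs.dim (fs.span (harm_poly e ` exps e m)) = card (exps e m)"
proof -
  \<comment> \<open>Independence concerns the image set, which would be smaller if two exponents
    gave the same function. Such a coincidence is a vanishing combination with coefficients 1 and
    -1.\<close>
  have inj: "inj_on (harm_poly e) (exps e m)"
  proof (rule inj_onI, rule ccontr)
    fix \<alpha> \<beta> assume ab: "\<alpha> \<in> exps e m" "\<beta> \<in> exps e m" "harm_poly e \<alpha> = harm_poly e \<beta>" "\<alpha> \<noteq> \<beta>"
    let ?c = "\<lambda>\<gamma>. (if \<gamma> = \<alpha> then 1 else 0) - (if \<gamma> = \<beta> then 1 else (0::real))"
    have "(\<Sum>\<gamma>\<in>exps e m. ?c \<gamma> * harm_poly e \<gamma> x) = 0" for x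
    proof -
      have "(\<Sum>\<gamma>\<in>exps e m. ?c \<gamma> * harm_poly e \<gamma> x)
        = (\<Sum>\<gamma>\<in>exps e m. if \<gamma> = \<alpha> then harm_poly e \<gamma> x else 0) - (\<Sum>\<gamma>\<in>exps e m. if \<gamma> = \<beta> then harm_poly e \<gamma> x else 0)"
        unfolding sum_subtractf[symmetric] by (rule sum.cong) auto
      then show ?thesis using ab(1-3) by (simp add: finite_exps)
    qed
    from harm_independent[OF this ab(1)] ab(4) show False by simp
  qed
  have "fs.independent (harm_poly e ` exps e m)"
  proof (rule fs.independent_if_scalars_zero)
    show "finite (harm_poly e ` exps e m)" by (simp add: finite_exps)
    fix f h assume 0: "(\<Sum>u\<in>harm_poly e ` exps e m. (\<lambda>x. f u * u x)) = 0" and h: "h \<in> harm_poly e ` exps e m"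
    have "(\<Sum>\<alpha>\<in>exps e m. f (harm_poly e \<alpha>) * harm_poly e \<alpha> x) = 0" for x
      using fun_cong[OF 0, of x] by (simp add: sum_fun_apply sum.reindex[OF inj])
    from harm_independent[OF this] h show "f h = 0" by auto
  qed
  then show ?thesis by (simp add: fs.dim_eq_card_independent card_image[OF inj])
qed

end

section \<open>Density of polynomials among smooth functions\<close>

lemma sphere_poly_mult:
  assumes e: "e \<in> Basis" and f: "f \<in> sphere_poly e m" and g: "g \<in> sphere_poly e n"
  shows "(\<lambda>x. f x * g x) \<in> sphere_poly e (m + n)"
proof -
  have mono: "(\<lambda>x. smono \<alpha> x * g x) \<in> sphere_poly e (j + n)" if "\<alpha> \<in> exps e j" for \<alpha> j
    using that
  proof (induction j arbitrary: \<alpha>)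
    case 0
    have "smono (\<lambda>b. 0) x * g x = g x" for x
    proof (cases "norm x = 1")
      case False
      then have "g x = 0" using g sphere_poly_smooth sphere_smooth_off by blast
      then show ?thesis by simp
    qed (simp add: smono_def)
    then have "(\<lambda>x. smono (\<lambda>b. 0) x * g x) = g" by (rule ext)
    then show ?case using 0 g by (simp add: exps_0)
  next
    case (Suc j)
    from Suc.prems obtain b \<beta> where b: "b \<in> Basis" "\<beta> \<in> exps e j" "\<alpha> = \<beta>(b := Suc (\<beta> b))"
      by (rule exps_SucE)
    from sphere_poly_coord[OF e b(1) Suc.IH[OF b(2)]] show ?case
      unfolding b(3) smono_Suc[OF b(1)] by (simp add: mult.assoc)
  qed
  let ?T = "{f. (\<lambda>x. f x * g x) \<in> sphere_poly e (m + n)}"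
  have "fs.subspace ?T"
    using subspace_sphere_poly[of e "m + n"]
    by (intro subspace_funI) (auto simp: distrib_right mult.assoc
        intro: subspace_fun_zero subspace_fun_add subspace_fun_scale)
  moreover have "smono \<alpha> \<in> ?T" if "j < m" "\<alpha> \<in> exps e j" for \<alpha> j
    using mono[OF that(2)] sphere_poly_mono[of "j + n" "m + n" e] that(1) by auto
  ultimately have "sphere_poly e m \<subseteq> ?T" by (rule sphere_poly_minimal)
  then show ?thesis using f by auto
qed

text \<open>The induction follows the generation of polynomial functions from linear forms and
  constants. The restricting factor \<open>sphere_one\<close> is idempotent, hence compatible with
  products.\<close>

lemma real_polynomial_function_sphere_poly:
  fixes e :: "'a::euclidean_space"
  assumes e: "e \<in> Basis" and p: "real_polynomial_function p"
  shows "\<exists>m. (\<lambda>x. sphere_one x * p x) \<in> sphere_poly e m"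
  using p
proof induction
  case (linear p)
  have one: "sphere_one \<in> sphere_poly e 1"
    using smono_in_sphere_poly[of "\<lambda>b. 0" e 0 1] by (simp add: exps_0 smono_0)
  have "sphere_one x * p x = (\<Sum>b\<in>Basis. p b * ((x \<bullet> b) * sphere_one x))" for x
  proof -
    have "p x = p (\<Sum>b\<in>Basis. (x \<bullet> b) *\<^sub>R b)" by (simp add: euclidean_representation)
    also have "\<dots> = (\<Sum>b\<in>Basis. (x \<bullet> b) * p b)"
      using bounded_linear.linear[OF linear] by (simp add: linear_sum linear_scale)
    finally show ?thesis by (simp add: sum_distrib_left mult_ac)
  qed
  moreover have "(\<lambda>x. \<Sum>b\<in>Basis. p b * ((x \<bullet> b) * sphere_one x)) \<in> sphere_poly e (Suc 1)"
    by (intro subspace_fun_sum subspace_fun_scale subspace_sphere_poly sphere_poly_coord[OF e _ one])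
  ultimately show ?case by auto
next
  case (const c)
  have "sphere_one \<in> sphere_poly e 1"
    using smono_in_sphere_poly[of "\<lambda>b. 0" e 0 1] by (simp add: exps_0 smono_0)
  from subspace_fun_scale[OF subspace_sphere_poly this, of c] show ?case by (auto simp: mult.commute)
next
  case (add p q)
  then obtain m n where "(\<lambda>x. sphere_one x * p x) \<in> sphere_poly e m" "(\<lambda>x. sphere_one x * q x) \<in> sphere_poly e n"
    by auto
  then have "(\<lambda>x. sphere_one x * p x) \<in> sphere_poly e (max m n)" "(\<lambda>x. sphere_one x * q x) \<in> sphere_poly e (max m n)"
    using sphere_poly_mono[of m "max m n" e] sphere_poly_mono[of n "max m n" e] by auto
  from subspace_fun_add[OF subspace_sphere_poly this] show ?case by (auto simp: distrib_left)
next
  case (mult p q)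
  then obtain m n where mn: "(\<lambda>x. sphere_one x * p x) \<in> sphere_poly e m" "(\<lambda>x. sphere_one x * q x) \<in> sphere_poly e n"
    by auto
  have "sphere_one x * p x * (sphere_one x * q x) = sphere_one x * (p x * q x)" for x :: 'a
    by (simp add: sphere_one_def)
  then have "(\<lambda>x. sphere_one x * p x * (sphere_one x * q x)) = (\<lambda>x. sphere_one x * (p x * q x))" by (rule ext)
  then show ?case using sphere_poly_mult[OF e mn] by auto
qed

text \<open>If \<open>v\<close> is a polynomial uniformly within \<open>\<epsilon>\<close> of
  \<open>u\<close>, orthogonality replaces the integral of \<open>u^2\<close> by that of
  \<open>u * (u - v)\<close>, which is at most \<open>\<epsilon>\<close> times the absolute integral
  \<open>M\<close> of \<open>u\<close>.\<close>

lemma sphere_poly_orthogonal_imp_0: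
  fixes u :: "'a::euclidean_space \<Rightarrow> real"
  assumes e: "e \<in> Basis" and u: "u \<in> sphere_smooth"
    and orth: "\<And>m v. v \<in> sphere_poly e m \<Longrightarrow> sphint (\<lambda>x. u x * v x) = 0"
  shows "u = (\<lambda>x. 0)"
proof -
  define M where "M = (\<integral>x. \<bar>bump x / norm x * u (sgn x)\<bar> \<partial>lborel)"
  have "sphint (\<lambda>x. u x * u x) \<le> \<epsilon> * M" if \<epsilon>: "\<epsilon> > 0" for \<epsilon>
  proof -
    have "continuous_on (sphere 0 1) (\<lambda>x. u (sgn x))"
      by (rule continuous_on_subset[OF sphere_smooth_continuous[OF u]]) auto
    then have "continuous_on (sphere 0 1) u"
      by (rule continuous_on_eq) (simp add: sgn_eq_self)
    then obtain p where p: "real_polynomial_function p" "\<And>x. x \<in> sphere 0 1 \<Longrightarrow> \<bar>u x - p x\<bar> < \<epsilon>"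
      using Stone_Weierstrass_real_polynomial_function[OF compact_sphere _ \<epsilon>] by metis
    obtain m where m: "(\<lambda>x. sphere_one x * p x) \<in> sphere_poly e m"
      using real_polynomial_function_sphere_poly[OF e p(1)] by auto
    let ?v = "\<lambda>x. sphere_one x * p x"
    have v: "?v \<in> sphere_smooth" using m sphere_poly_smooth by blast
    have w: "(\<lambda>x. u x - ?v x) \<in> sphere_smooth" by (rule sphere_smooth_diff[OF u v])
    have "sphint (\<lambda>x. u x * u x) = sphint (\<lambda>x. u x * (u x - ?v x) + u x * ?v x)"
      by (simp add: algebra_simps)
    also have "\<dots> = sphint (\<lambda>x. u x * (u x - ?v x))"
      using sphint_add[OF sphere_smooth_mult[OF u w] sphere_smooth_mult[OF u v]] orth[OF m] by simp
    also have "\<dots> \<le> \<bar>\<dots>\<bar>" by simp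
    also have "\<dots> \<le> \<epsilon> * M" unfolding M_def
    proof (rule sphint_mult_bound[OF u w])
      fix x :: 'a assume "norm x = 1"
      then show "\<bar>u x - ?v x\<bar> \<le> \<epsilon>" using p(2)[of x] by (simp add: sphere_one_def)
    qed
    finally show ?thesis .
  qed
  note bound = this
  have M0: "M \<ge> 0" unfolding M_def by (intro integral_nonneg_AE) auto
  have "sphint (\<lambda>x. u x * u x) \<le> 0"
  proof (rule field_le_epsilon)
    fix \<eta> :: real assume "\<eta> > 0"
    \<comment> \<open>The denominator \<open>M + 1\<close> avoids a separate case
      \<open>M = 0\<close>.\<close>
    then have "sphint (\<lambda>x. u x * u x) \<le> \<eta> / (M + 1) * M" using M0 by (intro bound) simp
    also have "\<dots> \<le> \<eta>" using M0 \<open>\<eta> > 0\<close> by (simp add: divide_simps mult_left_mono)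
    finally show "sphint (\<lambda>x. u x * u x) \<le> 0 + \<eta>" by simp
  qed
  then have "sphint (\<lambda>x. u x * u x) = 0" using sphint_square_nonneg[of u] by simp
  then show ?thesis by (rule sphint_square_eq_0[OF u])
qed

section \<open>Orthogonal projection and completeness of the eigenfunctions\<close>

lemma sphint_orthogonal_span:
  assumes w: "w \<in> sphere_smooth" and B: "B \<subseteq> sphere_smooth"
    and orth: "\<And>b. b \<in> B \<Longrightarrow> sphint (\<lambda>x. w x * b x) = 0" and "f \<in> fs.span B"
  shows "sphint (\<lambda>x. w x * f x) = 0"
proof -
  let ?T = "{f \<in> sphere_smooth. sphint (\<lambda>x. w x * f x) = 0}"
  have "fs.subspace ?T"
  proof (rule subspace_funI)
    show "(\<lambda>x. 0) \<in> ?T" by (simp add: sphere_smooth_zero sphint_def)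
    fix f g assume "f \<in> ?T" "g \<in> ?T"
    then show "(\<lambda>x. f x + g x) \<in> ?T"
      using sphint_add[OF sphere_smooth_mult[OF w, of f] sphere_smooth_mult[OF w, of g]]
      by (auto simp: distrib_left intro: sphere_smooth_add)
  next
    fix c f assume "f \<in> ?T"
    then show "(\<lambda>x. c * f x) \<in> ?T"
      using sphint_scale[of c "\<lambda>x. w x * f x"] by (simp add: sphere_smooth_scale mult.left_commute)
  qed
  then have "fs.span B \<subseteq> ?T" using B orth by (intro fs.span_minimal) auto
  then show ?thesis using assms by auto
qed

lemma span_sphere_smooth: "B \<subseteq> sphere_smooth \<Longrightarrow> fs.span B \<subseteq> sphere_smooth"
  by (intro fs.span_minimal subspace_sphere_smooth)

text \<open>Gram-Schmidt by induction: the new element is first made orthogonal to the old ones,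
  then its component is added. The family may be dependent, so a residual may vanish.\<close>

lemma sphint_orthogonal_projection:
  assumes "finite B" "B \<subseteq> sphere_smooth" "u \<in> sphere_smooth"
  shows "\<exists>p\<in>fs.span B. \<forall>b\<in>B. sphint (\<lambda>x. (u x - p x) * b x) = 0"
  using assms
proof (induction B arbitrary: u)
  case empty
  then show ?case by simp
next
  case (insert b B)
  then have B: "B \<subseteq> sphere_smooth" and b: "b \<in> sphere_smooth" and u: "u \<in> sphere_smooth" by auto
  from insert.IH[OF B b] obtain q where q: "q \<in> fs.span B" "\<And>c. c \<in> B \<Longrightarrow> sphint (\<lambda>x. (b x - q x) * c x) = 0"
    by auto
  from insert.IH[OF B u] obtain r where r: "r \<in> fs.span B" "\<And>c. c \<in> B \<Longrightarrow> sphint (\<lambda>x. (u x - r x) * c x) = 0"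
    by auto
  let ?b = "\<lambda>x. b x - q x"
  have qs: "q \<in> sphere_smooth" and rs: "r \<in> sphere_smooth" using q r span_sphere_smooth[OF B] by auto
  have bs: "?b \<in> sphere_smooth" by (rule sphere_smooth_diff[OF b qs])
  \<comment> \<open>If the residual \<open>?b\<close> has norm zero the quotient is 0 by convention;
    \<open>?b\<close> is then the zero function and the orthogonality to it is trivial.\<close>
  define a where "a = sphint (\<lambda>x. (u x - r x) * ?b x) / sphint (\<lambda>x. ?b x * ?b x)"
  let ?p = "\<lambda>x. r x + a * ?b x"
  have span_B: "fs.span B \<subseteq> fs.span (insert b B)" by (rule fs.span_mono) auto
  have "b \<in> fs.span (insert b B)" by (rule fs.span_base) simp
  then have p: "?p \<in> fs.span (insert b B)"
    using span_B q r
    by (intro subspace_fun_add subspace_fun_scale subspace_fun_diff fs.subspace_span) auto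
  have ps: "?p \<in> sphere_smooth" by (intro sphere_smooth_add sphere_smooth_scale rs bs)
  have ws: "(\<lambda>x. u x - ?p x) \<in> sphere_smooth" by (rule sphere_smooth_diff[OF u ps])
  have split: "sphint (\<lambda>x. (u x - ?p x) * c x) = sphint (\<lambda>x. (u x - r x) * c x) - a * sphint (\<lambda>x. ?b x * c x)"
    if c: "c \<in> sphere_smooth" for c
  proof -
    have "sphint (\<lambda>x. (u x - r x) * c x - a * (?b x * c x))
        = sphint (\<lambda>x. (u x - r x) * c x) - sphint (\<lambda>x. a * (?b x * c x))"
      by (intro sphint_diff sphere_smooth_mult sphere_smooth_scale sphere_smooth_diff u rs bs c b qs)
    moreover have "(u x - ?p x) * c x = (u x - r x) * c x - a * (?b x * c x)" for x by (simp add: algebra_simps)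
    ultimately show ?thesis by (simp only: sphint_scale)
  qed
  have oB: "sphint (\<lambda>x. (u x - ?p x) * c x) = 0" if "c \<in> B" for c
    using split[of c] that B r(2) q(2) by auto
  have ob: "sphint (\<lambda>x. (u x - ?p x) * ?b x) = 0"
  proof (cases "sphint (\<lambda>x. ?b x * ?b x) = 0")
    case True
    from sphint_square_eq_0[OF bs True] have b0: "b x - q x = 0" for x by (rule fun_cong)
    show ?thesis unfolding b0 by (simp add: sphint_def)
  next
    case False
    then show ?thesis using split[OF bs] by (simp add: a_def)
  qed
  have "sphint (\<lambda>x. (u x - ?p x) * b x) = sphint (\<lambda>x. (u x - ?p x) * ?b x + (u x - ?p x) * q x)"
    by (simp add: algebra_simps)
  also have "\<dots> = sphint (\<lambda>x. (u x - ?p x) * ?b x) + sphint (\<lambda>x. (u x - ?p x) * q x)"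
    by (intro sphint_add sphere_smooth_mult ws bs qs)
  also have "\<dots> = 0" using ob sphint_orthogonal_span[OF ws B oB q(1)] by simp
  finally show ?case using p oB by (intro bexI[of _ ?p]) auto
qed

lemma eigenspace_iff:
  "u \<in> eigenspace \<mu> \<longleftrightarrow> u \<in> sphere_smooth \<and> (\<forall>x. sphere_lap u x = - \<mu> * u x)"
proof -
  have "(\<forall>x\<in>sphere 0 1. laplace_beltrami u x + \<mu> * u x = 0) \<longleftrightarrow> (\<forall>x. sphere_lap u x = - \<mu> * u x)"
    if u: "u \<in> sphere_smooth"
  proof -
    have "sphere_lap u x = - \<mu> * u x" if "norm x \<noteq> 1" for x
      using that sphere_smooth_off[OF u that] sphere_smooth_off[OF sphere_lap_in_sphere_smooth[OF u] that] by simp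
    moreover have "laplace_beltrami u x = sphere_lap u x" if "norm x = 1" for x
      by (rule laplace_beltrami_eq_sphere_lap[OF u that])
    ultimately show ?thesis by (auto simp: add_eq_0_iff2)
  qed
  moreover have "u \<in> eigenspace \<mu> \<longleftrightarrow> u \<in> sphere_smooth \<and> (\<forall>x\<in>sphere 0 1. laplace_beltrami u x + \<mu> * u x = 0)"
    by (auto simp: eigenspace_def sphere_smooth_def)
  ultimately show ?thesis by blast
qed

lemma subspace_eigenspace: "fs.subspace (eigenspace \<mu>)"
  by (rule subspace_funI)
     (auto simp: eigenspace_iff sphere_smooth_zero sphere_smooth_add sphere_smooth_scale
        sphere_lap_zero sphere_lap_add sphere_lap_scale algebra_simps)

lemma eigenspaces_orthogonal:
  assumes "u \<in> eigenspace \<mu>" "v \<in> eigenspace \<nu>" "\<mu> \<noteq> \<nu>"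
  shows "sphint (\<lambda>x. u x * v x) = 0"
proof -
  have u: "u \<in> sphere_smooth" "sphere_lap u = (\<lambda>x. - \<mu> * u x)"
    and v: "v \<in> sphere_smooth" "sphere_lap v = (\<lambda>x. - \<nu> * v x)"
    using assms by (auto simp: eigenspace_iff)
  have "sphint (\<lambda>x. (- \<nu>) * (u x * v x)) = sphint (\<lambda>x. (- \<mu>) * (u x * v x))"
    using sphere_lap_symmetric[OF u(1) v(1)] by (simp add: u(2) v(2) mult_ac)
  then have "\<nu> * sphint (\<lambda>x. u x * v x) = \<mu> * sphint (\<lambda>x. u x * v x)"
    unfolding sphint_scale by simp
  then show ?thesis using assms(3)[symmetric] by (simp only: mult_cancel_right) simp
qed

lemma harm_in_eigenspace:
  fixes e :: "'a::euclidean_space"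
  assumes "e \<in> Basis" "DIM('a) \<ge> 2" "\<alpha> \<in> exps e m"
  shows "harm_poly e \<alpha> \<in> eigenspace (lam TYPE('a) m)"
  using harm_props[OF assms] by (auto simp: eigenspace_iff)

text \<open>Subtracting the projection to \<open>span B\<close> leaves an element of the same
  eigenspace. It is orthogonal to the harmonics in \<open>B\<close> by construction and to those of
  other eigenvalues by symmetry, hence to every polynomial, so it is zero. With \<open>B\<close> the
  harmonics of one degree this computes an eigenspace; with \<open>B\<close> empty it excludes
  further eigenvalues.\<close>

lemma eigenspace_subset_span_harm:
  fixes e :: "'a::euclidean_space"
  assumes e: "e \<in> Basis" and d: "DIM('a) \<ge> 2" and u: "u \<in> eigenspace \<mu>"
    and "finite B" and B: "B \<subseteq> eigenspace \<mu>"
    and hB: "\<And>\<alpha> m. \<alpha> \<in> exps e m \<Longrightarrow> lam TYPE('a) m = \<mu> \<Longrightarrow> harm_poly e \<alpha> \<in> B"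
  shows "u \<in> fs.span B"
proof -
  have us: "u \<in> sphere_smooth" and Bs: "B \<subseteq> sphere_smooth" using u B by (auto simp: eigenspace_iff)
  obtain p where p: "p \<in> fs.span B" "\<And>b. b \<in> B \<Longrightarrow> sphint (\<lambda>x. (u x - p x) * b x) = 0"
    using sphint_orthogonal_projection[OF assms(4) Bs us] by blast
  let ?w = "\<lambda>x. u x - p x"
  have "p \<in> eigenspace \<mu>" using p(1) fs.span_minimal[OF B subspace_eigenspace] by auto
  then have w: "?w \<in> eigenspace \<mu>" by (intro subspace_fun_diff subspace_eigenspace u)
  then have ws: "?w \<in> sphere_smooth" by (simp add: eigenspace_iff)
  have oh: "sphint (\<lambda>x. ?w x * harm_poly e \<alpha> x) = 0" if "\<alpha> \<in> exps e m" for \<alpha> m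
  proof (cases "lam TYPE('a) m = \<mu>")
    case True
    then show ?thesis using p(2) hB that by auto
  next
    case False
    then show ?thesis using eigenspaces_orthogonal[OF w harm_in_eigenspace[OF e d that]] by simp
  qed
  have "?w = (\<lambda>x. 0)"
  proof (rule sphere_poly_orthogonal_imp_0[OF e ws])
    fix m v assume "v \<in> sphere_poly e m"
    then have "v \<in> fs.span (\<Union>j<m. harm_poly e ` exps e j)" using sphere_poly_subset_harm[OF e d] by auto
    moreover have "(\<Union>j<m. harm_poly e ` exps e j) \<subseteq> sphere_smooth" using harm_props(2)[OF e d] by auto
    ultimately show "sphint (\<lambda>x. ?w x * v x) = 0" using sphint_orthogonal_span[OF ws] oh by blast
  qed
  then have "u = p" by (simp add: fun_eq_iff)
  then show ?thesis using p(1) by simp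
qed

lemma eigen_mult_lam:
  fixes e :: "'a::euclidean_space"
  assumes "e \<in> Basis" "DIM('a) \<ge> 2"
  shows "eigen_mult TYPE('a) (lam TYPE('a) m) = card (exps e m)"
proof -
  have "eigenspace (lam TYPE('a) m) = fs.span (harm_poly e ` exps e m)"
  proof
    show "eigenspace (lam TYPE('a) m) \<subseteq> fs.span (harm_poly e ` exps e m)"
      using harm_in_eigenspace[OF assms] lam_inj[OF assms(2)]
      by (intro subsetI eigenspace_subset_span_harm[OF assms]) (auto simp: finite_exps)
    show "fs.span (harm_poly e ` exps e m) \<subseteq> eigenspace (lam TYPE('a) m)"
      using harm_in_eigenspace[OF assms] by (intro fs.span_minimal subspace_eigenspace) auto
  qed
  then show ?thesis by (simp only: eigen_mult_def dim_span_harm[OF assms])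
qed

lemma eigen_mult_not_lam:
  assumes "DIM('a::euclidean_space) \<ge> 2" "\<mu> \<notin> range (lam TYPE('a))"
  shows "eigen_mult TYPE('a) \<mu> = 0"
proof -
  obtain e :: 'a where e: "e \<in> Basis" using nonempty_Basis by blast
  have "eigenspace \<mu> \<subseteq> fs.span ({} :: ('a \<Rightarrow> real) set)"
    using assms by (intro subsetI eigenspace_subset_span_harm[OF e]) auto
  then have "fs.dim (eigenspace \<mu> :: ('a \<Rightarrow> real) set) = 0"
    using fs.dim_le_card[of "eigenspace \<mu> :: ('a \<Rightarrow> real) set" "{}"] by simp
  then show ?thesis by (simp add: eigen_mult_def)
qed

section \<open>Multiplicities, eigenvalue sums and Weyl constants\<close>

text \<open>Stars and bars: the exponent of a new variable is \<open>m - i\<close> when the others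
  sum to \<open>i\<close>, and the counts for \<open>i \<le> m\<close> add up by the hockey-stick
  identity.\<close>

lemma card_exponents:
  fixes A :: "'a set"
  assumes "finite A" "A \<noteq> {}"
  shows "card {\<alpha> :: 'a \<Rightarrow> nat. (\<forall>b. b \<notin> A \<longrightarrow> \<alpha> b = 0) \<and> sum \<alpha> A = m} = (m + (card A - 1)) choose (card A - 1)"
  using assms
proof (induction A arbitrary: m rule: finite_ne_induct)
  case (singleton a)
  have "{\<alpha> :: 'a \<Rightarrow> nat. (\<forall>b. b \<notin> {a} \<longrightarrow> \<alpha> b = 0) \<and> sum \<alpha> {a} = m} = {\<lambda>b. if b = a then m else 0}"
    by (auto simp: fun_eq_iff)
  then show ?case by simp
next
  case (insert a A)
  let ?N = "\<lambda>A m. {\<alpha> :: 'a \<Rightarrow> nat. (\<forall>b. b \<notin> A \<longrightarrow> \<alpha> b = 0) \<and> sum \<alpha> A = m}"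
  let ?u = "\<lambda>i \<alpha>. \<alpha>(a := m - i)"
  have fin: "finite (?N A i)" for i
  proof (rule finite_subset)
    show "?N A i \<subseteq> {\<alpha>. \<forall>x. (x \<in> A \<longrightarrow> \<alpha> x \<in> {..i}) \<and> (x \<notin> A \<longrightarrow> \<alpha> x = 0)}"
      using insert.hyps(1) by (auto intro: member_le_sum)
  qed (intro finite_set_of_finite_funs; simp add: insert.hyps)
  have inj: "inj_on (?u i) (?N A i)" for i
  proof (rule inj_onI)
    fix \<alpha> \<beta> assume ab: "\<alpha> \<in> ?N A i" "\<beta> \<in> ?N A i" "?u i \<alpha> = ?u i \<beta>"
    show "\<alpha> = \<beta>"
    proof
      fix b show "\<alpha> b = \<beta> b"
        using fun_cong[OF ab(3), of b] ab(1,2) insert.hyps by (cases "b = a") auto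
    qed
  qed
  have sum_upd: "sum (\<alpha>(a := k)) A = sum \<alpha> A" for \<alpha> :: "'a \<Rightarrow> nat" and k
    using insert.hyps by (intro sum.cong) auto
  have "?N (insert a A) m = (\<Union>i\<in>{..m}. ?u i ` ?N A i)"
  proof (intro set_eqI iffI)
    fix \<alpha> assume \<alpha>: "\<alpha> \<in> ?N (insert a A) m"
    then have s: "\<alpha> a + sum \<alpha> A = m" using insert.hyps by simp
    have "\<alpha>(a := 0) \<in> ?N A (sum \<alpha> A)" using \<alpha> sum_upd[of \<alpha> 0] by auto
    moreover have "\<alpha> = ?u (sum \<alpha> A) (\<alpha>(a := 0))" using s by (simp add: fun_eq_iff)
    ultimately show "\<alpha> \<in> (\<Union>i\<in>{..m}. ?u i ` ?N A i)" using s by (intro UN_I[of "sum \<alpha> A"] image_eqI) auto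
  next
    fix \<alpha> assume "\<alpha> \<in> (\<Union>i\<in>{..m}. ?u i ` ?N A i)"
    then obtain i \<beta> where i: "i \<le> m" "\<beta> \<in> ?N A i" "\<alpha> = ?u i \<beta>" by blast
    have "sum \<alpha> (insert a A) = \<alpha> a + sum \<alpha> A" using insert.hyps by simp
    also have "sum \<alpha> A = sum \<beta> A" unfolding i(3) by (rule sum_upd)
    also have "\<alpha> a + sum \<beta> A = m" using i by simp
    finally have "sum \<alpha> (insert a A) = m" .
    moreover have "\<alpha> b = 0" if "b \<notin> insert a A" for b using i(2) that by (simp add: i(3))
    ultimately show "\<alpha> \<in> ?N (insert a A) m" by (intro CollectI conjI allI impI)
  qed
  moreover have "card (\<Union>i\<in>{..m}. ?u i ` ?N A i) = (\<Sum>i\<le>m. card (?u i ` ?N A i))"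
  proof (rule card_UN_disjoint)
    show "\<forall>i\<in>{..m}. \<forall>j\<in>{..m}. i \<noteq> j \<longrightarrow> ?u i ` ?N A i \<inter> ?u j ` ?N A j = {}"
    proof (intro ballI impI)
      fix i j assume ij: "i \<in> {..m}" "j \<in> {..m}" "i \<noteq> j"
      show "?u i ` ?N A i \<inter> ?u j ` ?N A j = {}"
      proof (rule equals0I)
        fix \<gamma> assume "\<gamma> \<in> ?u i ` ?N A i \<inter> ?u j ` ?N A j"
        then obtain \<alpha> \<beta> where "\<gamma> = ?u i \<alpha>" "\<gamma> = ?u j \<beta>" by (elim IntE imageE) iprover
        from this(1)[THEN fun_cong, of a] this(2)[THEN fun_cong, of a]
        have "\<gamma> a = m - i" "\<gamma> a = m - j" by simp_all
        then show False using ij by auto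
      qed
    qed
  qed (use fin in auto)
  moreover have "(\<Sum>i\<le>m. card (?u i ` ?N A i)) = (\<Sum>i\<le>m. (card A - 1 + i) choose (card A - 1))"
    using insert.IH by (simp add: card_image[OF inj] add.commute)
  ultimately have "card (?N (insert a A) m) = ((card A - 1) + m + 1) choose ((card A - 1) + 1)"
    by (simp only: choose_rising_sum(1))
  moreover obtain q where "card A = Suc q" using insert.hyps by (metis card_0_eq not0_implies_Suc)
  ultimately show ?case using insert.hyps by (simp add: add.commute)
qed

text \<open>The exponent of \<open>e\<close> is 0 or 1, leaving degree \<open>m\<close> or
  \<open>m - 1\<close> to the \<open>p + 1\<close> other coordinates. For \<open>m = 0\<close> the
  second binomial must be 0, which holds for \<open>p \<ge> 1\<close> even with truncated
  subtraction. By Pascal's rule the value is the usual difference of binomials with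
  \<open>n = p + 1\<close>.\<close>

lemma card_exps:
  fixes e :: "'a::euclidean_space"
  assumes e: "e \<in> Basis" and d: "DIM('a) = p + 2" and p: "p \<ge> 1"
  shows "card (exps e m) = ((m + p) choose p) + ((m + p - 1) choose p)"
proof -
  let ?B = "Basis - {e}"
  let ?N = "\<lambda>m. {\<alpha> :: 'a \<Rightarrow> nat. (\<forall>b. b \<notin> ?B \<longrightarrow> \<alpha> b = 0) \<and> sum \<alpha> ?B = m}"
  have cB: "card ?B = p + 1" using e d by (simp add: card_Diff_singleton)
  then have cN: "card (?N i) = (i + p) choose p" for i
    using card_exponents[of ?B i] by (metis (no_types, lifting) One_nat_def add_diff_cancel_right' card.empty finite_Diff finite_Basis add_is_0 zero_neq_one)
  have sB: "sum \<alpha> Basis = \<alpha> e + sum \<alpha> ?B" for \<alpha> :: "'a \<Rightarrow> nat"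
    by (rule sum.remove) (use e in auto)
  have fN: "finite (?N i)" for i
    using cN[of i] by (metis (no_types, lifting) card_ge_0_finite le_add2 zero_less_binomial)
  have sum_upd: "sum (\<alpha>(e := k)) ?B = sum \<alpha> ?B" for \<alpha> :: "'a \<Rightarrow> nat" and k
    by (intro sum.cong) auto
  show ?thesis
  proof (cases m)
    case 0
    then show ?thesis using p by (simp add: exps_0)
  next
    case (Suc i)
    let ?u = "\<lambda>\<alpha>. \<alpha>(e := Suc 0)"
    have "exps e m = ?N m \<union> ?u ` ?N i"
    proof (intro set_eqI iffI)
      fix \<alpha> assume \<alpha>: "\<alpha> \<in> exps e m"
      show "\<alpha> \<in> ?N m \<union> ?u ` ?N i"
      proof (cases "\<alpha> e = 0")
        case True
        then show ?thesis using \<alpha> sB[of \<alpha>] by (auto simp: exps_def)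
      next
        case False
        then have a1: "\<alpha> e = 1" using \<alpha> by (simp add: exps_def)
        then have "\<alpha>(e := 0) \<in> ?N i" using \<alpha> sB[of \<alpha>] Suc by (auto simp: exps_def sum_upd)
        moreover have "\<alpha> = ?u (\<alpha>(e := 0))" using a1 by (simp add: fun_eq_iff)
        ultimately show ?thesis by blast
      qed
    next
      fix \<alpha> assume "\<alpha> \<in> ?N m \<union> ?u ` ?N i"
      then show "\<alpha> \<in> exps e m"
      proof
        assume "\<alpha> \<in> ?N m"
        then show ?thesis using sB[of \<alpha>] by (auto simp: exps_def)
      next
        assume "\<alpha> \<in> ?u ` ?N i"
        then obtain \<beta> where b: "\<beta> \<in> ?N i" "\<alpha> = ?u \<beta>" by blast
        then show ?thesis using sB[of \<alpha>] e Suc by (auto simp: exps_def sum_upd)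
      qed
    qed
    moreover have "?N m \<inter> ?u ` ?N i = {}" by auto
    moreover have "inj_on ?u (?N i)"
    proof (rule inj_onI, rule ext)
      fix \<alpha> \<beta> b assume "\<alpha> \<in> ?N i" "\<beta> \<in> ?N i" "?u \<alpha> = ?u \<beta>"
      then show "\<alpha> b = \<beta> b" by (cases "b = e") (auto, metis fun_upd_other)
    qed
    ultimately show ?thesis
      using cN[of m] cN[of i] Suc fN by (simp add: card_Un_disjoint card_image)
  qed
qed

section \<open>Enumeration of values with multiplicity\<close>

lemma finite_downclosed_nat:
  assumes "finite (S :: nat set)" "\<And>i j. i \<in> S \<Longrightarrow> j \<le> i \<Longrightarrow> j \<in> S"
  shows "S = {..<card S}"
proof (cases "S = {}")
  case False
  then have "S = {..Max S}" using assms by (auto intro: Max_in)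
  then show ?thesis by (metis card_atMost lessThan_Suc_atMost)
qed simp

text \<open>Isolates the combinatorics of the definite description in
  \<open>sphere_eigenvalue\<close>: an increasing sequence of values with positive multiplicities
  has exactly one nondecreasing enumeration, constant on blocks of consecutive indices.\<close>

locale weighted_levels =
  fixes v :: "nat \<Rightarrow> real" and m :: "nat \<Rightarrow> nat" and mult :: "real \<Rightarrow> nat"
  assumes v: "strict_mono v" and m_pos: "\<And>K. m K > 0"
    and mult_v: "\<And>K. mult (v K) = m K" and mult_0: "\<And>x. x \<notin> range v \<Longrightarrow> mult x = 0"
begin

definition cum :: "nat \<Rightarrow> nat" where "cum K = (\<Sum>i<K. m i)"

definition enum :: "nat \<Rightarrow> real" where
  "enum = (THE l. mono l \<and> (\<forall>x. finite {j. l j = x} \<and> card {j. l j = x} = mult x))"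

lemma cum_Suc: "cum (Suc K) = cum K + m K" by (simp add: cum_def)

lemma strict_mono_cum: "strict_mono cum"
  by (rule strict_monoI_Suc) (simp add: cum_Suc m_pos)

definition level :: "nat \<Rightarrow> nat" where "level j = (LEAST K. j < cum (Suc K))"

lemma level_iff: "level j = K \<longleftrightarrow> cum K \<le> j \<and> j < cum (Suc K)"
proof -
  have ex: "j < cum (Suc j)" using strict_mono_imp_increasing[OF strict_mono_cum, of "Suc j"] by simp
  have lt: "j < cum (Suc (level j))" unfolding level_def by (rule LeastI[of _ j]) (rule ex)
  have ge: "cum (level j) \<le> j"
  proof (cases "level j")
    case (Suc K)
    then have "\<not> j < cum (Suc K)" unfolding level_def by (metis lessI not_less_Least)
    then show ?thesis using Suc by simp
  qed (simp add: cum_def)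
  have "K = level j" if "cum K \<le> j" "j < cum (Suc K)"
  proof -
    have "cum K < cum (Suc (level j))" "cum (level j) < cum (Suc K)" using that lt ge by auto
    then show ?thesis using strict_mono_less[OF strict_mono_cum] by simp
  qed
  then show ?thesis using lt ge by auto
qed

lemma mono_level: "mono level"
proof (rule monoI, rule ccontr)
  fix i j :: nat assume ij: "i \<le> j" "\<not> level i \<le> level j"
  then have "cum (Suc (level j)) \<le> cum (level i)"
    using strict_mono_less_eq[OF strict_mono_cum] by simp
  then show False using level_iff[of i "level i"] level_iff[of j "level j"] ij by simp
qed

text \<open>Values outside the range of \<open>v\<close> have empty preimage. By monotonicity the
  indices with \<open>l j \<le> v K\<close> form an initial segment, whose length is the sum of the
  multiplicities up to \<open>K\<close>; consecutive segments locate each index in its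
  block.\<close>

lemma enum_spec_unique:
  assumes l: "mono l" "\<And>x. finite {j. l j = x} \<and> card {j. l j = x} = mult x"
  shows "l j = v (level j)"
proof -
  have rng: "\<exists>K. l j = v K" for j
  proof (rule ccontr)
    assume "\<nexists>K. l j = v K"
    then have "card {i. l i = l j} = 0" using l(2)[of "l j"] mult_0[of "l j"] by auto
    then show False using l(2)[of "l j"] by auto
  qed
  have below: "{j. l j \<le> v K} = {..<cum (Suc K)}" for K
  proof -
    have eq: "{j. l j \<le> v K} = (\<Union>i\<in>{..K}. {j. l j = v i})"
    proof (intro set_eqI iffI)
      fix j assume "j \<in> {j. l j \<le> v K}"
      moreover obtain i where "l j = v i" using rng by blast
      ultimately show "j \<in> (\<Union>i\<in>{..K}. {j. l j = v i})" using strict_mono_less_eq[OF v] by auto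
    qed (use strict_mono_less_eq[OF v] in auto)
    then have "card {j. l j \<le> v K} = (\<Sum>i\<le>K. card {j. l j = v i})"
      unfolding eq using l(2) strict_mono_eq[OF v] by (intro card_UN_disjoint) auto
    also have "\<dots> = cum (Suc K)" using l(2) by (simp add: mult_v cum_def lessThan_Suc_atMost)
    finally have "card {j. l j \<le> v K} = cum (Suc K)" .
    moreover have "finite {j. l j \<le> v K}" unfolding eq using l(2) by auto
    moreover have "i \<in> {j. l j \<le> v K}" if "j \<in> {j. l j \<le> v K}" "i \<le> j" for i j
      using that monoD[OF l(1) that(2)] by auto
    ultimately show ?thesis using finite_downclosed_nat by metis
  qed
  obtain K where K: "l j = v K" using rng by blast
  have "j \<in> {j. l j \<le> v K}" using K by simp
  then have "j < cum (Suc K)" unfolding below by simp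
  moreover have "cum K \<le> j"
  proof (cases K)
    case (Suc i)
    have "\<not> l j \<le> v i" using K Suc strict_mono_less[OF v, of i K] by simp
    then have "j \<notin> {j. l j \<le> v i}" by simp
    then show ?thesis unfolding below Suc by simp
  qed (simp add: cum_def)
  ultimately have "level j = K" by (simp add: level_iff)
  then show ?thesis using K by simp
qed

lemma enum_eq: "enum = (\<lambda>j. v (level j))"
  unfolding enum_def
proof (rule the_equality)
  show "mono (\<lambda>j. v (level j)) \<and>
    (\<forall>x. finite {j. v (level j) = x} \<and> card {j. v (level j) = x} = mult x)"
  proof (intro conjI allI)
    show "mono (\<lambda>j. v (level j))"
      using mono_level strict_mono_mono[OF v] by (auto simp: mono_def)
    fix x
    have "finite {j. v (level j) = x} \<and> card {j. v (level j) = x} = mult x"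
    proof (cases "x \<in> range v")
      case True
      then obtain K where K: "x = v K" by auto
      have "{j. v (level j) = x} = {cum K..<cum (Suc K)}"
        using strict_mono_eq[OF v] level_iff by (auto simp: K)
      then show ?thesis by (simp add: K mult_v cum_Suc)
    next
      case False
      then have "{j. v (level j) = x} = {}" by auto
      then show ?thesis using mult_0[OF False] by (simp only:) simp
    qed
    then show "finite {j. v (level j) = x}" "card {j. v (level j) = x} = mult x" by auto
  qed
next
  fix l :: "nat \<Rightarrow> real" assume "mono l \<and> (\<forall>x. finite {j. l j = x} \<and> card {j. l j = x} = mult x)"
  then show "l = (\<lambda>j. v (level j))" using enum_spec_unique by blast
qed

lemma sum_enum: "r \<le> m K \<Longrightarrow> (\<Sum>j<cum K + r. enum j) = (\<Sum>i<K. real (m i) * v i) + real r * v K"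
proof -
  have step: "(\<Sum>j<cum K + r. enum j) = (\<Sum>j<cum K. enum j) + real r * v K" if r: "r \<le> m K" for K r
  proof -
    have "(\<Sum>j<cum K + r. enum j) = (\<Sum>j<cum K. enum j) + (\<Sum>j\<in>{cum K..<cum K + r}. enum j)"
      by (simp add: lessThan_atLeast0 sum.atLeastLessThan_concat)
    also have "(\<Sum>j\<in>{cum K..<cum K + r}. enum j) = (\<Sum>j\<in>{cum K..<cum K + r}. v K)"
    proof (rule sum.cong[OF refl])
      fix j assume "j \<in> {cum K..<cum K + r}"
      then have "level j = K" using r by (auto simp: level_iff cum_Suc)
      then show "enum j = v K" by (simp add: enum_eq)
    qed
    finally show ?thesis by simp
  qed
  have "(\<Sum>j<cum K. enum j) = (\<Sum>i<K. real (m i) * v i)" for K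
  proof (induction K)
    case (Suc K)
    then show ?case using step[of "m K" K] by (simp add: cum_Suc)
  qed (simp add: cum_def)
  then show "r \<le> m K \<Longrightarrow> ?thesis" using step by simp
qed

text \<open>The level is that of the last index \<open>k\<close>, not of \<open>k + 1\<close>. So a
  completed block gives \<open>r = m K\<close> instead of \<open>r = 0\<close> at the next level,
  and at least one term of level \<open>K\<close> is present.\<close>

lemma level_decomposition:
  obtains K r where "Suc k = cum K + r" "1 \<le> r" "r \<le> m K"
proof -
  have "cum (level k) \<le> k" "k < cum (Suc (level k))" using level_iff[of k "level k"] by auto
  then show ?thesis using that[of "level k" "Suc k - cum (level k)"] by (simp add: cum_Suc)
qed

end

lemma sphere_weighted_levels:
  assumes "DIM('a::euclidean_space) = p + 2" "p \<ge> 1"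
  shows "weighted_levels (lam TYPE('a)) (\<lambda>K. ((K + p) choose p) + ((K + p - 1) choose p)) (eigen_mult TYPE('a))"
proof
  obtain e :: 'a where e: "e \<in> Basis" using nonempty_Basis by blast
  have d: "DIM('a) \<ge> 2" using assms by simp
  show "strict_mono (lam TYPE('a))" using lam_strict_mono[OF d] by (rule strict_monoI)
  show "eigen_mult TYPE('a) (lam TYPE('a) K) = ((K + p) choose p) + ((K + p - 1) choose p)" for K
    by (simp add: eigen_mult_lam[OF e d] card_exps[OF e assms])
qed (use assms eigen_mult_not_lam[where 'a='a] in auto)

section \<open>Volume of the sphere and the Weyl constants\<close>

lemma measure_annulus:
  fixes \<epsilon> :: real
  assumes "0 < \<epsilon>" "\<epsilon> < 1"
  shows "measure lebesgue {y::'a::euclidean_space. infdist y (sphere 0 1) < \<epsilon>}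
     = unit_ball_vol (real DIM('a)) * ((1 + \<epsilon>) ^ DIM('a) - (1 - \<epsilon>) ^ DIM('a))"
proof -
  obtain b :: 'a where b: "b \<in> Basis" using nonempty_Basis by blast
  have inf: "infdist y (sphere 0 1) = \<bar>norm y - 1\<bar>" for y :: 'a
  proof (rule antisym)
    \<comment> \<open>The nearest point is \<open>sgn y\<close>, except at the origin, where
      \<open>sgn\<close> gives 0 and any point of the sphere may be taken.\<close>
    obtain z :: 'a where z: "norm z = 1" "dist y z = \<bar>norm y - 1\<bar>"
    proof (cases "y = 0")
      case True
      then show ?thesis using that[of b] b by simp
    next
      case False
      have "y - sgn y = (norm y - 1) *\<^sub>R sgn y"
        using False by (simp add: sgn_div_norm algebra_simps)
      then have "dist y (sgn y) = \<bar>norm y - 1\<bar>"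
        using False by (simp add: dist_norm norm_sgn)
      then show ?thesis using that[of "sgn y"] False by (simp add: norm_sgn)
    qed
    then show "infdist y (sphere 0 1) \<le> \<bar>norm y - 1\<bar>"
      using infdist_le[of z "sphere 0 1" y] by simp
    show "\<bar>norm y - 1\<bar> \<le> infdist y (sphere 0 1)"
    proof -
      have ne: "sphere (0::'a) 1 \<noteq> {}" using b by (auto intro!: exI[of _ b])
      have "\<bar>norm y - 1\<bar> \<le> dist y z" if "z \<in> sphere 0 1" for z
        using that norm_triangle_ineq3[of y z] by (simp add: dist_norm)
      then show ?thesis unfolding infdist_notempty[OF ne] by (intro cINF_greatest ne)
    qed
  qed
  have "{y::'a. infdist y (sphere 0 1) < \<epsilon>} = ball 0 (1 + \<epsilon>) - cball 0 (1 - \<epsilon>)"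
    unfolding inf by (auto simp: abs_less_iff)
  moreover have "measure lebesgue (ball 0 (1 + \<epsilon>) - cball (0::'a) (1 - \<epsilon>))
      = measure lebesgue (ball (0::'a) (1 + \<epsilon>)) - measure lebesgue (cball (0::'a) (1 - \<epsilon>))"
    using assms by (intro measurable_measure_Diff) auto
  ultimately show ?thesis
    using assms by (simp add: content_ball content_cball right_diff_distrib)
qed

text \<open>The quotient of the shell volume by \<open>2 * \<epsilon>\<close> is a difference
  quotient at 0: \<open>(1 + \<epsilon>) ^ n - (1 - \<epsilon>) ^ n\<close> has derivative
  \<open>2 * n\<close> there, and the two sides of the shell account for the 2.\<close>

lemma hypersurface_volume_sphere:
  "hypersurface_volume (sphere (0::'a::euclidean_space) 1) = real DIM('a) * unit_ball_vol (real DIM('a))"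
proof -
  let ?n = "DIM('a)" and ?V = "unit_ball_vol (real DIM('a))"
  have "((\<lambda>\<epsilon>::real. (1 + \<epsilon>) ^ ?n - (1 - \<epsilon>) ^ ?n) has_real_derivative 2 * real ?n) (at 0)"
    by (auto intro!: derivative_eq_intros)
  then have "((\<lambda>\<epsilon>::real. ((1 + \<epsilon>) ^ ?n - (1 - \<epsilon>) ^ ?n) / \<epsilon>) \<longlongrightarrow> 2 * real ?n) (at_right 0)"
    by (auto simp: DERIV_def intro: tendsto_within_subset)
  from tendsto_mult_left[OF this, of "?V / 2"]
  have "((\<lambda>\<epsilon>::real. ?V * ((1 + \<epsilon>) ^ ?n - (1 - \<epsilon>) ^ ?n) / (2 * \<epsilon>)) \<longlongrightarrow> real ?n * ?V) (at_right 0)"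
    by (simp add: field_simps)
  moreover have "\<forall>\<^sub>F \<epsilon> in at_right (0::real). ?V * ((1 + \<epsilon>) ^ ?n - (1 - \<epsilon>) ^ ?n) / (2 * \<epsilon>)
      = measure lebesgue {y::'a. infdist y (sphere 0 1) < \<epsilon>} / (2 * \<epsilon>)"
    unfolding eventually_at_right_field by (intro exI[of _ 1]) (simp add: measure_annulus)
  ultimately have "((\<lambda>\<epsilon>. measure lebesgue {y::'a. infdist y (sphere 0 1) < \<epsilon>} / (2 * \<epsilon>))
      \<longlongrightarrow> real ?n * ?V) (at_right 0)"
    by (rule Lim_transform_eventually)
  then show ?thesis unfolding hypersurface_volume_def by (intro tendsto_Lim) auto
qed

lemma weyl_constant_S2: "weyl_constant 2 (sphere (0 :: real^3) 1) = 1"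
  by (simp add: weyl_constant_def hypersurface_volume_sphere unit_ball_vol_2 unit_ball_vol_3 powr_one power2_eq_square)

lemma weyl_constant_S4: "weyl_constant 4 (sphere (0 :: real^5) 1) = 2 * sqrt 3"
proof -
  \<comment> \<open>The factors are \<open>pi^2 / 2\<close> and the volume
    \<open>8 * pi^2 / 3\<close> of the four-sphere. Their product is displayed as a square over 3
    because the exponent \<open>2 / 4\<close> is a square root.\<close>
  have eq: "unit_ball_vol 4 * (5 * unit_ball_vol 5) = (2 * pi\<^sup>2)\<^sup>2 / 3"
    by (simp add: unit_ball_vol_4 unit_ball_vol_5 power2_eq_square)
  have "(unit_ball_vol 4 * (5 * unit_ball_vol 5)) powr (1 / 2) = sqrt ((2 * pi\<^sup>2)\<^sup>2 / 3)"
    unfolding eq by (rule powr_half_sqrt) simp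
  also have "\<dots> = 2 * pi\<^sup>2 / sqrt 3"
    by (simp only: real_sqrt_divide real_sqrt_abs) simp
  finally have "(unit_ball_vol 4 * (5 * unit_ball_vol 5)) powr (2 / 4) = 2 * pi\<^sup>2 / sqrt 3" by simp
  then show ?thesis
    by (simp add: weyl_constant_def hypersurface_volume_sphere power2_eq_square)
qed

section \<open>The inequalities\<close>

lemma cos_le_quartic: "cos (x::real) \<le> 1 - x\<^sup>2 / 2 + x ^ 4 / 24"
proof -
  obtain t where "cos x = (\<Sum>m<4. cos_coeff m * x ^ m) + (cos (t + 1/2 * real 4 * pi) / fact 4) * x ^ 4"
    using Maclaurin_cos_expansion[of x 4] by blast
  moreover have "{..<4::nat} = {0, 1, 2, 3}" by auto
  then have "(\<Sum>m<4. cos_coeff m * x ^ m) = 1 - x\<^sup>2 / 2"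
    by (simp only:) (simp add: cos_coeff_def fact_numeral)
  moreover have "cos (t + 1/2 * real 4 * pi) / fact 4 * x ^ 4 \<le> 1 / 24 * x ^ 4"
    by (intro mult_right_mono) (simp_all add: fact_numeral)
  ultimately show ?thesis by simp
qed

lemma cos_ge_sextic: "cos (x::real) \<ge> 1 - x\<^sup>2 / 2 + x ^ 4 / 24 - x ^ 6 / 720"
proof -
  obtain t where "cos x = (\<Sum>m<6. cos_coeff m * x ^ m) + (cos (t + 1/2 * real 6 * pi) / fact 6) * x ^ 6"
    using Maclaurin_cos_expansion[of x 6] by blast
  moreover have "{..<6::nat} = {0, 1, 2, 3, 4, 5}" by auto
  then have "(\<Sum>m<6. cos_coeff m * x ^ m) = 1 - x\<^sup>2 / 2 + x ^ 4 / 24"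
    by (simp only:) (simp add: cos_coeff_def fact_numeral)
  moreover have "cos (t + 1/2 * real 6 * pi) / fact 6 * x ^ 6 \<ge> (- 1 / 720) * x ^ 6"
    by (intro mult_right_mono) (simp_all add: fact_numeral divide_simps)
  ultimately show ?thesis by simp
qed

text \<open>At 16/10 the quartic upper bound of the cosine is already negative, so this point lies
  beyond \<open>pi / 2\<close>.\<close>

lemma pi_less_32: "pi < 32 / 10"
proof (rule ccontr)
  assume "\<not> pi < 32 / 10"
  then have "cos (16 / 10 :: real) \<ge> 0" by (intro cos_ge_zero) auto
  then show False using cos_le_quartic[of "16 / 10"] by (simp add: power_divide)
qed

text \<open>At 31/20 the lower bound of degree six is still positive, so this point lies before
  \<open>pi / 2\<close>.\<close>

lemma pi_greater_31: "31 / 10 < pi"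
proof (rule ccontr)
  assume "\<not> 31 / 10 < pi"
  then have "cos (31 / 20) \<le> cos (pi / 2)" using pi_ge_two by (intro cos_monotone_0_pi_le) auto
  then show False using cos_ge_sextic[of "31 / 20"] by (simp add: power_divide)
qed

text \<open>Equality holds for \<open>s = 0\<close> and \<open>\<bar>s\<bar> = 1/2\<close>; a Taylor bound is used near \<open>0\<close> and the
  bound \<open>sin x \<le> x\<close> near \<open>\<bar>s\<bar> = 1/2\<close>.\<close>
lemma one_minus_cos_pi_ge:
  fixes s :: real
  assumes "\<bar>s\<bar> \<le> 1 / 2"
  shows "4 * s\<^sup>2 + 11 / 10 * s\<^sup>2 * (1 / 4 - s\<^sup>2) \<le> 1 - cos (pi * s)"
proof -
  have pi2: "961 / 100 \<le> pi\<^sup>2" using power_mono[of "31 / 10" pi 2] pi_greater_31 by (simp add: power_divide)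
  have pi2': "pi\<^sup>2 \<le> 1024 / 100" using power_mono[of pi "32 / 10" 2] pi_less_32 by (simp add: power_divide)
  show ?thesis
  proof (cases "\<bar>s\<bar> \<le> 4 / 10")
    case True
    have s2: "s\<^sup>2 \<le> 16 / 100" using power_mono[OF True, of 2] by (simp add: power_divide)
    define a where "a = pi\<^sup>2"
    define y where "y = s\<^sup>2"
    have y: "0 \<le> y" "y \<le> 16 / 100" using s2 by (auto simp: y_def)
    have a: "961 / 100 \<le> a" "a \<le> 1024 / 100" using pi2 pi2' by (auto simp: a_def)
    have "4 + 11 / 10 * (1 / 4 - y) \<le> a / 2 - a\<^sup>2 * y / 24"
    proof -
      \<comment> \<open>Replaces \<open>pi^2\<close> by \<open>(31/10)^2\<close>. The difference of
        \<open>a / 2 - a^2 * y / 24\<close> at the two values is this product divided by 24.\<close>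
      have "(a - 961 / 100) * (12 - y * (a + 961 / 100)) \<ge> 0"
      proof (rule mult_nonneg_nonneg)
        have "y * (a + 961 / 100) \<le> 16 / 100 * 20" using y a by (intro mult_mono) auto
        then show "0 \<le> 12 - y * (a + 961 / 100)" by simp
      qed (use a in simp)
      then have "a / 2 - a\<^sup>2 * y / 24 \<ge> (961 / 100) / 2 - (961 / 100)\<^sup>2 * y / 24"
        by (simp add: field_simps power2_eq_square)
      moreover have "4 + 11 / 10 * (1 / 4 - y) \<le> (961 / 100) / 2 - (961 / 100)\<^sup>2 * y / 24"
        using y by (simp add: power2_eq_square field_simps)
      ultimately show ?thesis by linarith
    qed
    then have "y * (4 + 11 / 10 * (1 / 4 - y)) \<le> y * (a / 2 - a\<^sup>2 * y / 24)"
      using y by (intro mult_left_mono) auto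
    moreover have "(pi * s)\<^sup>2 / 2 - (pi * s) ^ 4 / 24 = y * (a / 2 - a\<^sup>2 * y / 24)"
      by (simp add: y_def a_def power_mult_distrib power2_eq_square eval_nat_numeral algebra_simps)
    ultimately show ?thesis using cos_le_quartic[of "pi * s"] by (simp add: y_def algebra_simps)
  next
    case False
    \<comment> \<open>In terms of \<open>h\<close> both \<open>1 - 4 * s^2 = 4 * h * (1 - h)\<close>
      and \<open>1/4 - s^2 = h * (1 - h)\<close> carry the factor \<open>h\<close>, so the claim
      becomes a comparison of slopes with \<open>32/10\<close>, an upper bound of
      \<open>pi\<close>.\<close>
    define h where "h = 1 / 2 - \<bar>s\<bar>"
    have h: "0 \<le> h" "h \<le> 1 / 10" using assms False by (auto simp: h_def)
    have "cos (pi * s) = cos (pi * \<bar>s\<bar>)" by (simp add: abs_if)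
    also have "\<dots> = sin (pi * h)"
      by (simp add: sin_cos_eq h_def right_diff_distrib)
    also have "\<dots> \<le> pi * h" using h by (intro sin_x_le_x) simp
    also have "\<dots> \<le> (32 / 10) * h" using pi_less_32 h by (intro mult_right_mono) auto
    finally have "cos (pi * s) \<le> (32 / 10) * h" .
    moreover have s2: "s\<^sup>2 = (1 / 2 - h)\<^sup>2" by (simp add: h_def)
    have "4 * s\<^sup>2 + 11 / 10 * s\<^sup>2 * (1 / 4 - s\<^sup>2) = 1 - h * ((1 - h) * (4 - 11 / 10 * (1 / 2 - h)\<^sup>2))"
      unfolding s2 by (simp add: field_simps power2_eq_square)
    moreover have "h * (32 / 10) \<le> h * ((1 - h) * (4 - 11 / 10 * (1 / 2 - h)\<^sup>2))"
    proof (rule mult_left_mono[OF _ h(1)])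
      have "(1 / 2 - h)\<^sup>2 \<le> (1 / 2)\<^sup>2" using h by (intro power_mono) auto
      then have "(9 / 10) * (4 - 11 / 40) \<le> (1 - h) * (4 - 11 / 10 * (1 / 2 - h)\<^sup>2)"
        using h by (intro mult_mono) (auto simp: power_divide)
      then show "32 / 10 \<le> (1 - h) * (4 - 11 / 10 * (1 / 2 - h)\<^sup>2)" by simp
    qed
    ultimately show ?thesis by simp
  qed
qed

section \<open>Averages on the two-sphere\<close>

text \<open>\<open>w = sqrt (x + 1)\<close> lies between \<open>K\<close> and \<open>K + 1\<close>;
  measured from the midpoint by \<open>s\<close>, the sine becomes \<open>cos (pi * s)\<close>. The
  right-hand side is \<open>x + 1 - (r - K)^2\<close> with \<open>r - K = 2 * w * s + q\<close>, so
  it remains to bound \<open>(2 * w * s + q)^2 - 1\<close> by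
  \<open>x * (1 - cos (pi * s))\<close>.\<close>

lemma abs_sin_pi_sqrt_le:
  fixes K r :: nat
  assumes r: "1 \<le> r" "r \<le> 2 * K + 1" and N: "real (K\<^sup>2 + r) = x + 1"
  shows "x * \<bar>sin (pi * sqrt (x + 1))\<bar> \<le> real r * (2 * real K + 1 - real r)"
proof -
  define w where "w = sqrt (x + 1)"
  define s where "s = w - real K - 1 / 2"
  define q where "q = 1 / 4 - s\<^sup>2"
  have x: "x \<ge> 0" using N r by linarith
  have w2: "w\<^sup>2 = (real K)\<^sup>2 + real r" using N x by (simp add: w_def)
  have "real K \<le> w" unfolding w_def by (rule real_le_rsqrt) (use N in simp)
  moreover have "w \<le> real K + 1"
    unfolding w_def by (rule real_le_lsqrt) (use N r x in \<open>auto simp: power2_eq_square algebra_simps\<close>)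
  ultimately have s: "\<bar>s\<bar> \<le> 1 / 2" unfolding s_def by linarith
  have "s\<^sup>2 \<le> (1 / 2)\<^sup>2" using power_mono[OF s, of 2] by simp
  then have q: "q \<ge> 0" "s\<^sup>2 \<le> 1 / 4" by (simp_all add: q_def power_divide)
  have "sin (pi * w) = sin ((pi * s + pi / 2) + real K * pi)"
    by (simp add: s_def algebra_simps)
  also have "\<dots> = cos (pi * s) * (- 1) ^ K"
    by (simp add: sin_add cos_add)
  finally have "\<bar>sin (pi * w)\<bar> = \<bar>cos (pi * s)\<bar>" by (simp add: abs_mult power_abs)
  moreover have "cos (pi * s) \<ge> 0"
    using s mult_left_mono[of s "1/2" pi] mult_left_mono[of "- (1/2)" s pi] by (intro cos_ge_zero) auto
  ultimately have sin: "\<bar>sin (pi * w)\<bar> = cos (pi * s)" by simp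
  have u: "real r - real K = 2 * w * s + q"
    using w2 by (simp add: s_def q_def power2_eq_square field_simps)
  have x': "x = w\<^sup>2 - 1" using x by (simp add: w_def)
  have "(4 * s\<^sup>2 + 11 / 10 * s\<^sup>2 * q) * x \<le> (1 - cos (pi * s)) * x"
    using one_minus_cos_pi_ge[OF s] x by (intro mult_right_mono) (auto simp: q_def)
  moreover have "(2 * w * s + q)\<^sup>2 - 1 \<le> (4 * s\<^sup>2 + 11 / 10 * s\<^sup>2 * q) * x"
  proof -
    define z where "z = w * s"
    \<comment> \<open>The minimum over \<open>z\<close>, at 20/11, leaves 4/11. What is still to be
      subtracted, \<open>11/10 * s^2 + q\<close>, is at most 11/40 for
      \<open>s^2 \<le> 1/4\<close>.\<close>
    have "4 - 4 * z + 11 / 10 * z\<^sup>2 \<ge> 4 - 40 / 11"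
      using zero_le_power2[of "z - 20 / 11"] by (simp add: power2_eq_square field_simps)
    then have "4 + 11 / 10 * (z\<^sup>2 - s\<^sup>2) - 4 * z - q \<ge> 0"
      using q(2) unfolding q_def right_diff_distrib by linarith
    then have "q * (4 + 11 / 10 * (z\<^sup>2 - s\<^sup>2) - 4 * z - q) \<ge> 0"
      using q by (intro mult_nonneg_nonneg)
    moreover have "(4 * s\<^sup>2 + 11 / 10 * s\<^sup>2 * q) * x - ((2 * w * s + q)\<^sup>2 - 1)
        = q * (4 + 11 / 10 * (z\<^sup>2 - s\<^sup>2) - 4 * z - q)"
      by (simp add: x' z_def q_def power2_eq_square field_simps)
    ultimately show ?thesis by simp
  qed
  moreover have "real r * (2 * real K + 1 - real r) = x + 1 - (real r - real K)\<^sup>2"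
    using N by (simp add: power2_eq_square algebra_simps)
  ultimately have "x * cos (pi * s) \<le> real r * (2 * real K + 1 - real r)"
    by (simp add: u algebra_simps)
  then show ?thesis using sin by (simp add: w_def)
qed

lemma S2_eigenvalue_sum:
  assumes "k \<ge> 1"
  obtains K r where "1 \<le> r" "r \<le> 2 * K + 1" "real (K\<^sup>2 + r) = real k + 1"
    "(\<Sum>j=0..k. sphere_eigenvalue TYPE(real^3) j)
      = (real K)\<^sup>2 * ((real K)\<^sup>2 - 1) / 2 + real r * (real K * (real K + 1))"
proof -
  interpret L: weighted_levels "lam TYPE(real^3)" "\<lambda>K. ((K + 1) choose 1) + ((K + 1 - 1) choose 1)"
    "eigen_mult TYPE(real^3)"
    by (rule sphere_weighted_levels) simp_all
  have enum: "L.enum = sphere_eigenvalue TYPE(real^3)" by (simp add: L.enum_def sphere_eigenvalue_def)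
  have lam: "lam TYPE(real^3) i = real i * (real i + 1)" for i by (simp add: lam_def)
  have cum: "L.cum K = K\<^sup>2" for K
    unfolding L.cum_def by (induction K) (simp_all add: power2_eq_square)
  have sum: "(\<Sum>i<K. real (((i + 1) choose 1) + ((i + 1 - 1) choose 1)) * lam TYPE(real^3) i)
      = (real K)\<^sup>2 * ((real K)\<^sup>2 - 1) / 2" for K
    by (induction K) (simp_all add: lam power2_eq_square field_simps)
  obtain K r where Kr: "Suc k = L.cum K + r" "1 \<le> r" "r \<le> ((K + 1) choose 1) + ((K + 1 - 1) choose 1)"
    by (rule L.level_decomposition)
  have "{0..k} = {..<L.cum K + r}" using Kr(1) by auto
  then have "(\<Sum>j=0..k. sphere_eigenvalue TYPE(real^3) j)
      = (real K)\<^sup>2 * ((real K)\<^sup>2 - 1) / 2 + real r * (real K * (real K + 1))"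
    using L.sum_enum[OF Kr(3)] by (simp only: enum[symmetric] sum lam[of K])
  moreover have "real (K\<^sup>2 + r) = real k + 1" using Kr(1) cum by (metis of_nat_Suc add.commute)
  moreover have "r \<le> 2 * K + 1" using Kr(3) by simp
  ultimately show ?thesis by (intro that[OF Kr(2)])
qed

lemma S2_bounds:
  fixes k :: nat
  assumes "k \<ge> 1"
  defines "S \<equiv> \<Sum>j=0..k. sphere_eigenvalue TYPE(real^3) j"
  shows "1/2 * real k + real k / (2 * (real k + 1)) * \<bar>sin (pi * sqrt (real k + 1))\<bar> \<le> 1 / (real k + 1) * S"
    and "1 / (real k + 1) * S \<le> 1/2 * real k + 1/2"
proof -
  obtain K r where r: "1 \<le> r" "r \<le> 2 * K + 1" and N: "real (K\<^sup>2 + r) = real k + 1"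
    and "(\<Sum>j=0..k. sphere_eigenvalue TYPE(real^3) j)
      = (real K)\<^sup>2 * ((real K)\<^sup>2 - 1) / 2 + real r * (real K * (real K + 1))"
    by (rule S2_eigenvalue_sum[OF assms(1)])
  then have S: "S = (real K)\<^sup>2 * ((real K)\<^sup>2 - 1) / 2 + real r * (real K * (real K + 1))"
    by (simp only: S_def)
  have k: "real k = (real K)\<^sup>2 + real r - 1" using N by simp
  have "2 * S - real k * (real k + 1) = real r * (2 * real K + 1 - real r)"
    unfolding S k by (simp add: power2_eq_square field_simps)
  then have low: "real k * (real k + 1) + real k * \<bar>sin (pi * sqrt (real k + 1))\<bar> \<le> 2 * S"
    using abs_sin_pi_sqrt_le[OF r N] by linarith
  have split: "1/2 * x + x / (2 * (x + 1)) * c = 1 / (x + 1) * ((x * (x + 1) + x * c) / 2)"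
    if "x \<ge> 0" for x c :: real
  proof -
    have "1/2 * x = 1 / (x + 1) * (x * (x + 1) / 2)" using that by simp
    moreover have "x / (2 * (x + 1)) * c = 1 / (x + 1) * (x * c / 2)" by simp
    ultimately show ?thesis by (simp only: distrib_left add_divide_distrib)
  qed
  have "1/2 * real k + real k / (2 * (real k + 1)) * \<bar>sin (pi * sqrt (real k + 1))\<bar>
      = 1 / (real k + 1) * ((real k * (real k + 1) + real k * \<bar>sin (pi * sqrt (real k + 1))\<bar>) / 2)"
    by (rule split) simp
  also have "\<dots> \<le> 1 / (real k + 1) * S" using low by (intro mult_left_mono) auto
  finally show "1/2 * real k + real k / (2 * (real k + 1)) * \<bar>sin (pi * sqrt (real k + 1))\<bar> \<le> 1 / (real k + 1) * S" .
  \<comment> \<open>The gap in the upper bound is a perfect square, zero exactly when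
    \<open>r = K\<close>, that is, \<open>k + 1 = K * (K + 1)\<close>.\<close>
  have "(real k + 1)\<^sup>2 - 2 * S = (real K - real r)\<^sup>2"
    unfolding S k by (simp add: power2_eq_square field_simps)
  then have "2 * S \<le> (real k + 1)\<^sup>2" using zero_le_power2[of "real K - real r"] by linarith
  then have "1 / (real k + 1) * S \<le> 1 / (real k + 1) * ((real k + 1)\<^sup>2 / 2)" by (intro mult_left_mono) auto
  also have "\<dots> = 1/2 * real k + 1/2" by (simp add: power2_eq_square field_simps)
  finally show "1 / (real k + 1) * S \<le> 1/2 * real k + 1/2" .
qed

section \<open>Averages on the four-sphere\<close>

text \<open>With \<open>a = l\<^sup>2 / 12\<close>, the slope-\<open>l\<close> line is compared with \<open>16 * N ^ 3 / 3\<close> at the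
  point \<open>N = a\<close>, where \<open>4 * N ^ 3 - a * (3 * N - a)\<^sup>2 = (N - a)\<^sup>2 * (4 * N - a)\<close> vanishes.\<close>
lemma S4_cubic_bound:
  fixes l N :: real
  assumes l: "10 \<le> l" and N: "7 / 10 * (l\<^sup>2 / 12) \<le> N"
  shows "3 * (l * (N - (l + 2)\<^sup>2 / 36))\<^sup>2 \<le> 16 * (N ^ 3 - N\<^sup>2 - 1)"
proof -
  define a where "a = l\<^sup>2 / 12"
  \<comment> \<open>The shift of the actual line:
    \<open>(l + 2)^2 / 36 = (a + \<epsilon>) / 3\<close>. It turns the tangent identity into a
    surplus \<open>4 * a * \<epsilon> * (4 * a + 6 * x - \<epsilon>)\<close>, which has to pay for
    \<open>16 * N^2 + 16\<close>.\<close>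
  define \<epsilon> where "\<epsilon> = (l + 1) / 3"
  define x where "x = N - a"
  have l2: "100 \<le> l\<^sup>2" using power_mono[OF l, of 2] by simp
  have a: "25 / 3 \<le> a" using l2 by (simp add: a_def)
  have \<epsilon>: "11 / 3 \<le> \<epsilon>" using l by (simp add: \<epsilon>_def)
  have \<epsilon>2: "4 * \<epsilon>\<^sup>2 \<le> 65 / 10 * a"
  proof -
    have "(l + 1)\<^sup>2 \<le> (11 / 10 * l)\<^sup>2" using l by (intro power_mono) auto
    then have "(l + 1)\<^sup>2 \<le> 121 / 100 * l\<^sup>2" by (simp add: power_mult_distrib power_divide)
    moreover have "\<epsilon>\<^sup>2 = (l + 1)\<^sup>2 / 9" by (simp add: \<epsilon>_def power_divide)
    ultimately show ?thesis using zero_le_power2[of l] unfolding a_def by linarith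
  qed
  have a2: "16 \<le> 24 / 100 * a\<^sup>2" using power_mono[OF a, of 2] by (simp add: power_divide)
  have x: "- (3 / 10) * a \<le> x" using N by (simp add: x_def a_def)
  have eq: "16 * (N ^ 3 - N\<^sup>2 - 1) - 3 * (l * (N - (l + 2)\<^sup>2 / 36))\<^sup>2
     = 4 * a * \<epsilon> * (4 * a + 6 * x - \<epsilon>) + 4 * x\<^sup>2 * (3 * a + 4 * x) - 16 * (a + x)\<^sup>2 - 16"
    by (simp add: x_def a_def \<epsilon>_def eval_nat_numeral field_simps)
  \<comment> \<open>\<open>22/10 * a\<close> is the least value of \<open>4 * a + 6 * x\<close>
    permitted by \<open>x \<ge> - 3/10 * a\<close>; the inequality is the worst case of the surplus
    and is reused for both signs of \<open>x\<close>.\<close>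
  have main: "4 * a * (\<epsilon> * (22 / 10 * a)) - a * (4 * \<epsilon>\<^sup>2) - 16 * a\<^sup>2 - 16 \<ge> 0"
  proof -
    have "11 / 3 * (a * a) \<le> \<epsilon> * (a * a)" using \<epsilon> by (intro mult_right_mono) auto
    moreover have "a * (4 * \<epsilon>\<^sup>2) \<le> a * (65 / 10 * a)" using \<epsilon>2 a by (intro mult_left_mono) auto
    ultimately show ?thesis using a2 by (simp add: power2_eq_square algebra_simps)
  qed
  have "0 \<le> 4 * a * \<epsilon> * (4 * a + 6 * x - \<epsilon>) + 4 * x\<^sup>2 * (3 * a + 4 * x) - 16 * (a + x)\<^sup>2 - 16"
  proof (cases "x \<le> 0")
    case True
    have "4 * a * (\<epsilon> * (22 / 10 * a)) \<le> 4 * a * (\<epsilon> * (4 * a + 6 * x))"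
      using x a \<epsilon> by (intro mult_left_mono) auto
    moreover have "0 \<le> 4 * x\<^sup>2 * (3 * a + 4 * x)" using x a by (intro mult_nonneg_nonneg) auto
    moreover have "(a + x)\<^sup>2 \<le> a\<^sup>2" using x a True by (intro power_mono) auto
    ultimately show ?thesis using main by (simp add: power2_eq_square algebra_simps)
  next
    case False
    have "4 * a * (\<epsilon> * (22 / 10 * a)) \<le> 4 * a * (\<epsilon> * (4 * a))"
      using a \<epsilon> by (intro mult_left_mono) auto
    moreover have "32 * (a * x) \<le> 24 * \<epsilon> * (a * x)" using False a \<epsilon> by (intro mult_right_mono) auto
    moreover have "16 * x\<^sup>2 \<le> 4 * (3 * a + 4 * x) * x\<^sup>2" using False a by (intro mult_right_mono) auto
    ultimately show ?thesis using main by (simp add: power2_eq_square algebra_simps)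
  qed
  then show ?thesis using eq by linarith
qed

text \<open>The target inequality cleared of roots, up to a discarded square. At
  \<open>k = 1\<close> it is an equality, \<open>3 * 4^2 = 16 * (4 - 1)\<close>.\<close>

lemma S4_eigenvalue_sum_bound:
  assumes "k \<ge> 1"
  defines "S \<equiv> \<Sum>j=0..k. sphere_eigenvalue TYPE(real^5) j"
  shows "0 \<le> S" and "3 * S\<^sup>2 \<le> 16 * (real k * (real k + 1)\<^sup>2 - 1)"
proof -
  interpret L: weighted_levels "lam TYPE(real^5)" "\<lambda>K. ((K + 3) choose 3) + ((K + 3 - 1) choose 3)"
    "eigen_mult TYPE(real^5)"
    by (rule sphere_weighted_levels) simp_all
  have enum: "L.enum = sphere_eigenvalue TYPE(real^5)" by (simp add: L.enum_def sphere_eigenvalue_def)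
  have lam: "lam TYPE(real^5) i = real i * (real i + 3)" for i by (simp add: lam_def)
  have choose3: "6 * real (n + 2 choose 3) = real n * (real n + 1) * (real n + 2)" for n
  proof (induction n)
    case (Suc n)
    have "real (n + 2 choose 2) = (real n + 2) * (real n + 1) / 2"
      by (induction n) (simp_all add: eval_nat_numeral field_simps)
    then show ?case using Suc by (simp add: eval_nat_numeral field_simps)
  qed (simp add: eval_nat_numeral)
  have m: "real (((K + 3) choose 3) + ((K + 3 - 1) choose 3)) = (real K + 1) * (real K + 2) * (2 * real K + 3) / 6" for K
    using choose3[of K] choose3[of "Suc K"] by (simp add: eval_nat_numeral field_simps)
  have cum: "12 * real (L.cum K) = real K * (real K + 1)\<^sup>2 * (real K + 2)" for K
    unfolding L.cum_def of_nat_sum m by (induction K) (simp_all add: power2_eq_square field_simps)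
  have sum: "(\<Sum>i<K. real (((i + 3) choose 3) + ((i + 3 - 1) choose 3)) * lam TYPE(real^5) i)
      = (real K - 1) * real K * (real K + 1)\<^sup>2 * (real K + 2) * (real K + 3) / 18" for K
    unfolding m lam by (induction K) (simp_all add: power2_eq_square field_simps)
  obtain K r where Kr: "Suc k = L.cum K + r" "1 \<le> r" "r \<le> ((K + 3) choose 3) + ((K + 3 - 1) choose 3)"
    by (rule L.level_decomposition)
  define N where "N = real k + 1"
  define l where "l = real K * (real K + 3)"
  have N: "N = real (L.cum K) + real r" 
    using arg_cong[OF Kr(1), of real] by (simp only: N_def of_nat_Suc of_nat_add)
  have "{0..k} = {..<L.cum K + r}" using Kr(1) by auto
  then have "S = (real K - 1) * real K * (real K + 1)\<^sup>2 * (real K + 2) * (real K + 3) / 18 + real r * l"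
    unfolding S_def l_def using L.sum_enum[OF Kr(3)] by (simp only: enum[symmetric] sum lam[of K])
  moreover have "real r = N - real K * (real K + 1)\<^sup>2 * (real K + 2) / 12" using N cum[of K] by simp
  \<comment> \<open>Because \<open>l + 2 = (K + 1) * (K + 2)\<close>, the full levels and the
    incomplete one combine to an expression in \<open>l\<close> and \<open>N\<close> alone.\<close>
  ultimately have S: "S = l * (N - (l + 2)\<^sup>2 / 36)"
    by (simp add: l_def power2_eq_square field_simps)
  have "0 \<le> L.enum j" for j by (simp add: L.enum_eq lam)
  then show "0 \<le> S" unfolding S_def enum by (intro sum_nonneg)
  have "3 * S\<^sup>2 \<le> 16 * (N ^ 3 - N\<^sup>2 - 1)"
  proof -
    have N2: "N \<ge> 2" using assms(1) by (simp add: N_def)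
    \<comment> \<open>Level 0 holds a single index and cannot contain \<open>k \<ge> 1\<close>. At
      level 1 the bound is attained for \<open>N = 2\<close>, so the difference is factored exactly,
      with root 2; from level 2 on there is room for estimates.\<close>
    consider "K = 0" | "K = 1" | "K \<ge> 2" by linarith
    then show ?thesis
    proof cases
      case 1
      have "real r \<le> (real K + 1) * (real K + 2) * (2 * real K + 3) / 6"
        unfolding m[symmetric] using Kr(3) by (simp only: of_nat_le_iff)
      then have "N \<le> 1" unfolding N using cum[of K] by (simp only: 1) simp
      then show ?thesis using N2 by simp
    next
      case 2
      then have S1: "S = 4 * (N - 1)" using S by (simp add: l_def)
      have "0 \<le> (N - 2) * (N\<^sup>2 - 2 * N + 2)"
        using N2 zero_le_power2[of "N - 1"] by (intro mult_nonneg_nonneg) (auto simp: power2_eq_square algebra_simps)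
      then show ?thesis unfolding S1 by (simp add: power2_eq_square eval_nat_numeral algebra_simps)
    next
      case 3
      define j where "j = real K - 2"
      have j: "0 \<le> j" "real K = j + 2" using 3 by (auto simp: j_def)
      have "2 * 5 \<le> real K * (real K + 3)" using 3 by (intro mult_mono) auto
      then have l10: "10 \<le> l" by (simp add: l_def)
      \<comment> \<open>\<open>12 * cum K / l^2\<close> is smallest at \<open>K = 2\<close>, where
        it is 72/100; this is the source of 7/10. The expansion in \<open>j = K - 2\<close> has
        nonnegative coefficients.\<close>
      have "0 \<le> real K * (1 + j * (15 / 10 + j * (16 / 10 + j * (3 / 10))))"
        using j by (intro mult_nonneg_nonneg add_nonneg_nonneg) auto
      also have "\<dots> = real K * (real K + 1)\<^sup>2 * (real K + 2) - 7 / 10 * l\<^sup>2"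
        unfolding l_def j(2) by (simp add: power2_eq_square field_simps)
      finally have "7 / 10 * (l\<^sup>2 / 12) \<le> N" using N cum[of K] by simp
      then show ?thesis unfolding S by (rule S4_cubic_bound[OF l10])
    qed
  qed
  also have "16 * (N ^ 3 - N\<^sup>2 - 1) = 16 * (real k * (real k + 1)\<^sup>2 - 1)"
    unfolding N_def by (simp add: power2_eq_square eval_nat_numeral algebra_simps)
  finally show "3 * S\<^sup>2 \<le> 16 * (real k * (real k + 1)\<^sup>2 - 1)" .
qed

text \<open>Multiplying by \<open>d = sqrt (3 * k)\<close> turns the claim into
  \<open>d * S / N \<le> 4 * k - 2 / N^2\<close> with a nonnegative right-hand side, so it may be
  squared.\<close>

lemma S4_bound:
  fixes k :: nat
  assumes k: "k \<ge> 1"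
  defines "S \<equiv> \<Sum>j=0..k. sphere_eigenvalue TYPE(real^5) j"
  shows "1 / (real k + 1) * S
    \<le> 2/3 * (2 * sqrt 3) * real k powr (1/2) - 2 / (sqrt (3 * real k) * (real k + 1)\<^sup>2)"
proof -
  define N where "N = real k + 1"
  define d where "d = sqrt (3 * real k)"
  have d: "d > 0" "d\<^sup>2 = 3 * real k" using k by (simp_all add: d_def)
  have N: "N \<ge> 2" using k by (simp add: N_def)
  have S: "0 \<le> S" "3 * S\<^sup>2 \<le> 16 * (real k * N\<^sup>2 - 1)"
    using S4_eigenvalue_sum_bound[OF k] unfolding S_def N_def by auto
  have "d * S / N \<le> 4 * real k - 2 / N\<^sup>2"
  proof (rule power2_le_imp_le)
    have "1 \<le> N\<^sup>2" using N by (simp add: one_le_power)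
    then have "2 / N\<^sup>2 \<le> 2" by (simp add: divide_le_eq)
    then show "0 \<le> 4 * real k - 2 / N\<^sup>2" using k by linarith
    have "(d * S / N)\<^sup>2 = real k / N\<^sup>2 * (3 * S\<^sup>2)"
      by (simp add: power_mult_distrib power_divide d)
    also have "\<dots> \<le> real k / N\<^sup>2 * (16 * (real k * N\<^sup>2 - 1))"
      by (rule mult_left_mono[OF S(2)]) simp
    \<comment> \<open>Completing the square: the cross term of \<open>4 * k\<close> and
      \<open>2 / N^2\<close> is what the \<open>- 1\<close> in the squared bound provides, and the
      leftover \<open>(2 / N^2)^2\<close> is dropped.\<close>
    also have "\<dots> = (4 * real k - 2 / N\<^sup>2)\<^sup>2 - (2 / N\<^sup>2)\<^sup>2"
      using N by (simp add: power2_eq_square field_simps)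
    also have "\<dots> \<le> (4 * real k - 2 / N\<^sup>2)\<^sup>2" by simp
    finally show "(d * S / N)\<^sup>2 \<le> (4 * real k - 2 / N\<^sup>2)\<^sup>2" .
  qed
  then have "d * S / N / d \<le> (4 * real k - 2 / N\<^sup>2) / d" using d by (intro divide_right_mono) auto
  also have "(4 * real k - 2 / N\<^sup>2) / d = 4 * real k / d - 2 / (d * N\<^sup>2)"
    by (simp add: diff_divide_distrib mult.commute)
  also have "4 * real k / d = 4 / 3 * d" using d by (simp add: field_simps power2_eq_square)
  also have "4 / 3 * d = 2/3 * (2 * sqrt 3) * real k powr (1/2)"
    by (simp add: d_def real_sqrt_mult powr_half_sqrt)
  finally show ?thesis using d by (simp add: N_def d_def)
qed

theorem theorem7:
  fixes k :: nat
  assumes "k \<ge> 1"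
  shows "(1/2 * weyl_constant 2 (sphere (0 :: real^3) 1) * real k
           + real k / (2 * (real k + 1)) * \<bar>sin (pi * sqrt (real k + 1))\<bar>
         \<le> 1 / (real k + 1) * (\<Sum>j=0..k. sphere_eigenvalue TYPE(real^3) j))
       \<and> (1 / (real k + 1) * (\<Sum>j=0..k. sphere_eigenvalue TYPE(real^3) j)
         \<le> 1/2 * weyl_constant 2 (sphere (0 :: real^3) 1) * real k + 1/2)
       \<and> (1 / (real k + 1) * (\<Sum>j=0..k. sphere_eigenvalue TYPE(real^5) j)
         \<le> 2/3 * weyl_constant 4 (sphere (0 :: real^5) 1) * real k powr (1/2)
           - 2 / (sqrt (3 * real k) * (real k + 1)\<^sup>2))"
  unfolding weyl_constant_S2 weyl_constant_S4 mult_1_right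
  using S2_bounds[OF assms] S4_bound[OF assms] by (intro conjI)

end
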